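(* Let $T$ be any one of the three sets $\left(-\frac12,-\frac14\right)\cup\left(\frac14,\frac12\right)$, $\left(-\frac14,0\right)\cup\left(\frac14,\frac12\right)$, $\left(-\frac12,-\frac14\right)\cup\left(0,\frac14\right)$. Let $h$ be absolutely monotone with $h^{(8)}>0$ in $(-1,1)$, and let $C\subset\mathbb{S}^{22}$ be a $T$-avoiding spherical code with $|C|=93150$. Then $$E_h(C)\ \ge\ \mathcal{E}_h(23,93150;T)=93150\left(2464\left(h\!\left(-\tfrac12\right)+h\!\left(\tfrac12\right)\right)+22528\left(h\!\left(-\tfrac14\right)+h\!\left(\tfrac14\right)\right)+43164\,h(0)+h(-1)\right).$$ Equality $E_h(C)=\mathcal{E}_h(23,93150;T)$ is attained when $C$ is a spherical $7$-design with $I(C)=\{-1,-\frac12,-\frac14,0,\frac14,\frac12\}$ (and hence a distance-invariant code) and with distance distribution $(1,2464,22528,43164,22528,2464)$. In particular, the code $C_0$ is $T$-avoiding universally optimal on $\mathbb{S}^{22}$.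
   Context: A spherical code is a finite set $C\subset\mathbb{S}^{n-1}$; $I(C)=\{x\cdot y: x,y\in C,\ x\ne y\}$. For $T\subset[-1,1)$, $C$ is $T$-avoiding if $I(C)\cap T=\varnothing$. A spherical $\tau$-design is a spherical code $C$ such that the average over $C$ of every polynomial in $n$ variables of total degree at most $\tau$ equals its average over $\mathbb{S}^{n-1}$ with respect to normalized surface measure. A potential is a function $h:[-1,1)\to(-\infty,+\infty)$, continuous on $[-1,1)$; it is absolutely monotone if $h^{(j)}\ge0$ for all $j\ge1$ (on $(-1,1)$). The $h$-energy is $E_h(C)=\sum_{x\neq y\in C}h(x\cdot y)$ (sum over ordered pairs). $\mathcal{E}_h(n,N;T)$ is the minimum of $E_h(C)$ over all $T$-avoiding spherical codes $C\subset\mathbb{S}^{n-1}$ with $|C|=N$. For $T$ open, a code $C\subset\mathbb{S}^{n-1}$ is $T$-avoiding universally optimal if it is $T$-avoiding and, for every absolutely monotone $h$, it minimizes $E_h$ among all $T$-avoiding codes on $\mathbb{S}^{n-1}$ of cardinality $|C|$. A code $C$ is distance invariant if for each $t\in I(C)$ the number $A_t=|\{y\in C: x\cdot y=t\}|$ does not depend on $x\in C$; its distance distribution is the tuple $(A_t)$ listed in increasing order of $t\in I(C)$. The code $C_0$: let $L\subset\mathbb{S}^{23}$ be the set of the $196560$ minimal vectors of the Leech lattice rescaled to unit length. Fix $x\in L$; $C_0=\{y\in L: x\cdot y=0\}$, regarded as a subset of the unit sphere $\mathbb{S}^{22}$ of $x^\perp\cong\mathbb{R}^{23}$. It is an antipodal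 spherical $7$-design with $93150$ points, with the inner products and distance distribution listed in the claim. *)

theory Defs
  imports "HOL-Analysis.Analysis"
begin

section \<open>Spherical codes and designs\<close>

definition spherical_code :: "(real^'n) set \<Rightarrow> bool" where
  "spherical_code C \<longleftrightarrow> finite C \<and> C \<subseteq> sphere 0 1"

definition inner_products :: "(real^'n) set \<Rightarrow> real set" where
  "inner_products C = {x \<bullet> y |x y. x \<in> C \<and> y \<in> C \<and> x \<noteq> y}"

definition avoiding :: "real set \<Rightarrow> (real^'n) set \<Rightarrow> bool" where
  "avoiding T C \<longleftrightarrow> inner_products C \<inter> T = {}"

text \<open>Real polynomial functions in the coordinates of total degree at most \<open>d\<close>;
  \<open>\<alpha>\<close> ranges over exponent vectors.\<close>
definition polynomials_upto :: "nat \<Rightarrow> (real^'n \<Rightarrow> real) set" where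
  "polynomials_upto d =
    {p. \<exists>A c. finite A \<and> (\<forall>\<alpha>\<in>A. (\<Sum>i\<in>UNIV. \<alpha> i) \<le> d) \<and>
        p = (\<lambda>x. \<Sum>\<alpha>\<in>A. c \<alpha> * (\<Prod>i\<in>UNIV. (x $ i) ^ (\<alpha> i :: nat)))}"

text \<open>Normalized surface measure on the unit sphere, through polar coordinates: the measure of
  a subset \<open>E\<close> of the sphere is the volume of the cone of all \<open>t *\<^sub>R x\<close> with \<open>0 < t < 1\<close>
  and \<open>x \<in> E\<close>, divided by the volume of the ball. Here \<^term>\<open>sgn x\<close> is \<open>x /\<^sub>R norm x\<close>;
  the origin, which it maps to \<open>0\<close>, is a null set.\<close>
definition sphere_measure :: "(real^'n) measure" where
  "sphere_measure = distr (uniform_measure lborel (ball 0 1)) borel sgn"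

definition spherical_design :: "nat \<Rightarrow> (real^'n) set \<Rightarrow> bool" where
  "spherical_design d C \<longleftrightarrow> spherical_code C \<and>
    (\<forall>p\<in>polynomials_upto d. (\<Sum>x\<in>C. p x) / real (card C) = integral\<^sup>L sphere_measure p)"

definition distance_invariant :: "(real^'n) set \<Rightarrow> bool" where
  "distance_invariant C \<longleftrightarrow>
    (\<forall>t\<in>inner_products C. \<forall>x\<in>C. \<forall>x'\<in>C. card {y\<in>C. x \<bullet> y = t} = card {y\<in>C. x' \<bullet> y = t})"

definition has_distance_distribution :: "(real^'n) set \<Rightarrow> nat list \<Rightarrow> bool" where
  "has_distance_distribution C as \<longleftrightarrow> distance_invariant C \<and>
    (\<forall>x\<in>C. map (\<lambda>t. card {y\<in>C. x \<bullet> y = t}) (sorted_list_of_set (inner_products C)) = as)"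


section \<open>Energy\<close>

text \<open>Potentials are total functions of which only the values on \<open>[-1, 1)\<close> are used.\<close>
definition absolutely_monotone :: "(real \<Rightarrow> real) \<Rightarrow> bool" where
  "absolutely_monotone h \<longleftrightarrow> continuous_on {-1..<1} h \<and>
    (\<forall>j. \<forall>t\<in>{-1<..<1}. (deriv ^^ j) h differentiable (at t)) \<and>
    (\<forall>j\<ge>1. \<forall>t\<in>{-1<..<1}. (deriv ^^ j) h t \<ge> 0)"

definition energy :: "(real \<Rightarrow> real) \<Rightarrow> (real^'n) set \<Rightarrow> real" where
  "energy h C = (\<Sum>x\<in>C. \<Sum>y\<in>C - {x}. h (x \<bullet> y))"

text \<open>A genuine minimum (not an infimum); the dimension is given by the index type.\<close>
definition min_energy :: "'n::finite itself \<Rightarrow> (real \<Rightarrow> real) \<Rightarrow> nat \<Rightarrow> real set \<Rightarrow> real" where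
  "min_energy _ h N T =
    (LEAST e. \<exists>C :: (real^'n) set. spherical_code C \<and> avoiding T C \<and> card C = N \<and> e = energy h C)"

definition universally_optimal :: "real set \<Rightarrow> (real^'n) set \<Rightarrow> bool" where
  "universally_optimal T C \<longleftrightarrow> spherical_code C \<and> avoiding T C \<and>
    (\<forall>h. absolutely_monotone h \<longrightarrow>
      (\<forall>C' :: (real^'n) set. spherical_code C' \<and> avoiding T C' \<and> card C' = card C \<longrightarrow>
        energy h C \<le> energy h C'))"


section \<open>The Leech lattice\<close>

text \<open>The 24 coordinates are indexed by the projective line over the field with 23 elements,
  with \<^term>\<open>None\<close> as the point at infinity. The binary Golay code is the extended quadratic
  residue code: the span, under symmetric difference, of the 23 translates of the set of
  nonsquares together with infinity. Codewords are represented by their supports.\<close>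
definition golay_generator :: "23 \<Rightarrow> 23 option set" where
  "golay_generator i = insert None (Some ` {n + i |n. n \<notin> range (\<lambda>k. k * k)})"

definition golay_code :: "23 option set set" where
  "golay_code = {{a. odd (card {i\<in>J. a \<in> golay_generator i})} |J. True}"

text \<open>Conway and Sloane's standard coordinates.\<close>
definition leech_lattice :: "(real^(23 option)) set" where
  "leech_lattice =
    {(1 / sqrt 8) *\<^sub>R (\<chi> a. of_int (z a)) |z :: 23 option \<Rightarrow> int. \<exists>m :: int.
       (\<forall>a. z a mod 2 = m mod 2) \<and>
       (\<Sum>a\<in>UNIV. z a) mod 8 = 4 * m mod 8 \<and>
       (\<forall>k\<in>{0..<4}. {a. z a mod 4 = k} \<in> golay_code)}"

definition minimal_vectors :: "(real^'n) set \<Rightarrow> (real^'n) set" where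
  "minimal_vectors \<Lambda> = {v\<in>\<Lambda> - {0}. \<forall>w\<in>\<Lambda> - {0}. norm v \<le> norm w}"

definition leech_kissing :: "(real^(23 option)) set" where
  "leech_kissing = (\<lambda>v. v /\<^sub>R norm v) ` minimal_vectors leech_lattice"

text \<open>An isometric identification of \<open>\<real>\<^sup>n\<close> with the hyperplane orthogonal to \<open>x\<close>.\<close>
definition hyperplane_coordinates :: "real^'m \<Rightarrow> (real^'n \<Rightarrow> real^'m) \<Rightarrow> bool" where
  "hyperplane_coordinates x \<phi> \<longleftrightarrow>
    linear \<phi> \<and> (\<forall>u. norm (\<phi> u) = norm u) \<and> range \<phi> = {y. x \<bullet> y = 0}"

lemma hyperplane_coordinates_exist:
  fixes x :: "real^(23 option)"
  assumes "x \<noteq> 0"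
  shows "\<exists>\<phi> :: real^23 \<Rightarrow> real^(23 option). hyperplane_coordinates x \<phi>"
proof -
  have "dim (UNIV :: (real^23) set) = dim {y. x \<bullet> y = 0}"
    using dim_hyperplane[OF assms] by simp
  then obtain f :: "real^23 \<Rightarrow> real^(23 option)" where
    "linear f" "range f = {y. x \<bullet> y = 0}" "\<And>u. u \<in> UNIV \<Longrightarrow> norm (f u) = norm u"
    using isometry_subspaces[OF subspace_UNIV subspace_hyperplane] by metis
  then show ?thesis
    unfolding hyperplane_coordinates_def by blast
qed

text \<open>The code \<open>C\<^sub>0\<close> attached to \<open>x\<close>, in the ambient 24-dimensional space.\<close>
definition leech_section :: "real^(23 option) \<Rightarrow> (real^(23 option)) set" where
  "leech_section x = {y\<in>leech_kissing. x \<bullet> y = 0}"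

end

theory Submission
  imports Defs "HOL-Computational_Algebra.Polynomial"
begin

text \<open>
  The lower bound is the Delsarte-Yudin linear programming bound. The Hermite interpolation polynomial
  of \<open>h\<close> at the six inner products, with one of them (chosen according to \<open>T\<close>) taken twice, lies below
  \<open>h\<close> off \<open>T\<close>; its Newton coefficients are divided differences of \<open>h\<close>, hence nonnegative, and the Newton
  basis polynomials have nonnegative Gegenbauer coefficients.

  Equality requires the distance distribution of the code orthogonal to a minimal vector of the Leech
  lattice, for every minimal vector. No transitivity of the automorphism group is used: the \<open>196560\<close>
  minimal vectors attain the linear programming bound in dimension 24, so they form a design, and
  the design equations determine the distribution. The count rests on the Golay code having no word of
  weight 4; the second and fourth moments of its weights then give its size and the number of octads.
\<close>

section \<open>Zonal harmonics and positive definiteness of Gegenbauer polynomials\<close>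

text \<open>Staying below \<open>h\<close> on the whole interval would require a double contact at
  each of the five inner products above -1, hence a polynomial of degree 10, while averages over the
  code are controlled only up to degree 7. With a single doubled node the degree is 6. The sign of
  the interpolation error is then wrong exactly on two gaps between neighbouring nodes, and these
  two gaps are \<open>T\<close>. The bound is sharp because the distance distribution, with weight 1
  at the inner product 1, is a quadrature formula exact up to degree 6.

  In dimension 24, positive definiteness bounds the number of vectors from above and explicit
  vectors bound it from below. The two bounds agree, so every Gegenbauer sum of degree 2, 4, 6, 8
  vanishes; together with antipodality this gives all the moments used later.

  Positive definiteness is derived algebraically, from a Gram matrix for the Fischer product; the
  surface measure enters only for the distance invariance of designs.\<close>

text \<open>A polynomial is represented by its coefficients, as a function of the exponent vector.
  Multiplication by a variable and the corresponding partial derivative are adjoint for the Fischer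
  product, which is taken on the homogeneous components of a given degree.\<close>

definition degs :: "nat \<Rightarrow> ('n::finite \<Rightarrow> nat) set" where
  "degs k = {\<alpha>. sum \<alpha> UNIV = k}"

definition times_var :: "'n \<Rightarrow> (('n::finite \<Rightarrow> nat) \<Rightarrow> real) \<Rightarrow> ('n \<Rightarrow> nat) \<Rightarrow> real" where
  "times_var i p \<alpha> = (if \<alpha> i = 0 then 0 else p (\<alpha>(i := \<alpha> i - 1)))"

definition partial :: "'n \<Rightarrow> (('n::finite \<Rightarrow> nat) \<Rightarrow> real) \<Rightarrow> ('n \<Rightarrow> nat) \<Rightarrow> real" where
  "partial i p \<alpha> = real (Suc (\<alpha> i)) * p (\<alpha>(i := Suc (\<alpha> i)))"

definition fischer :: "nat \<Rightarrow> (('n::finite \<Rightarrow> nat) \<Rightarrow> real) \<Rightarrow> (('n \<Rightarrow> nat) \<Rightarrow> real) \<Rightarrow> real" where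
  "fischer k p q = (\<Sum>\<alpha>\<in>degs k. (\<Prod>i\<in>UNIV. fact (\<alpha> i)) * p \<alpha> * q \<alpha>)"

definition times_linear :: "real^'n \<Rightarrow> (('n::finite \<Rightarrow> nat) \<Rightarrow> real) \<Rightarrow> ('n \<Rightarrow> nat) \<Rightarrow> real" where
  "times_linear x p \<alpha> = (\<Sum>i\<in>UNIV. x $ i * times_var i p \<alpha>)"

definition times_norm2 :: "(('n::finite \<Rightarrow> nat) \<Rightarrow> real) \<Rightarrow> ('n \<Rightarrow> nat) \<Rightarrow> real" where
  "times_norm2 p \<alpha> = (\<Sum>i\<in>UNIV. times_var i (times_var i p) \<alpha>)"

definition directional :: "real^'n \<Rightarrow> (('n::finite \<Rightarrow> nat) \<Rightarrow> real) \<Rightarrow> ('n \<Rightarrow> nat) \<Rightarrow> real" where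
  "directional x p \<alpha> = (\<Sum>i\<in>UNIV. x $ i * partial i p \<alpha>)"

definition laplacian :: "(('n::finite \<Rightarrow> nat) \<Rightarrow> real) \<Rightarrow> ('n \<Rightarrow> nat) \<Rightarrow> real" where
  "laplacian p \<alpha> = (\<Sum>i\<in>UNIV. partial i (partial i p) \<alpha>)"

section \<open>Adjointness for the Fischer product\<close>

lemma finite_degs: "finite (degs k :: ('n::finite \<Rightarrow> nat) set)"
proof (rule finite_subset)
  show "degs k \<subseteq> (PiE UNIV (\<lambda>_. {..k}) :: ('n \<Rightarrow> nat) set)"
  proof
    fix \<alpha> :: "'n \<Rightarrow> nat" assume "\<alpha> \<in> degs k"
    then have "sum \<alpha> UNIV = k" by (simp add: degs_def)
    then have "\<alpha> i \<le> k" for i using member_le_sum[of i UNIV \<alpha>] by simp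
    then show "\<alpha> \<in> PiE UNIV (\<lambda>_. {..k})" by auto
  qed
qed (auto intro: finite_PiE)

lemma sum_upd_Suc:
  fixes \<beta> :: "'n::finite \<Rightarrow> nat"
  shows "sum (\<beta>(i := Suc (\<beta> i))) UNIV = Suc (sum \<beta> UNIV)"
proof -
  have "sum (\<beta>(i := Suc (\<beta> i))) (UNIV - {i}) = sum \<beta> (UNIV - {i})"
    by (rule sum.cong) auto
  then show ?thesis by (simp add: sum.remove[of UNIV i])
qed

lemma prod_fact_upd_Suc:
  fixes \<beta> :: "'n::finite \<Rightarrow> nat"
  shows "(\<Prod>j\<in>UNIV. fact ((\<beta>(i := Suc (\<beta> i))) j) :: real) = real (Suc (\<beta> i)) * (\<Prod>j\<in>UNIV. fact (\<beta> j))"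
proof -
  have "(\<Prod>j\<in>UNIV - {i}. fact ((\<beta>(i := Suc (\<beta> i))) j) :: real) = (\<Prod>j\<in>UNIV - {i}. fact (\<beta> j))"
    by (rule prod.cong) auto
  then show ?thesis by (simp add: prod.remove[of UNIV i])
qed

lemma fischer_commute: "fischer k p q = fischer k q p"
  by (simp add: fischer_def mult_ac)

text \<open>Raising the exponent of \<open>i\<close> by one matches the terms of the two sums, and
  the factorial weight changes by exactly the factor that \<open>partial\<close> carries. Exponent
  vectors with \<open>\<alpha> i = 0\<close> contribute nothing on the left.\<close>

lemma fischer_times_var: "fischer (Suc k) (times_var i p) q = fischer k p (partial i q)"
proof -
  let ?up = "\<lambda>\<beta>. \<beta>(i := Suc (\<beta> i))"
  let ?f = "\<lambda>\<alpha>. (\<Prod>j\<in>UNIV. fact (\<alpha> j)) * times_var i p \<alpha> * q \<alpha>"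
  have inj: "inj_on ?up (degs k)"
    by (rule inj_on_inverseI[where g = "\<lambda>\<alpha>. \<alpha>(i := \<alpha> i - 1)"]) auto
  have "\<alpha> \<in> ?up ` degs k" if "\<alpha> \<in> degs (Suc k)" "\<alpha> i \<noteq> 0" for \<alpha>
  proof -
    have *: "?up (\<alpha>(i := \<alpha> i - 1)) = \<alpha>" using that by auto
    then have "\<alpha>(i := \<alpha> i - 1) \<in> degs k"
      using sum_upd_Suc[of "\<alpha>(i := \<alpha> i - 1)" i] that(1) unfolding degs_def by simp
    then show ?thesis by (intro image_eqI[where x = "\<alpha>(i := \<alpha> i - 1)"]) (use that(2) in simp_all)
  qed
  moreover have "?up \<beta> \<in> degs (Suc k)" if "\<beta> \<in> degs k" for \<beta>
    using that sum_upd_Suc[of \<beta> i] by (simp add: degs_def del: fun_upd_apply)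
  ultimately have "fischer (Suc k) (times_var i p) q = sum ?f (?up ` degs k)"
    unfolding fischer_def
    by (intro sum.mono_neutral_right finite_degs) (auto simp: times_var_def)
  also have "\<dots> = (\<Sum>\<beta>\<in>degs k. ?f (?up \<beta>))"
    using inj by (simp add: sum.reindex)
  also have "\<dots> = fischer k p (partial i q)"
    unfolding fischer_def
    by (intro sum.cong refl, subst prod_fact_upd_Suc) (simp add: times_var_def partial_def mult_ac)
  finally show ?thesis .
qed

lemma fischer_sum_left:
  "fischer k (\<lambda>\<alpha>. \<Sum>i\<in>A. c i * f i \<alpha>) q = (\<Sum>i\<in>A. c i * fischer k (f i) q)"
  unfolding fischer_def sum_distrib_left sum_distrib_right
  by (subst sum.swap) (simp add: mult_ac)

lemma fischer_sum_right:
  "fischer k q (\<lambda>\<alpha>. \<Sum>i\<in>A. c i * f i \<alpha>) = (\<Sum>i\<in>A. c i * fischer k q (f i))"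
  by (simp add: fischer_commute[of k q] fischer_sum_left)

lemma fischer_diff_left:
  "fischer k (\<lambda>\<alpha>. p \<alpha> - c * r \<alpha>) q = fischer k p q - c * fischer k r q"
  by (simp add: fischer_def sum_distrib_left sum_subtractf algebra_simps)

lemma fischer_scale_right: "fischer k p (\<lambda>\<alpha>. c * q \<alpha>) = c * fischer k p q"
  by (simp add: fischer_def sum_distrib_left mult_ac)

lemma fischer_nonneg: "fischer k p p \<ge> 0"
  unfolding fischer_def by (intro sum_nonneg) (simp add: mult.assoc prod_nonneg)

lemma fischer_times_linear: "fischer (Suc k) (times_linear x p) q = fischer k p (directional x q)"
  using fischer_sum_left[where k = "Suc k" and A = UNIV and c = "\<lambda>i. x $ i" and f = "\<lambda>i. times_var i p" and q = q]
    fischer_sum_right[where k = k and q = p and A = UNIV and c = "\<lambda>i. x $ i" and f = "\<lambda>i. partial i q"]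
  by (simp add: times_linear_def[abs_def] directional_def[abs_def] fischer_times_var)

lemma fischer_times_norm2:
  "fischer (Suc (Suc k)) (times_norm2 p) q = fischer k p (laplacian q)"
  using fischer_sum_left[where k = "Suc (Suc k)" and A = UNIV and c = "\<lambda>i. 1" and f = "\<lambda>i. times_var i (times_var i p)" and q = q]
    fischer_sum_right[where k = k and q = p and A = UNIV and c = "\<lambda>i. 1" and f = "\<lambda>i. partial i (partial i q)"]
  by (simp add: times_norm2_def[abs_def] laplacian_def[abs_def] fischer_times_var)

section \<open>Commutators of multiplications and derivatives\<close>

lemma partial_lin [simp]:
  "partial i (\<lambda>\<alpha>. \<Sum>j\<in>A. f j \<alpha>) = (\<lambda>\<alpha>. \<Sum>j\<in>A. partial i (f j) \<alpha>)"
  "partial i (\<lambda>\<alpha>. c * p \<alpha>) = (\<lambda>\<alpha>. c * partial i p \<alpha>)"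
  "partial i (\<lambda>\<alpha>. p \<alpha> + q \<alpha>) = (\<lambda>\<alpha>. partial i p \<alpha> + partial i q \<alpha>)"
  "partial i (\<lambda>\<alpha>. p \<alpha> - q \<alpha>) = (\<lambda>\<alpha>. partial i p \<alpha> - partial i q \<alpha>)"
  "partial i (\<lambda>\<alpha>. 0) = (\<lambda>\<alpha>. 0)"
  by (simp_all add: partial_def fun_eq_iff sum_distrib_left algebra_simps)

lemma times_var_lin [simp]:
  "times_var i (\<lambda>\<alpha>. \<Sum>j\<in>A. f j \<alpha>) = (\<lambda>\<alpha>. \<Sum>j\<in>A. times_var i (f j) \<alpha>)"
  "times_var i (\<lambda>\<alpha>. c * p \<alpha>) = (\<lambda>\<alpha>. c * times_var i p \<alpha>)"
  "times_var i (\<lambda>\<alpha>. p \<alpha> + q \<alpha>) = (\<lambda>\<alpha>. times_var i p \<alpha> + times_var i q \<alpha>)"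
  "times_var i (\<lambda>\<alpha>. p \<alpha> - q \<alpha>) = (\<lambda>\<alpha>. times_var i p \<alpha> - times_var i q \<alpha>)"
  "times_var i (\<lambda>\<alpha>. 0) = (\<lambda>\<alpha>. 0)"
  by (simp_all add: times_var_def fun_eq_iff)

lemma partial_times_var:
  "partial i (times_var j p) = (\<lambda>\<alpha>. times_var j (partial i p) \<alpha> + (if i = j then p \<alpha> else 0))"
  by (auto simp: partial_def times_var_def fun_eq_iff fun_upd_twist fun_upd_idem algebra_simps)

lemma partial_commute: "partial i (partial j p) = partial j (partial i p)"
  by (cases "i = j") (auto simp: partial_def fun_eq_iff fun_upd_twist)

lemma times_var_partial: "times_var i (partial i p) \<alpha> = real (\<alpha> i) * p \<alpha>"
  by (cases "\<alpha> i") (auto simp: partial_def times_var_def fun_upd_idem)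

lemma laplacian_times_linear:
  "laplacian (times_linear x p) \<alpha> = times_linear x (laplacian p) \<alpha> + 2 * directional x p \<alpha>"
proof -
  have *: "partial i (partial i (times_var j p)) \<alpha> =
      times_var j (partial i (partial i p)) \<alpha> + 2 * (if i = j then partial i p \<alpha> else 0)" for i j
    by (cases "i = j") (simp_all add: partial_times_var)
  show ?thesis
    unfolding laplacian_def[abs_def] times_linear_def[abs_def] directional_def[abs_def]
    apply (simp add: * distrib_left sum.distrib sum_distrib_left)
    apply (subst sum.swap)
    apply (simp add: sum.delta mult_ac if_distrib[of "times _"] cong: if_cong)
    done
qed

text \<open>The factor \<open>sum \<alpha> UNIV\<close> is the Euler operator, which multiplies each
  monomial by its degree.\<close>

lemma laplacian_times_norm2:
  fixes p :: "('n::finite \<Rightarrow> nat) \<Rightarrow> real"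
  shows "laplacian (times_norm2 p) \<alpha> = times_norm2 (laplacian p) \<alpha>
    + (4 * real (sum \<alpha> UNIV) + 2 * real CARD('n)) * p \<alpha>"
proof -
  have *: "partial i (partial i (times_var j (times_var j p))) \<alpha> =
      times_var j (times_var j (partial i (partial i p))) \<alpha>
      + (if i = j then (4 * real (\<alpha> i) + 2) * p \<alpha> else 0)" for i j
  proof (cases "i = j")
    case True
    have "partial j (partial j (times_var j (times_var j p))) \<alpha> = (real (\<alpha> j) + 1) * (real (\<alpha> j) + 2) * p \<alpha>"
      by (simp add: partial_def times_var_def algebra_simps)
    moreover have "times_var j (times_var j (partial j (partial j p))) \<alpha> = real (\<alpha> j) * (real (\<alpha> j) - 1) * p \<alpha>"
      by (cases "\<alpha> j"; cases "\<alpha> j - 1") (auto simp: partial_def times_var_def fun_upd_idem)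
    ultimately show ?thesis using True by (simp add: algebra_simps)
  qed (simp add: partial_times_var)
  have "laplacian (times_norm2 p) \<alpha> = (\<Sum>i\<in>UNIV. \<Sum>j\<in>UNIV. partial i (partial i (times_var j (times_var j p))) \<alpha>)"
    by (simp add: laplacian_def times_norm2_def[abs_def])
  also have "\<dots> = (\<Sum>i\<in>UNIV. \<Sum>j\<in>UNIV. times_var j (times_var j (partial i (partial i p))) \<alpha>)
      + (\<Sum>i\<in>UNIV. (4 * real (\<alpha> i) + 2) * p \<alpha>)"
    by (simp only: * sum.distrib) simp
  also have "(\<Sum>i\<in>UNIV. (4 * real (\<alpha> i) + 2) * p \<alpha>) = (4 * real (sum \<alpha> UNIV) + 2 * real CARD('n)) * p \<alpha>"
    by (simp add: sum_distrib_right[symmetric] sum.distrib sum_distrib_left[symmetric])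
  also have "(\<Sum>i\<in>UNIV. \<Sum>j\<in>UNIV. times_var j (times_var j (partial i (partial i p))) \<alpha>) = times_norm2 (laplacian p) \<alpha>"
    by (subst sum.swap) (simp add: laplacian_def[abs_def] times_norm2_def)
  finally show ?thesis .
qed

lemma directional_times_linear:
  "directional x (times_linear x p) \<alpha> = times_linear x (directional x p) \<alpha> + (x \<bullet> x) * p \<alpha>"
proof -
  have *: "partial i (times_var j p) \<alpha> = times_var j (partial i p) \<alpha> + (if i = j then p \<alpha> else 0)" for i j
    by (simp add: partial_times_var)
  show ?thesis
    unfolding directional_def[abs_def] times_linear_def[abs_def] inner_vec_def
    apply (simp add: * distrib_left sum.distrib sum_distrib_left sum_distrib_right)
    apply (subst sum.swap)
    apply (simp add: sum.delta mult_ac if_distrib[of "times _"] cong: if_cong)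
    done
qed

lemma directional_times_norm2:
  "directional x (times_norm2 p) \<alpha> = times_norm2 (directional x p) \<alpha> + 2 * times_linear x p \<alpha>"
proof -
  have *: "partial i (times_var j (times_var j p)) \<alpha> = times_var j (times_var j (partial i p)) \<alpha>
     + 2 * (if i = j then times_var i p \<alpha> else 0)" for i j
    by (cases "i = j") (simp_all add: partial_times_var)
  show ?thesis
    unfolding directional_def[abs_def] times_linear_def[abs_def] times_norm2_def[abs_def]
    apply (simp add: * distrib_left sum.distrib sum_distrib_left sum_distrib_right)
    apply (subst sum.swap)
    apply (simp add: sum.delta mult_ac if_distrib[of "times _"] cong: if_cong)
    done
qed

text \<open>Differential operators with constant coefficients commute.\<close>

lemma laplacian_directional: 
  assumes "\<And>\<alpha>. laplacian p \<alpha> = 0"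
  shows "laplacian (directional x p) \<alpha> = 0"
proof -
  have "laplacian (directional x p) \<alpha> = directional x (laplacian p) \<alpha>"
    unfolding laplacian_def[abs_def] directional_def[abs_def]
    apply (simp add: sum_distrib_left)
    apply (subst sum.swap)
    apply (simp add: partial_commute)
    done
  then show ?thesis using assms by (simp add: directional_def partial_def)
qed

text \<open>The derivative of the zonal harmonic of degree \<open>k\<close> in the direction of its pole is
  \<open>zonal_deriv n k\<close> times the one of degree \<open>k - 1\<close>; \<open>gegen n k\<close> is the monic Gegenbauer polynomial
  of index \<open>n / 2 - 1\<close>.\<close>
fun zonal_deriv :: "nat \<Rightarrow> nat \<Rightarrow> real" where
  "zonal_deriv n 0 = 0"
| "zonal_deriv n (Suc k) = 1 + zonal_deriv n k * (2 * real k - 4 + real n) / (2 * real k - 2 + real n)"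

text \<open>For \<open>n > 2\<close> and \<open>k \<ge> 1\<close> the recursion solves to
  \<open>zonal_deriv n k = k (n + k - 3) / (n + 2 k - 4)\<close>, so this is the classical
  three-term coefficient \<open>k (n + k - 3) / ((n + 2 k - 4) (n + 2 k - 2))\<close> of the monic
  Gegenbauer polynomials.\<close>

definition gegen_coeff :: "nat \<Rightarrow> nat \<Rightarrow> real" where
  "gegen_coeff n k = zonal_deriv n k / (2 * real k - 2 + real n)"

fun gegen :: "nat \<Rightarrow> nat \<Rightarrow> real \<Rightarrow> real" where
  "gegen n 0 t = 1"
| "gegen n (Suc 0) t = t"
| "gegen n (Suc (Suc k)) t = t * gegen n (Suc k) t - gegen_coeff n (Suc k) * gegen n k t"

definition one_coeff :: "('n::finite \<Rightarrow> nat) \<Rightarrow> real" where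
  "one_coeff \<alpha> = (if \<alpha> = (\<lambda>_. 0) then 1 else 0)"

text \<open>The homogenization of \<open>gegen\<close>: the variable becomes the linear form of
  \<open>x\<close>, and the lower term is raised to the same degree by the squared norm.\<close>

fun zonal :: "real^'n \<Rightarrow> nat \<Rightarrow> ('n::finite \<Rightarrow> nat) \<Rightarrow> real" where
  "zonal x 0 = one_coeff"
| "zonal x (Suc 0) = times_linear x one_coeff"
| "zonal x (Suc (Suc k)) = (\<lambda>\<alpha>. times_linear x (zonal x (Suc k)) \<alpha>
      - gegen_coeff CARD('n) (Suc k) * times_norm2 (zonal x k) \<alpha>)"

section \<open>Harmonicity of the zonal polynomials\<close>

lemma times_var_homogeneous:
  assumes "\<And>\<alpha>. sum \<alpha> UNIV \<noteq> k \<Longrightarrow> p \<alpha> = 0" "sum \<alpha> UNIV \<noteq> Suc k"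
  shows "times_var i p \<alpha> = 0"
proof (cases "\<alpha> i = 0")
  case False
  let ?\<beta> = "\<alpha>(i := \<alpha> i - 1)"
  have "?\<beta>(i := Suc (?\<beta> i)) = \<alpha>" using False by auto
  then have "sum ?\<beta> UNIV \<noteq> k" using sum_upd_Suc[of ?\<beta> i] assms(2) by simp
  then show ?thesis using assms(1)[of ?\<beta>] by (simp add: times_var_def)
qed (simp add: times_var_def)

lemma zonal_homogeneous:
  fixes x :: "real^'n"
  shows "sum \<alpha> UNIV \<noteq> k \<Longrightarrow> zonal x k \<alpha> = 0"
proof (induction x k arbitrary: \<alpha> rule: zonal.induct)
  case (1 x)
  then have "\<alpha> \<noteq> (\<lambda>_. 0)" by auto
  then show ?case by (simp add: one_coeff_def)
next
  case (2 x)
  have "one_coeff \<beta> = 0" if "sum \<beta> UNIV \<noteq> 0" for \<beta> :: "'n \<Rightarrow> nat"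
    using that by (auto simp: one_coeff_def)
  then have "times_var i one_coeff \<alpha> = 0" for i using times_var_homogeneous[of 0 one_coeff] 2 by auto
  then show ?case by (simp add: times_linear_def)
next
  case (3 x k)
  have "times_var i (zonal x (Suc k)) \<alpha> = 0" for i
    using times_var_homogeneous[of "Suc k" "zonal x (Suc k)" \<alpha>] 3 by blast
  moreover have "times_var i (zonal x k) \<beta> = 0" if "sum \<beta> UNIV \<noteq> Suc k" for i \<beta>
    using times_var_homogeneous[of k "zonal x k" \<beta>] 3 that by blast
  then have "times_var i (times_var i (zonal x k)) \<alpha> = 0" for i
    using times_var_homogeneous[of "Suc k" "times_var i (zonal x k)" \<alpha>] 3 by blast
  ultimately show ?case by (simp add: times_linear_def times_norm2_def)
qed

text \<open>By homogeneity the degree factor may be replaced by \<open>k\<close> everywhere: at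
  exponent vectors of another degree the coefficient is 0.\<close>

lemma laplacian_times_norm2_zonal:
  fixes x :: "real^'n"
  shows "laplacian (times_norm2 (zonal x k)) \<alpha> =
    times_norm2 (laplacian (zonal x k)) \<alpha> + (4 * real k + 2 * real CARD('n)) * zonal x k \<alpha>"
  by (cases "sum \<alpha> UNIV = k") (simp_all add: laplacian_times_norm2 zonal_homogeneous del: of_nat_sum)

lemma directional_lin:
  "directional x (\<lambda>\<alpha>. p \<alpha> - c * q \<alpha>) \<alpha> = directional x p \<alpha> - c * directional x q \<alpha>"
  by (simp add: directional_def sum_subtractf algebra_simps sum_distrib_left)

lemma laplacian_lin:
  "laplacian (\<lambda>\<alpha>. p \<alpha> - c * q \<alpha>) \<alpha> = laplacian p \<alpha> - c * laplacian q \<alpha>"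
  by (simp add: laplacian_def sum_subtractf algebra_simps sum_distrib_left)

lemma times_linear_scale: "times_linear x (\<lambda>\<alpha>. c * p \<alpha>) = (\<lambda>\<alpha>. c * times_linear x p \<alpha>)"
  by (simp add: times_linear_def fun_eq_iff sum_distrib_left mult_ac)

lemma times_norm2_scale: "times_norm2 (\<lambda>\<alpha>. c * p \<alpha>) = (\<lambda>\<alpha>. c * times_norm2 p \<alpha>)"
  by (simp add: times_norm2_def fun_eq_iff sum_distrib_left)

lemma times_var_zero: "(\<And>\<alpha>. p \<alpha> = 0) \<Longrightarrow> times_var i p \<alpha> = 0"
  by (simp add: times_var_def)

lemma times_zero:
  assumes "\<And>\<alpha>. p \<alpha> = 0"
  shows "times_norm2 p \<alpha> = 0" "times_linear x p \<alpha> = 0"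
  using assms by (simp_all add: times_norm2_def times_linear_def times_var_zero)

lemma partial_one_coeff: "partial i one_coeff = (\<lambda>\<alpha>. 0)"
  by (auto simp: partial_def one_coeff_def fun_eq_iff)

lemma one_coeff_derivs [simp]: "laplacian one_coeff \<alpha> = 0" "directional x one_coeff \<alpha> = 0"
  by (simp_all add: laplacian_def directional_def partial_one_coeff)

text \<open>The two invariants carry each other: the choice of \<^const>\<open>gegen_coeff\<close> makes the Laplacian
  vanish, and the recursion of \<^const>\<open>zonal_deriv\<close> cancels the leftover multiple of
  \<^const>\<open>times_norm2\<close> in the directional derivative.\<close>
lemma zonal_harmonic_aux:
  fixes x :: "real^'n"
  assumes n: "CARD('n) > 2" and x: "norm x = 1"
  shows "(\<forall>\<alpha>. laplacian (zonal x k) \<alpha> = 0) \<and> (\<forall>\<alpha>. laplacian (zonal x (Suc k)) \<alpha> = 0) \<and>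
    (\<forall>\<alpha>. directional x (zonal x (Suc k)) \<alpha> = zonal_deriv CARD('n) (Suc k) * zonal x k \<alpha>)"
proof (induction k rule: less_induct)
  case (less k)
  have xx: "x \<bullet> x = 1" using x by (simp add: dot_square_norm)
  let ?n = "CARD('n)" let ?e = "zonal_deriv CARD('n)" let ?b = "gegen_coeff CARD('n)"
  consider "k = 0" | m where "k = Suc m" by (cases k) auto
  then show ?case
  proof cases
    case 1
    have "laplacian (zonal x (Suc 0)) \<alpha> = 0" for \<alpha>
      by (simp add: laplacian_times_linear times_zero)
    moreover have "directional x (zonal x (Suc 0)) \<alpha> = one_coeff \<alpha>" for \<alpha>
      by (simp add: directional_times_linear xx times_zero)
    ultimately show ?thesis using 1 n by simp
  next
    case (2 m)
    have IH: "laplacian (zonal x m) \<alpha> = 0" "laplacian (zonal x (Suc m)) \<alpha> = 0"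
      "directional x (zonal x (Suc m)) \<alpha> = ?e (Suc m) * zonal x m \<alpha>" for \<alpha>
      using less[of m] 2 by auto
    have dm: "directional x (zonal x (Suc m)) = (\<lambda>\<alpha>. ?e (Suc m) * zonal x m \<alpha>)"
      using IH by auto
    have pos: "2 * real m + real ?n > 0" using n by simp
    then have be: "?b (Suc m) * (2 * real m + real ?n) = ?e (Suc m)"
      by (simp add: gegen_coeff_def)
    have L: "laplacian (zonal x (Suc (Suc m))) \<alpha> = 0" for \<alpha>
    proof -
      have "laplacian (zonal x (Suc (Suc m))) \<alpha> = 2 * ?e (Suc m) * zonal x m \<alpha>
          - ?b (Suc m) * ((4 * real m + 2 * real ?n) * zonal x m \<alpha>)"
        by (simp add: laplacian_lin laplacian_times_linear laplacian_times_norm2_zonal IH times_zero)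
      also have "\<dots> = 2 * (?e (Suc m) - ?b (Suc m) * (2 * real m + real ?n)) * zonal x m \<alpha>"
        by (simp add: algebra_simps)
      finally show ?thesis by (simp only: be) simp
    qed
    have e2: "?e (Suc (Suc m)) = 1 + ?e (Suc m) - 2 * ?b (Suc m)"
    proof -
      have "?e (Suc (Suc m)) = 1 + ?e (Suc m) * (2 * real m + real ?n - 2) / (2 * real m + real ?n)"
        by (simp del: zonal_deriv.simps(2) add: zonal_deriv.simps(2)[of _ "Suc m"] algebra_simps)
      also have "\<dots> = 1 + ?e (Suc m) - 2 * ?b (Suc m)"
        using pos by (simp add: gegen_coeff_def field_simps del: zonal_deriv.simps)
      finally show ?thesis .
    qed
    have D: "directional x (zonal x (Suc (Suc m))) \<alpha> = ?e (Suc (Suc m)) * zonal x (Suc m) \<alpha>" for \<alpha>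
    proof -
      have d: "directional x (zonal x (Suc (Suc m))) \<alpha> = ?e (Suc m) * times_linear x (zonal x m) \<alpha>
          + zonal x (Suc m) \<alpha> - ?b (Suc m) * (times_norm2 (directional x (zonal x m)) \<alpha>
          + 2 * times_linear x (zonal x m) \<alpha>)"
        by (simp add: directional_lin directional_times_linear directional_times_norm2 xx dm
            times_linear_scale del: zonal_deriv.simps)
      show ?thesis
      proof (cases m)
        case 0
        have "times_norm2 (directional x (zonal x m)) \<alpha> = 0"
          using 0 by (intro times_zero) simp
        then show ?thesis using d unfolding e2 by (simp add: 0 algebra_simps del: zonal_deriv.simps)
      next
        case (Suc l)
        have dl: "directional x (zonal x m) = (\<lambda>\<alpha>. ?e m * zonal x l \<alpha>)"
          using less[of l] 2 Suc by auto
        \<comment> \<open>The recurrence, solved for the product with the linear form, trades it for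
          the next zonal polynomial and a multiple of \<open>times_norm2 (zonal x l)\<close>. Such
          multiples cancel in the end because both sides of the identity below equal
          \<open>?e (Suc m) * ?e m / (2 m + n)\<close>.\<close>
        have l: "times_linear x (zonal x m) \<alpha> = zonal x (Suc m) \<alpha> + ?b m * times_norm2 (zonal x l) \<alpha>"
          using Suc by simp
        have "2 * real m - 2 + real ?n > 0" using n by simp
        then have "(?e (Suc m) - 2 * ?b (Suc m)) * ?b m = ?b (Suc m) * ?e m"
          using pos by (simp add: gegen_coeff_def divide_simps del: zonal_deriv.simps)
             (simp add: algebra_simps del: zonal_deriv.simps)
        then have "(?e (Suc m) - 2 * ?b (Suc m)) * (?b m * times_norm2 (zonal x l) \<alpha>) =
            ?b (Suc m) * (?e m * times_norm2 (zonal x l) \<alpha>)"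
          by (simp only: mult.assoc[symmetric])
        then show ?thesis using d unfolding e2 dl times_norm2_scale l
          by (simp add: algebra_simps del: zonal_deriv.simps zonal.simps)
      qed
    qed
    show ?thesis using IH L D 2 by simp
  qed
qed

lemma laplacian_zonal:
  fixes x :: "real^'n"
  assumes "CARD('n) > 2" "norm x = 1"
  shows "laplacian (zonal x k) \<alpha> = 0"
  using zonal_harmonic_aux[OF assms] by blast

text \<open>The coefficients of the power series of \<open>exp (x \<bullet> z)\<close> in
  \<open>z\<close>. The Fischer product of its part of degree \<open>k\<close> with a homogeneous
  polynomial of that degree is the value of the polynomial at \<open>x\<close>, so evaluation
  becomes a pairing.\<close>

definition exp_coeff :: "real^'n \<Rightarrow> ('n::finite \<Rightarrow> nat) \<Rightarrow> real" where
  "exp_coeff x \<alpha> = (\<Prod>i\<in>UNIV. (x $ i) ^ \<alpha> i / fact (\<alpha> i))"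

lemma partial_exp_coeff: "partial i (exp_coeff x) = (\<lambda>\<alpha>. x $ i * exp_coeff x \<alpha>)"
proof
  fix \<alpha>
  have "(\<Prod>j\<in>UNIV - {i}. (x $ j) ^ (\<alpha>(i := Suc (\<alpha> i))) j / fact ((\<alpha>(i := Suc (\<alpha> i))) j))
      = (\<Prod>j\<in>UNIV - {i}. (x $ j) ^ \<alpha> j / fact (\<alpha> j))"
    by (rule prod.cong) auto
  then show "partial i (exp_coeff x) \<alpha> = x $ i * exp_coeff x \<alpha>"
    by (simp add: partial_def exp_coeff_def prod.remove[of UNIV i] del: of_nat_Suc)
qed

lemma fischer_exp_times_linear:
  "fischer (Suc k) (exp_coeff x) (times_linear y p) = (x \<bullet> y) * fischer k (exp_coeff x) p"
proof -
  have "directional y (exp_coeff x) = (\<lambda>\<alpha>. (x \<bullet> y) * exp_coeff x \<alpha>)"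
    by (simp add: fun_eq_iff directional_def partial_exp_coeff inner_vec_def sum_distrib_left mult_ac)
  then show ?thesis
    by (simp add: fischer_commute[of "Suc k" "exp_coeff x"] fischer_times_linear fischer_scale_right
        fischer_commute[of k p])
qed

lemma fischer_exp_times_norm2:
  "fischer (Suc (Suc k)) (exp_coeff x) (times_norm2 p) = (x \<bullet> x) * fischer k (exp_coeff x) p"
proof -
  have "laplacian (exp_coeff x) = (\<lambda>\<alpha>. (x \<bullet> x) * exp_coeff x \<alpha>)"
    by (simp add: fun_eq_iff laplacian_def partial_exp_coeff inner_vec_def sum_distrib_left mult_ac)
  then show ?thesis
    by (simp add: fischer_commute[of "Suc (Suc k)" "exp_coeff x"] fischer_times_norm2 fischer_scale_right
        fischer_commute[of k p])
qed

lemma degs_0: "degs 0 = {\<lambda>_. 0}"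
  by (auto simp: degs_def fun_eq_iff)

text \<open>Evaluation at the unit vector \<open>x\<close> turns \<open>times_linear y\<close> into
  the factor \<open>x \<bullet> y\<close> and \<open>times_norm2\<close> into the factor 1, so the
  recurrence of \<open>zonal\<close> becomes that of \<open>gegen\<close>.\<close>

lemma fischer_exp_zonal:
  fixes x y :: "real^'n"
  assumes "norm x = 1"
  shows "fischer k (exp_coeff x) (zonal y k) = gegen CARD('n) k (x \<bullet> y)"
proof (induction k rule: induct_nat_012)
  case 0
  then show ?case by (simp add: fischer_def degs_0 exp_coeff_def one_coeff_def)
next
  case 1
  then show ?case
    by (simp add: fischer_exp_times_linear) (simp add: fischer_def degs_0 exp_coeff_def one_coeff_def)
next
  case (ge2 k)
  have "x \<bullet> x = 1" using assms by (simp add: dot_square_norm)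
  then show ?case using ge2
    by (simp add: fischer_commute[of _ "exp_coeff x"] fischer_diff_left)
       (simp add: fischer_commute[of _ _ "exp_coeff x"] fischer_exp_times_linear fischer_exp_times_norm2)
qed

text \<open>Euler's identity for homogeneous polynomials, with evaluation at \<open>x\<close>
  written as a pairing.\<close>

lemma fischer_exp_directional:
  "fischer k (exp_coeff x) (directional x p) = real (Suc k) * fischer (Suc k) (exp_coeff x) p"
proof -
  have *: "times_linear x (exp_coeff x) \<alpha> = real (sum \<alpha> UNIV) * exp_coeff x \<alpha>" for \<alpha>
  proof -
    have "times_linear x (exp_coeff x) \<alpha> = (\<Sum>i\<in>UNIV. times_var i (partial i (exp_coeff x)) \<alpha>)"
      by (simp add: times_linear_def partial_exp_coeff)
    then show ?thesis by (simp add: times_var_partial sum_distrib_right)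
  qed
  have "fischer k (exp_coeff x) (directional x p) = fischer (Suc k) (times_linear x (exp_coeff x)) p"
    by (simp add: fischer_times_linear)
  also have "\<dots> = fischer (Suc k) (\<lambda>\<alpha>. real (Suc k) * exp_coeff x \<alpha>) p"
    unfolding fischer_def by (intro sum.cong refl) (simp add: * degs_def)
  finally show ?thesis by (simp add: fischer_commute[of _ _ p] fischer_scale_right)
qed

text \<open>The reproducing property. Modulo multiples of the squared norm, which are orthogonal to
  harmonic polynomials, \<open>zonal x k\<close> is the \<open>k\<close>-th power of the linear form
  of \<open>x\<close>, that is, \<open>fact k\<close> times the evaluation functional.\<close>

lemma fischer_zonal_harmonic:
  fixes x :: "real^'n"
  assumes "\<And>\<alpha>. laplacian H \<alpha> = 0"
  shows "fischer k (zonal x k) H = fact k * fischer k (exp_coeff x) H"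
  using assms
proof (induction k arbitrary: H rule: induct_nat_012)
  case 0
  then show ?case by (simp add: fischer_def degs_0 exp_coeff_def one_coeff_def)
next
  case 1
  have "fischer (Suc 0) (zonal x (Suc 0)) H = fischer 0 one_coeff (directional x H)"
    by (simp add: fischer_times_linear)
  also have "\<dots> = fischer 0 (exp_coeff x) (directional x H)"
    by (simp add: fischer_def degs_0 exp_coeff_def one_coeff_def)
  finally show ?case by (simp add: fischer_exp_directional)
next
  case (ge2 k)
  have "fischer (Suc (Suc k)) (zonal x (Suc (Suc k))) H = fischer (Suc k) (zonal x (Suc k)) (directional x H)
      - gegen_coeff CARD('n) (Suc k) * fischer k (zonal x k) (laplacian H)"
    by (simp add: fischer_diff_left fischer_times_linear fischer_times_norm2)
  also have "fischer k (zonal x k) (laplacian H) = 0"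
    using ge2.prems by (simp add: fischer_def)
  also have "fischer (Suc k) (zonal x (Suc k)) (directional x H)
      = fact (Suc k) * fischer (Suc k) (exp_coeff x) (directional x H)"
    using ge2 by (intro ge2.IH) (simp add: laplacian_directional)
  finally show ?case by (simp add: fischer_exp_directional algebra_simps)
qed

text \<open>Up to the factor \<open>fact k\<close>, the Gegenbauer kernel is the Gram matrix of the
  zonal harmonics, so the double sum is a squared Fischer norm.\<close>

theorem gegen_positive_definite:
  fixes f :: "'i \<Rightarrow> real^'n"
  assumes "CARD('n) > 2" "\<And>i. i \<in> I \<Longrightarrow> norm (f i) = 1"
  shows "(\<Sum>i\<in>I. \<Sum>j\<in>I. c i * c j * gegen CARD('n) k (f i \<bullet> f j)) \<ge> 0"
proof -
  let ?Z = "\<lambda>\<alpha>. \<Sum>i\<in>I. c i * zonal (f i) k \<alpha>"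
  have "fischer k ?Z ?Z = (\<Sum>i\<in>I. \<Sum>j\<in>I. c i * c j * fischer k (zonal (f i) k) (zonal (f j) k))"
    by (simp only: fischer_sum_left fischer_sum_right sum_distrib_left mult.assoc)
  also have "\<dots> = (\<Sum>i\<in>I. \<Sum>j\<in>I. c i * c j * (fact k * gegen CARD('n) k (f i \<bullet> f j)))"
    using assms by (intro sum.cong refl) (simp add: fischer_zonal_harmonic laplacian_zonal fischer_exp_zonal)
  also have "\<dots> = fact k * (\<Sum>i\<in>I. \<Sum>j\<in>I. c i * c j * gegen CARD('n) k (f i \<bullet> f j))"
    by (simp add: sum_distrib_left mult_ac)
  finally have "0 \<le> fact k * (\<Sum>i\<in>I. \<Sum>j\<in>I. c i * c j * gegen CARD('n) k (f i \<bullet> f j))"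
    using fischer_nonneg[of k ?Z] by simp
  then show ?thesis using mult_pos_neg[of "fact k :: real"] by (meson fact_gt_zero not_le)
qed

section \<open>Divided differences and Hermite interpolation\<close>

text \<open>Rolle is applied between consecutive zeros. The half-open interval admits the node -1,
  where \<open>h\<close> is only continuous. The new zeros lie off \<open>S\<close>, so that doubled
  nodes can be counted in addition to them.\<close>

lemma rolle_zeros:
  fixes g :: "real \<Rightarrow> real"
  assumes "finite S" "S \<noteq> {}" "S \<subseteq> {a..<b}" "continuous_on {a..<b} g"
    "\<And>t. t \<in> {a<..<b} \<Longrightarrow> g differentiable (at t)" "\<And>t. t \<in> S \<Longrightarrow> g t = 0"
  shows "\<exists>S'. finite S' \<and> S' \<subseteq> {a<..<Max S} \<and> S' \<inter> S = {} \<and> Suc (card S') = card S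
    \<and> (\<forall>t\<in>S'. deriv g t = 0)"
  using assms(1-3,6)
proof (induction S rule: finite_linorder_max_induct)
  case empty
  then show ?case by simp
next
  case (insert c A)
  show ?case
  proof (cases "A = {}")
    case True
    then show ?thesis by (intro exI[of _ "{}"]) auto
  next
    case False
    then obtain S' where S': "finite S'" "S' \<subseteq> {a<..<Max A}" "S' \<inter> A = {}" "Suc (card S') = card A"
      "\<forall>t\<in>S'. deriv g t = 0" using insert by auto
    have m: "Max A \<in> A" using False insert by simp
    then have lt: "Max A < c" and ma: "a \<le> Max A" and cb: "c < b" using insert by auto
    have "continuous_on {Max A..c} g"
      using assms(4) by (rule continuous_on_subset) (use ma cb in auto)
    moreover have "\<And>t. \<lbrakk>Max A < t; t < c\<rbrakk> \<Longrightarrow> g differentiable (at t)"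
      using assms(5) ma cb by auto
    moreover have "g (Max A) = g c" using insert.prems(3) m by simp
    ultimately obtain z where z: "Max A < z" "z < c" "DERIV g z :> 0"
      using Rolle[OF lt] by metis
    have zS: "z \<notin> S'" "z \<notin> A" using S'(2) z(1) insert.hyps(1) Max_ge[of A z] by (auto simp: not_le[symmetric])
    have "Max (insert c A) = c" using insert lt False by (simp add: Max_insert2 less_imp_le)
    then show ?thesis
      using S' z zS lt ma insert DERIV_imp_deriv[OF z(3)]
      by (intro exI[of _ "insert z S'"]) auto
  qed
qed

lemma higher_rolle:
  fixes g :: "real \<Rightarrow> real"
  assumes "\<And>i t. t \<in> {a<..<b} \<Longrightarrow> (deriv ^^ i) g differentiable (at t)"
    "finite S" "card S = Suc m" "S \<subseteq> {a<..<b}" "\<And>t. t \<in> S \<Longrightarrow> g t = 0"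
  shows "\<exists>\<xi>\<in>{a<..<b}. (deriv ^^ m) g \<xi> = 0"
  using assms
proof (induction m arbitrary: g S)
  case 0
  then obtain t where "t \<in> S" by (metis card_1_singletonE insertI1 One_nat_def)
  then show ?case using 0 by (intro bexI[of _ t]) auto
next
  case (Suc m)
  have ne: "S \<noteq> {}" using Suc.prems(3) by auto
  \<comment> \<open>Starting the interval at the least zero makes continuity on
    \<open>{a'..<b}\<close> a consequence of differentiability inside
    \<open>{a<..<b}\<close>.\<close>
  define a' where "a' = Min S"
  have a': "a' \<in> S" using Suc.prems(2) ne by (simp add: a'_def)
  have d: "g differentiable (at t)" if "t \<in> {a<..<b}" for t
    using Suc.prems(1)[OF that, of 0] by simp
  have cont: "continuous_on {a'..<b} g"
    using d Suc.prems(4) a' by (intro continuous_at_imp_continuous_on ballI differentiable_imp_continuous_within) auto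
  have "\<exists>S'. finite S' \<and> S' \<subseteq> {a'<..<Max S} \<and> S' \<inter> S = {} \<and> Suc (card S') = card S
    \<and> (\<forall>t\<in>S'. deriv g t = 0)"
  proof (rule rolle_zeros[where b = b])
    show "S \<subseteq> {a'..<b}" using Suc.prems(2,4) by (auto simp: a'_def)
    show "g differentiable (at t)" if "t \<in> {a'<..<b}" for t
      using that Suc.prems(4) a' by (intro d) auto
  qed (use cont Suc.prems ne in auto)
  then obtain S' where S': "finite S'" "S' \<subseteq> {a'<..<Max S}" "Suc (card S') = card S"
    "\<forall>t\<in>S'. deriv g t = 0" by blast
  have "Max S \<in> S" using Suc.prems(2) ne by simp
  then have "S' \<subseteq> {a<..<b}" using S'(2) Suc.prems(4) a' by fastforce
  then have "\<exists>\<xi>\<in>{a<..<b}. (deriv ^^ m) (deriv g) \<xi> = 0"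
    using Suc.prems(1)[of _ "Suc _"] S' Suc.prems(3)
    by (intro Suc.IH[of "deriv g" S']) (auto simp: funpow_swap1)
  then show ?case by (simp add: funpow_swap1)
qed

text \<open>Value and derivative are treated together, because differentiating once more needs the
  formula for the \<open>i\<close>-th derivative on a whole neighbourhood.\<close>

lemma higher_deriv_diff_poly:
  fixes h :: "real \<Rightarrow> real"
  assumes "\<And>i t. t \<in> {a<..<b} \<Longrightarrow> (deriv ^^ i) h differentiable (at t)" "t \<in> {a<..<b}"
  shows "((deriv ^^ i) (\<lambda>t. h t - poly p t) has_field_derivative
     (deriv ^^ Suc i) h t - poly ((pderiv ^^ Suc i) p) t) (at t)
     \<and> (deriv ^^ i) (\<lambda>t. h t - poly p t) t = (deriv ^^ i) h t - poly ((pderiv ^^ i) p) t"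
  using assms(2)
proof (induction i arbitrary: t)
  case (0 t)
  have "(h has_field_derivative deriv h t) (at t)"
    using assms(1)[OF 0, of 0] by (simp add: DERIV_deriv_iff_real_differentiable)
  then show ?case by (auto intro!: derivative_eq_intros)
next
  case (Suc i t)
  let ?g = "\<lambda>t. h t - poly p t"
  have eq: "(deriv ^^ Suc i) ?g s = (deriv ^^ Suc i) h s - poly ((pderiv ^^ Suc i) p) s" if "s \<in> {a<..<b}" for s
    using Suc.IH[OF that] by (auto intro!: DERIV_imp_deriv)
  have "((deriv ^^ Suc i) h has_field_derivative (deriv ^^ Suc (Suc i)) h t) (at t)"
    using assms(1)[OF Suc.prems, of "Suc i"] by (simp add: DERIV_deriv_iff_real_differentiable)
  then have "((\<lambda>s. (deriv ^^ Suc i) h s - poly ((pderiv ^^ Suc i) p) s) has_field_derivative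
      (deriv ^^ Suc (Suc i)) h t - poly ((pderiv ^^ Suc (Suc i)) p) t) (at t)"
    by (auto intro!: derivative_eq_intros)
  then have "((deriv ^^ Suc i) ?g has_field_derivative
      (deriv ^^ Suc (Suc i)) h t - poly ((pderiv ^^ Suc (Suc i)) p) t) (at t)"
    by (rule has_field_derivative_transform_within_open[where S = "{a<..<b}"]) (use Suc.prems eq in auto)
  then show ?case using eq[OF Suc.prems] by blast
qed

lemma higher_pderiv_degree_le:
  fixes p :: "real poly"
  assumes "degree p \<le> j"
  shows "poly ((pderiv ^^ j) p) t = fact j * coeff p j"
proof -
  have "coeff ((pderiv ^^ j) p) n = (if n = 0 then fact j * coeff p j else 0)" for n
    using assms by (simp add: coeff_higher_pderiv coeff_eq_0 pochhammer_fact[symmetric])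
  then have "(pderiv ^^ j) p = [:fact j * coeff p j:]"
    by (intro poly_eqI) (simp add: coeff_pCons split: nat.split)
  then show ?thesis by simp
qed

lemma absolutely_monotone_diff_poly:
  assumes h: "absolutely_monotone h" and t: "t \<in> {-1<..<1}"
  shows "(deriv ^^ i) (\<lambda>t. h t - poly p t) differentiable (at t)"
    and "(deriv ^^ i) (\<lambda>t. h t - poly p t) t = (deriv ^^ i) h t - poly ((pderiv ^^ i) p) t"
proof -
  have "((deriv ^^ i) (\<lambda>t. h t - poly p t) has_field_derivative
     (deriv ^^ Suc i) h t - poly ((pderiv ^^ Suc i) p) t) (at t)
     \<and> (deriv ^^ i) (\<lambda>t. h t - poly p t) t = (deriv ^^ i) h t - poly ((pderiv ^^ i) p) t"
    using h t by (intro higher_deriv_diff_poly[of "-1" 1]) (auto simp: absolutely_monotone_def)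
  then show "(deriv ^^ i) (\<lambda>t. h t - poly p t) differentiable (at t)"
    and "(deriv ^^ i) (\<lambda>t. h t - poly p t) t = (deriv ^^ i) h t - poly ((pderiv ^^ i) p) t"
    unfolding real_differentiable_def by blast+
qed

text \<open>The leading coefficient of an interpolation polynomial is a divided difference of \<open>h\<close>.
  \<open>D\<close> is the set of nodes at which the derivative is interpolated, too.\<close>
lemma interpolation_leading_coeff_nonneg:
  assumes h: "absolutely_monotone h" and j: "j \<ge> 1" "degree p \<le> j"
    and S: "finite S" "S \<subseteq> {-1..<1}" "\<And>t. t \<in> S \<Longrightarrow> poly p t = h t"
    and D: "D \<subseteq> S" "D \<subseteq> {-1<..}" "\<And>t. t \<in> D \<Longrightarrow> poly (pderiv p) t = deriv h t"
    and card: "card S + card D = Suc j"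
  shows "coeff p j \<ge> 0"
proof -
  let ?g = "\<lambda>t. h t - poly p t"
  have ne: "S \<noteq> {}" using D(1) card by auto
  have "\<exists>S'. finite S' \<and> S' \<subseteq> {-1<..<Max S} \<and> S' \<inter> S = {} \<and> Suc (card S') = card S
      \<and> (\<forall>t\<in>S'. deriv ?g t = 0)"
    using h S ne absolutely_monotone_diff_poly(1)[OF h, where i = 0]
    by (intro rolle_zeros[where b = 1]) (auto intro!: continuous_intros simp: absolutely_monotone_def)
  then obtain S' where S': "finite S'" "S' \<subseteq> {-1<..<Max S}" "S' \<inter> S = {}" "Suc (card S') = card S"
    "\<forall>t\<in>S'. deriv ?g t = 0" by blast
  have "Max S \<in> S" using S(1) ne by simp
  then have sub: "S' \<union> D \<subseteq> {-1<..<1}" using S'(2) S(2) D by fastforce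
  have finD: "finite D" using D(1) S(1) finite_subset by blast
  then have "card (S' \<union> D) = card S' + card D"
    using S' D by (intro card_Un_disjoint) auto
  \<comment> \<open>Critical points and doubled nodes together are \<open>j\<close> distinct zeros
    of the derivative, all inside the open interval even if -1 is a node.\<close>
  then have c: "card (S' \<union> D) = Suc (j - 1)" using S'(4) card j by simp
  have zero: "deriv ?g t = 0" if "t \<in> S' \<union> D" for t
    using that S'(5) D sub absolutely_monotone_diff_poly(2)[OF h, of t 1 p] by auto
  have "(deriv ^^ i) (deriv ?g) differentiable (at t)" if "t \<in> {-1<..<1}" for i t
    using absolutely_monotone_diff_poly(1)[OF h that, of "Suc i"] by (simp add: funpow_swap1)
  then have "\<exists>\<xi>\<in>{-1<..<1}. (deriv ^^ (j - 1)) (deriv ?g) \<xi> = 0"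
    using S'(1) finD c sub zero by (intro higher_rolle[of "-1" 1 _ "S' \<union> D"]) auto
  then obtain \<xi> where \<xi>: "\<xi> \<in> {-1<..<1}" "(deriv ^^ j) ?g \<xi> = 0"
    using j by (cases j) (auto simp: funpow_swap1)
  then have "(deriv ^^ j) h \<xi> = fact j * coeff p j"
    using absolutely_monotone_diff_poly(2)[OF h \<xi>(1), of j p] higher_pderiv_degree_le[OF j(2)] by simp
  moreover have "(deriv ^^ j) h \<xi> \<ge> 0" using h j \<xi> by (simp add: absolutely_monotone_def)
  ultimately show ?thesis using mult_pos_neg[of "fact j :: real" "coeff p j"]
    by (smt (verit) fact_gt_zero)
qed

section \<open>Newton and Hermite interpolation\<close>

definition node_poly :: "(nat \<Rightarrow> real) \<Rightarrow> nat \<Rightarrow> real poly" where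
  "node_poly t j = (\<Prod>i<j. [:- t i, 1:])"

lemma poly_node_poly: "poly (node_poly t j) x = (\<Prod>i<j. x - t i)"
  by (simp add: node_poly_def poly_prod)

lemma node_poly_monic: "degree (node_poly t j) = j \<and> coeff (node_poly t j) j = 1"
proof (induction j)
  case 0
  then show ?case by (simp add: node_poly_def)
next
  case (Suc j)
  have eq: "node_poly t (Suc j) = node_poly t j * [:- t j, 1:]" by (simp add: node_poly_def)
  have "node_poly t j \<noteq> 0" using Suc by auto
  then have d: "degree (node_poly t (Suc j)) = Suc j" unfolding eq using Suc by (subst degree_mult_eq) auto
  moreover have "lead_coeff (node_poly t (Suc j)) = 1" unfolding eq lead_coeff_mult using Suc by simp
  ultimately show ?case by simp
qed

fun newton_poly :: "(real \<Rightarrow> real) \<Rightarrow> (nat \<Rightarrow> real) \<Rightarrow> nat \<Rightarrow> real poly" where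
  "newton_poly h t 0 = 0"
| "newton_poly h t (Suc j) = newton_poly h t j
    + smult ((h (t j) - poly (newton_poly h t j) (t j)) / poly (node_poly t j) (t j)) (node_poly t j)"

lemma newton_poly_interpolates:
  assumes "inj_on t {..<j}" "i < j"
  shows "poly (newton_poly h t j) (t i) = h (t i)"
  using assms
proof (induction j)
  case (Suc j)
  show ?case
  proof (cases "i = j")
    case True
    have "poly (node_poly t j) (t j) \<noteq> 0"
      using Suc.prems(1) by (fastforce simp: poly_node_poly inj_on_def)
    then show ?thesis using True by simp
  next
    case False
    then have "i < j" using Suc.prems by simp
    then have "poly (node_poly t j) (t i) = 0" by (auto simp: poly_node_poly)
    moreover have "inj_on t {..<j}" using Suc.prems(1) by (rule inj_on_subset) auto
    ultimately show ?thesis using Suc \<open>i < j\<close> by simp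
  qed
qed simp

lemma newton_poly_degree: "degree (newton_poly h t (Suc j)) \<le> j"
proof (induction j)
  case 0
  then show ?case by (simp add: node_poly_def)
next
  case (Suc j)
  have "degree (smult c (node_poly t (Suc j))) \<le> Suc j" for c
    using node_poly_monic[of t "Suc j"] degree_smult_le[of c "node_poly t (Suc j)"] by simp
  then show ?case using Suc newton_poly.simps(2)[of h t "Suc j"] degree_add_le[of _ "Suc j"]
    by (metis le_SucI)
qed

lemma newton_poly_coeff:
  assumes "absolutely_monotone h" "inj_on t {..j}" "t ` {..j} \<subseteq> {-1..<1}" "j \<ge> 1"
  shows "coeff (newton_poly h t (Suc j)) j \<ge> 0"
proof (rule interpolation_leading_coeff_nonneg[OF assms(1,4) newton_poly_degree, where S = "t ` {..j}" and D = "{}"])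
  show "poly (newton_poly h t (Suc j)) s = h s" if "s \<in> t ` {..j}" for s
    using that newton_poly_interpolates[of t "Suc j"] assms(2) by (auto simp: lessThan_Suc_atMost)
qed (use assms card_image[of t "{..j}"] in auto)

lemma newton_poly_expansion:
  assumes "absolutely_monotone h" "inj_on t {..<m}" "t ` {..<m} \<subseteq> {-1..<1}" 
  shows "\<exists>c. (\<forall>j. 1 \<le> j \<and> j < m \<longrightarrow> c j \<ge> 0) \<and> newton_poly h t m = (\<Sum>j<m. smult (c j) (node_poly t j))"
proof -
  let ?c = "\<lambda>j. (h (t j) - poly (newton_poly h t j) (t j)) / poly (node_poly t j) (t j)"
  have "newton_poly h t m = (\<Sum>j<m. smult (?c j) (node_poly t j))" by (induction m) auto
  \<comment> \<open>\<open>?c j\<close> is the coefficient of degree \<open>j\<close> of the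
    interpolant at \<open>j + 1\<close> nodes, since the preceding interpolant has smaller degree.
    Index 0 is left out because \<open>h\<close> itself may take negative values.\<close>
  moreover have "?c j \<ge> 0" if "1 \<le> j" "j < m" for j
  proof -
    have "inj_on t {..j}" using assms(2) by (rule inj_on_subset) (use that in auto)
    moreover have "t ` {..j} \<subseteq> {-1..<1}" using assms(3) that by fastforce
    ultimately have "coeff (newton_poly h t (Suc j)) j \<ge> 0" using newton_poly_coeff that assms(1) by blast
    moreover have "coeff (newton_poly h t j) j = 0"
      using that newton_poly_degree[of h t "j - 1"] by (intro coeff_eq_0) simp
    ultimately show ?thesis using node_poly_monic[of t j] by simp
  qed
  ultimately show ?thesis by (intro exI[of _ ?c]) auto
qed

text \<open>Hermite interpolation at \<open>t 0, \<dots>, t (m - 1)\<close>, where the node \<open>t k\<close> counts twice.\<close>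
lemma hermite_minorant:
  assumes h: "absolutely_monotone h" and inj: "inj_on t {..<m}" and t: "t ` {..<m} \<subseteq> {-1..<1}"
    and k: "k < m" "t k > -1"
  obtains c where "\<And>j. 1 \<le> j \<Longrightarrow> j \<le> m \<Longrightarrow> c j \<ge> 0"
    "\<And>i. i < m \<Longrightarrow> (\<Sum>j\<le>m. c j * poly (node_poly t j) (t i)) = h (t i)"
    "\<And>x. x \<in> {-1..<1} \<Longrightarrow> (x - t k) * poly (node_poly t m) x \<ge> 0 \<Longrightarrow>
       (\<Sum>j\<le>m. c j * poly (node_poly t j) x) \<le> h x"
proof -
  let ?P = "node_poly t m" let ?F = "newton_poly h t m" let ?d = "t k"
  obtain c where c: "\<And>j. 1 \<le> j \<and> j < m \<Longrightarrow> c j \<ge> 0" "?F = (\<Sum>j<m. smult (c j) (node_poly t j))"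
    using newton_poly_expansion[OF h inj t] by blast
  have P0: "poly ?P (t i) = 0" if "i < m" for i using that by (auto simp: poly_node_poly)
  have P': "poly (pderiv ?P) ?d \<noteq> 0"
  proof -
    define Q where "Q = (\<Prod>i\<in>{..<m} - {k}. [:- t i, 1:])"
    have "?P = [:- ?d, 1:] * Q"
      unfolding node_poly_def Q_def using k by (intro prod.remove) auto
    then have "poly (pderiv ?P) ?d = poly Q ?d"
      by (simp add: pderiv_mult pderiv_pCons del: mult_pCons_left)
    then have "poly (pderiv ?P) ?d = (\<Prod>i\<in>{..<m} - {k}. ?d - t i)"
      by (simp add: Q_def poly_prod)
    then show ?thesis using inj k by (auto simp: inj_on_def)
  qed
  \<comment> \<open>The last Newton step repeats the node \<open>t k\<close>: the coefficient is
    fixed by the derivative there, and the values at the nodes do not change.\<close>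
  define c' where "c' = (deriv h ?d - poly (pderiv ?F) ?d) / poly (pderiv ?P) ?d"
  define G where "G = ?F + smult c' ?P"
  have dF: "degree ?F \<le> m - 1" using newton_poly_degree[of h t "m - 1"] k by simp
  have dP: "degree (smult r ?P) \<le> m" for r using node_poly_monic[of t m] degree_smult_le[of r ?P] by simp
  have dG: "degree G \<le> m" unfolding G_def using dF dP by (intro degree_add_le) auto
  have Gm: "coeff G m = c'"
    unfolding G_def using dF k node_poly_monic[of t m] by (simp add: coeff_eq_0)
  have Gt: "poly G (t i) = h (t i)" if "i < m" for i
    using newton_poly_interpolates[OF inj that] P0[OF that] by (simp add: G_def)
  have Gd: "poly (pderiv G) ?d = deriv h ?d"
    using P' by (simp add: G_def c'_def pderiv_add pderiv_smult)
  have card_t: "card (t ` {..<m}) = m" using inj by (simp add: card_image)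
  have c'0: "c' \<ge> 0"
    unfolding Gm[symmetric] using k t Gt Gd card_t dG
    by (intro interpolation_leading_coeff_nonneg[OF h, where S = "t ` {..<m}" and D = "{?d}"]) auto
  have expand: "poly G x = (\<Sum>j\<le>m. (c(m := c')) j * poly (node_poly t j) x)" for x
    by (simp add: G_def c(2) poly_sum lessThan_Suc_atMost[symmetric])
  show ?thesis
  proof
    show "(c(m := c')) j \<ge> 0" if "1 \<le> j" "j \<le> m" for j using that c(1)[of j] c'0 by auto
    show "(\<Sum>j\<le>m. (c(m := c')) j * poly (node_poly t j) (t i)) = h (t i)" if "i < m" for i
      using Gt[OF that] expand by simp
    fix x assume x: "x \<in> {-1..<1}" "(x - ?d) * poly ?P x \<ge> 0"
    show "(\<Sum>j\<le>m. (c(m := c')) j * poly (node_poly t j) x) \<le> h x"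
      unfolding expand[symmetric]
    proof (cases "x \<in> t ` {..<m}")
      case True
      then show "poly G x \<le> h x" using Gt by auto
    next
      case False
      let ?Q = "[:- ?d, 1:] * ?P"
      \<comment> \<open>One more Newton step with \<open>x\<close> as an additional node. Thus
        \<open>r\<close> is the divided difference in the error formula
        \<open>h x - poly G x = r * poly ?Q x\<close>, and it is nonnegative as a leading
        coefficient.\<close>
      define r where "r = (h x - poly G x) / poly ?Q x"
      have Q0: "poly ?Q x \<noteq> 0" using False k by (auto simp: poly_node_poly)
      have mon: "degree ?Q = Suc m \<and> coeff ?Q (Suc m) = 1"
      proof -
        have "?P \<noteq> 0" using node_poly_monic[of t m] by auto
        then have "degree ?Q = Suc m" using node_poly_monic[of t m] by (subst degree_mult_eq) auto
        moreover have "lead_coeff ?Q = 1" unfolding lead_coeff_mult using node_poly_monic[of t m] by simp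
        ultimately show ?thesis by simp
      qed
      have "coeff (G + smult r ?Q) (Suc m) \<ge> 0"
      proof (rule interpolation_leading_coeff_nonneg[OF h, where S = "insert x (t ` {..<m})" and D = "{?d}"])
        show "degree (G + smult r ?Q) \<le> Suc m"
          using dG mon degree_smult_le[of r ?Q] by (intro degree_add_le) auto
        show "poly (G + smult r ?Q) s = h s" if "s \<in> insert x (t ` {..<m})" for s
          using that Gt P0 Q0 by (auto simp: r_def simp del: mult_pCons_left)
        show "poly (pderiv (G + smult r ?Q)) s = deriv h s" if "s \<in> {?d}" for s
          using that Gd P0[OF k(1)] by (simp add: pderiv_add pderiv_smult pderiv_mult pderiv_pCons del: mult_pCons_left)
      qed (use x t k False card_t in \<open>auto simp del: mult_pCons_left\<close>)
      then have "r \<ge> 0" using dG mon by (simp add: coeff_eq_0 del: mult_pCons_left)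
      moreover have "h x - poly G x = r * poly ?Q x" using Q0 by (simp add: r_def)
      moreover have "poly ?Q x \<ge> 0" using x(2) by (simp del: mult_pCons_left)
      ultimately show "poly G x \<le> h x" by (smt (verit) mult_nonneg_nonneg)
    qed
  qed
qed

section \<open>The energy bound in dimension 23\<close>

text \<open>All terms of positive degree are nonnegative by positive definiteness and are dropped.
  The diagonal pairs are included in the sum.\<close>

lemma gegen_expansion_bound:
  fixes C :: "(real^'n) set"
  assumes n: "CARD('n) > 2" and C: "spherical_code C"
    and P: "\<And>s. P s = (\<Sum>k\<le>m. b k * gegen CARD('n) k s)" and b: "\<And>k. k \<in> {1..m} \<Longrightarrow> b k \<ge> 0"
  shows "(\<Sum>x\<in>C. \<Sum>y\<in>C. P (x \<bullet> y)) \<ge> b 0 * (real (card C))\<^sup>2"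
proof -
  let ?S = "\<lambda>k. \<Sum>x\<in>C. \<Sum>y\<in>C. gegen CARD('n) k (x \<bullet> y)"
  have pos: "?S k \<ge> 0" for k
    using gegen_positive_definite[of C "\<lambda>x. x" "\<lambda>_. 1" k] n C by (force simp: spherical_code_def)
  have "(\<Sum>x\<in>C. \<Sum>y\<in>C. P (x \<bullet> y)) = (\<Sum>k\<le>m. b k * ?S k)"
    unfolding P sum_distrib_left by (subst sum.swap, subst sum.swap[of _ _ C]) (intro sum.cong refl sum.swap)
  also have "\<dots> = b 0 * ?S 0 + (\<Sum>k\<in>{1..m}. b k * ?S k)"
    by (simp add: atMost_atLeast0 sum.atLeast_Suc_atMost)
  also have "\<dots> \<ge> b 0 * ?S 0"
  proof -
    have "(\<Sum>k\<in>{1..m}. b k * ?S k) \<ge> 0" using b pos by (intro sum_nonneg) (meson mult_nonneg_nonneg)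
    then show ?thesis by simp
  qed
  finally show ?thesis by (simp add: power2_eq_square)
qed

lemma gegen_rec:
  "k = Suc m \<Longrightarrow> m = Suc l \<Longrightarrow> gegen n k t = t * gegen n m t - gegen_coeff n m * gegen n l t"
  by simp

lemma zonal_deriv_rec:
  "m = Suc l \<Longrightarrow> zonal_deriv n m = 1 + zonal_deriv n l * (2 * real l - 4 + real n) / (2 * real l - 2 + real n)"
  by simp

lemma zonal_deriv_23:
  "zonal_deriv 23 1 = 1" "zonal_deriv 23 2 = 44/23" "zonal_deriv 23 3 = 69/25" "zonal_deriv 23 4 = 32/9"
  "zonal_deriv 23 5 = 125/29"
proof -
  show 1: "zonal_deriv 23 1 = 1" by simp
  show 2: "zonal_deriv 23 2 = 44/23"
    using zonal_deriv_rec[of 2 1 23] by (simp add: 1 del: zonal_deriv.simps One_nat_def)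
  show 3: "zonal_deriv 23 3 = 69/25"
    using zonal_deriv_rec[of 3 2 23] by (simp add: 2 del: zonal_deriv.simps One_nat_def)
  show 4: "zonal_deriv 23 4 = 32/9"
    using zonal_deriv_rec[of 4 3 23] by (simp add: 3 del: zonal_deriv.simps One_nat_def)
  show "zonal_deriv 23 5 = 125/29"
    using zonal_deriv_rec[of 5 4 23] by (simp add: 4 del: zonal_deriv.simps One_nat_def)
qed

lemma gegen_01: "gegen n 0 t = 1" "gegen n 1 t = t"
  by simp_all

lemma gegen_23:
  "gegen 23 2 t = t^2 - 1/23"
  "gegen 23 3 t = t^3 - 3/25 * t"
  "gegen 23 4 t = t^4 - 2/9 * t^2 + 1/225"
  "gegen 23 5 t = t^5 - 10/29 * t^3 + 5/261 * t"
  "gegen 23 6 t = t^6 - 15/31 * t^4 + 45/899 * t^2 - 5/8091"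
proof -
  have g: "gegen_coeff 23 1 = 1/23" "gegen_coeff 23 2 = 44/575" "gegen_coeff 23 3 = 23/225"
    "gegen_coeff 23 4 = 32/261" "gegen_coeff 23 5 = 125/899"
    by (simp_all add: gegen_coeff_def zonal_deriv_23 del: One_nat_def zonal_deriv.simps(2))
  have r: "gegen 23 2 t = t * gegen 23 1 t - gegen_coeff 23 1 * gegen 23 0 t"
    "gegen 23 3 t = t * gegen 23 2 t - gegen_coeff 23 2 * gegen 23 1 t"
    "gegen 23 4 t = t * gegen 23 3 t - gegen_coeff 23 3 * gegen 23 2 t"
    "gegen 23 5 t = t * gegen 23 4 t - gegen_coeff 23 4 * gegen 23 3 t"
    "gegen 23 6 t = t * gegen 23 5 t - gegen_coeff 23 5 * gegen 23 4 t"
    by (rule gegen_rec; simp)+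
  show 2: "gegen 23 2 t = t^2 - 1/23"
    unfolding r(1) g gegen_01 by (simp add: power2_eq_square)
  show 3: "gegen 23 3 t = t^3 - 3/25 * t"
    unfolding r(2) g gegen_01 2 by (simp add: field_simps eval_nat_numeral)
  show 4: "gegen 23 4 t = t^4 - 2/9 * t^2 + 1/225"
    unfolding r(3) g 2 3 by (simp add: field_simps eval_nat_numeral)
  show 5: "gegen 23 5 t = t^5 - 10/29 * t^3 + 5/261 * t"
    unfolding r(4) g 3 4 by (simp add: field_simps eval_nat_numeral)
  show "gegen 23 6 t = t^6 - 15/31 * t^4 + 45/899 * t^2 - 5/8091"
    unfolding r(5) g 4 5 by (simp add: field_simps eval_nat_numeral)
qed

text \<open>In this order the partial products of the factors \<open>s - code_node i\<close> have
  nonnegative Gegenbauer coefficients. The repeated node always comes seventh, so the basis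
  polynomials up to degree 6 are the same for all three \<open>T\<close>.\<close>

definition code_node :: "nat \<Rightarrow> real" where
  "code_node i = [-1, -1/2, -1/4, 0, 1/4, 1/2] ! i"

text \<open>Coefficients of the first Newton basis polynomials in the Gegenbauer basis for dimension 23.\<close>
definition node_gegen :: "nat \<Rightarrow> real list" where
  "node_gegen j = [[1], [1, 1], [25/46, 3/2, 1], [37/184, 199/200, 7/4, 1],
    [199/4600, 67/200, 79/72, 7/4, 1], [3/800, 313/7200, 23/96, 363/464, 3/2, 1],
    [1/66240, 1/2880, 61/16704, 15/464, 85/496, 1, 1]] ! j"

lemma code_node_values:
  "code_node 0 = -1" "code_node 1 = -1/2" "code_node 2 = -1/4" "code_node 3 = 0" "code_node 4 = 1/4" "code_node 5 = 1/2"
  "code_node (Suc 0) = -1/2"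
  by (simp_all add: code_node_def)

lemma atMost_6_cases: "j \<le> (6::nat) \<Longrightarrow> j = 0 \<or> j = 1 \<or> j = 2 \<or> j = 3 \<or> j = 4 \<or> j = 5 \<or> j = 6"
  by auto

lemma sum_prod_upto_6:
  fixes f :: "nat \<Rightarrow> real"
  shows
    "(\<Sum>k\<le>0. f k) = f 0"
    "(\<Sum>k\<le>1. f k) = f 0 + f 1"
    "(\<Sum>k\<le>2. f k) = f 0 + f 1 + f 2"
    "(\<Sum>k\<le>3. f k) = f 0 + f 1 + f 2 + f 3"
    "(\<Sum>k\<le>4. f k) = f 0 + f 1 + f 2 + f 3 + f 4"
    "(\<Sum>k\<le>5. f k) = f 0 + f 1 + f 2 + f 3 + f 4 + f 5"
    "(\<Sum>k\<le>6. f k) = f 0 + f 1 + f 2 + f 3 + f 4 + f 5 + f 6"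
    "(\<Prod>k<0. f k) = 1"
    "(\<Prod>k<1. f k) = f 0"
    "(\<Prod>k<2. f k) = f 0 * f 1"
    "(\<Prod>k<3. f k) = f 0 * f 1 * f 2"
    "(\<Prod>k<4. f k) = f 0 * f 1 * f 2 * f 3"
    "(\<Prod>k<5. f k) = f 0 * f 1 * f 2 * f 3 * f 4"
    "(\<Prod>k<6. f k) = f 0 * f 1 * f 2 * f 3 * f 4 * f 5"
  by (simp_all add: eval_nat_numeral)

lemma node_poly_gegen:
  assumes "j \<le> 6"
  shows "poly (node_poly code_node j) s = (\<Sum>k\<le>j. node_gegen j ! k * gegen 23 k s)"
proof -
  have "poly (node_poly code_node 0) s = (\<Sum>k\<le>0. node_gegen 0 ! k * gegen 23 k s)"
    "poly (node_poly code_node 1) s = (\<Sum>k\<le>1. node_gegen 1 ! k * gegen 23 k s)"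
    "poly (node_poly code_node 2) s = (\<Sum>k\<le>2. node_gegen 2 ! k * gegen 23 k s)"
    "poly (node_poly code_node 3) s = (\<Sum>k\<le>3. node_gegen 3 ! k * gegen 23 k s)"
    "poly (node_poly code_node 4) s = (\<Sum>k\<le>4. node_gegen 4 ! k * gegen 23 k s)"
    "poly (node_poly code_node 5) s = (\<Sum>k\<le>5. node_gegen 5 ! k * gegen 23 k s)"
    "poly (node_poly code_node 6) s = (\<Sum>k\<le>6. node_gegen 6 ! k * gegen 23 k s)"
    unfolding poly_node_poly sum_prod_upto_6 gegen_23 gegen_01 code_node_values
    by (simp_all add: node_gegen_def) (simp_all add: field_simps eval_nat_numeral)
  then show ?thesis using atMost_6_cases[OF assms] by fastforce
qed

section \<open>Linear programming for codes avoiding T\<close>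

lemma unit_inner_ne_1:
  fixes x y :: "'a::real_inner"
  assumes "norm x = 1" "norm y = 1" "x \<noteq> y"
  shows "x \<bullet> y \<noteq> 1"
proof
  assume "x \<bullet> y = 1"
  moreover have "x \<bullet> x = 1" "y \<bullet> y = 1" using assms by (simp_all add: dot_square_norm)
  ultimately have "(x - y) \<bullet> (x - y) = 0"
    by (simp add: inner_diff_left inner_diff_right inner_commute[of y x])
  then show False using assms(3) by simp
qed

lemma avoiding_inner_range:
  assumes "spherical_code C" "avoiding T C" "x \<in> C" "y \<in> C" "x \<noteq> y"
  shows "x \<bullet> y \<in> {-1..<1}" "x \<bullet> y \<notin> T"
proof -
  have n: "norm x = 1" "norm y = 1" using assms by (auto simp: spherical_code_def)
  have "x \<bullet> y \<noteq> 1" using unit_inner_ne_1[OF n assms(5)] .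
  moreover have "\<bar>x \<bullet> y\<bar> \<le> 1" using Cauchy_Schwarz_ineq2[of x y] n by simp
  ultimately show "x \<bullet> y \<in> {-1..<1}" by auto
  show "x \<bullet> y \<notin> T" using assms unfolding avoiding_def inner_products_def by blast
qed

text \<open>The contribution of one point to the energy of the optimal code. It is linear in
  \<open>h\<close> and sees only the values at the six nodes, so \<open>h\<close> may be replaced by
  an interpolant.\<close>

definition design_energy :: "(real \<Rightarrow> real) \<Rightarrow> real" where
  "design_energy h = 2464 * (h (-1/2) + h (1/2)) + 22528 * (h (-1/4) + h (1/4)) + 43164 * h 0 + h (-1)"

lemma lessThan_6: "{..<6::nat} = {0,1,2,3,4,5}"
  by auto

lemma inj_on_code_node: "inj_on code_node {..<6}"
  unfolding lessThan_6 by (auto simp: code_node_def)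

text \<open>Exactness of the quadrature formula: \<open>node_gegen j ! 0\<close> is the mean of the
  basis polynomial over the sphere. For \<open>j = 6\<close> the right side is 0, and 93150 is the
  value 45/32 at 1 divided by the mean 1/66240.\<close>

lemma design_energy_node_poly:
  assumes "j \<le> 6"
  shows "93150 * node_gegen j ! 0 - poly (node_poly code_node j) 1 = design_energy (poly (node_poly code_node j))"
proof -
  have *: "{..<2::nat} = {0,1}" "{..<3::nat} = {0,1,2}" "{..<4::nat} = {0,1,2,3}"
    "{..<5::nat} = {0,1,2,3,4}" "{..<6::nat} = {0,1,2,3,4,5}" by auto
  show ?thesis
    using atMost_6_cases[OF assms]
    by (elim disjE; simp add: poly_node_poly code_node_def node_gegen_def design_energy_def *)
qed

lemma node_gegen_nonneg:
  assumes "j \<le> 6" "k \<le> j"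
  shows "node_gegen j ! k \<ge> 0"
proof -
  have "k < length (node_gegen j)" using atMost_6_cases[OF assms(1)] assms(2)
    by (elim disjE) (simp_all add: node_gegen_def)
  moreover have "\<forall>r\<in>set (node_gegen j). r \<ge> 0" using atMost_6_cases[OF assms(1)]
    by (elim disjE) (simp_all add: node_gegen_def)
  ultimately show ?thesis by simp
qed

text \<open>The intervals of \<open>T\<close> join four of the five nodes above -1 into neighbouring
  pairs, and the unpaired node is doubled: 0, -1/2 and 1/2 for the three sets. The product then
  consists of \<open>x + 1\<close>, a square, and two quadratics, each negative exactly on one
  interval of \<open>T\<close>.\<close>

lemma avoiding_sign:
  assumes T: "T \<in> {{-1/2<..<-1/4} \<union> {1/4<..<1/2},
                {-1/4<..<0} \<union> {1/4<..<1/2},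
                {-1/2<..<-1/4} \<union> {0<..<1/4}}"
  obtains k where "k \<in> {1..<6}"
    "\<And>x. x \<in> {-1..<1} \<Longrightarrow> x \<notin> T \<Longrightarrow> (x - code_node k) * poly (node_poly code_node 6) x \<ge> 0"
proof -
  have P: "poly (node_poly code_node 6) x = (x + 1) * (x + 1/2) * (x + 1/4) * x * (x - 1/4) * (x - 1/2)" for x
    by (simp add: poly_node_poly lessThan_6 code_node_def mult.assoc)
  consider "T = {-1/2<..<-1/4} \<union> {1/4<..<1/2}" | "T = {-1/4<..<0} \<union> {1/4<..<1/2}"
    | "T = {-1/2<..<-1/4} \<union> {0<..<1/4}" using T by blast
  then show ?thesis
  proof cases
    case 1
    show ?thesis
    proof (rule that[of 3])
      fix x :: real assume x: "x \<in> {-1..<1}" "x \<notin> T"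
      have "(x + 1/2) * (x + 1/4) \<ge> 0" "(x - 1/4) * (x - 1/2) \<ge> 0"
        using x 1 by (auto simp: zero_le_mult_iff)
      moreover have "x + 1 \<ge> 0" using x by simp
      ultimately have "(x + 1) * ((x + 1/2) * (x + 1/4)) * ((x - 1/4) * (x - 1/2)) * (x * x) \<ge> 0"
        by (meson mult_nonneg_nonneg zero_le_square)
      then show "(x - code_node 3) * poly (node_poly code_node 6) x \<ge> 0"
        unfolding P code_node_values by (simp add: mult_ac)
    qed simp
  next
    case 2
    show ?thesis
    proof (rule that[of 1])
      fix x :: real assume x: "x \<in> {-1..<1}" "x \<notin> T"
      have "(x + 1/4) * x \<ge> 0" "(x - 1/4) * (x - 1/2) \<ge> 0"
        using x 2 by (auto simp: zero_le_mult_iff)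
      moreover have "x + 1 \<ge> 0" using x by simp
      ultimately have "(x + 1) * ((x + 1/4) * x) * ((x - 1/4) * (x - 1/2)) * ((x + 1/2) * (x + 1/2)) \<ge> 0"
        by (meson mult_nonneg_nonneg zero_le_square)
      then show "(x - code_node 1) * poly (node_poly code_node 6) x \<ge> 0"
        unfolding P code_node_values by (simp add: mult_ac)
    qed simp
  next
    case 3
    show ?thesis
    proof (rule that[of 5])
      fix x :: real assume x: "x \<in> {-1..<1}" "x \<notin> T"
      have "(x + 1/2) * (x + 1/4) \<ge> 0" "x * (x - 1/4) \<ge> 0"
        using x 3 by (auto simp: zero_le_mult_iff)
      moreover have "x + 1 \<ge> 0" using x by simp
      ultimately have "(x + 1) * ((x + 1/2) * (x + 1/4)) * (x * (x - 1/4)) * ((x - 1/2) * (x - 1/2)) \<ge> 0"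
        by (meson mult_nonneg_nonneg zero_le_square)
      then show "(x - code_node 5) * poly (node_poly code_node 6) x \<ge> 0"
        unfolding P code_node_values by (simp add: mult_ac)
    qed simp
  qed
qed

theorem energy_lower_bound:
  fixes C :: "(real^23) set"
  assumes T: "T \<in> {{-1/2<..<-1/4} \<union> {1/4<..<1/2},
                {-1/4<..<0} \<union> {1/4<..<1/2},
                {-1/2<..<-1/4} \<union> {0<..<1/4}}"
    and h: "absolutely_monotone h" and C: "spherical_code C" "avoiding T C" "card C = 93150"
  shows "energy h C \<ge> 93150 * design_energy h"
proof -
  let ?P = "\<lambda>j. poly (node_poly code_node j)"
  obtain k where k: "k \<in> {1..<6}"
    "\<And>x. x \<in> {-1..<1} \<Longrightarrow> x \<notin> T \<Longrightarrow> (x - code_node k) * ?P 6 x \<ge> 0"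
    using avoiding_sign[OF T] by blast
  have range: "code_node ` {..<6} \<subseteq> {-1..<1}" unfolding lessThan_6 by (auto simp: code_node_def)
  have k1: "code_node k > -1"
  proof -
    have "k = 1 \<or> k = 2 \<or> k = 3 \<or> k = 4 \<or> k = 5" using k(1) by auto
    then show ?thesis by (auto simp: code_node_values)
  qed
  have k6: "k < 6" using k(1) by simp
  obtain c where c: "\<And>j. 1 \<le> j \<Longrightarrow> j \<le> 6 \<Longrightarrow> c j \<ge> 0"
    "\<And>i. i < 6 \<Longrightarrow> (\<Sum>j\<le>6. c j * ?P j (code_node i)) = h (code_node i)"
    "\<And>x. x \<in> {-1..<1} \<Longrightarrow> (x - code_node k) * ?P 6 x \<ge> 0 \<Longrightarrow> (\<Sum>j\<le>6. c j * ?P j x) \<le> h x"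
    by (fact hermite_minorant[OF h inj_on_code_node range k6 k1])
  define f where "f x = (\<Sum>j\<le>6. c j * ?P j x)" for x
  have fin: "finite C" using C(1) by (simp add: spherical_code_def)
  have self: "x \<bullet> x = 1" if "x \<in> C" for x using that C(1) by (auto simp: spherical_code_def dot_square_norm)
  have bound: "c j * (\<Sum>x\<in>C. \<Sum>y\<in>C. ?P j (x \<bullet> y)) \<ge> c j * (node_gegen j ! 0 * 93150\<^sup>2)" if j: "j \<le> 6" for j
  proof (cases "j = 0")
    \<comment> \<open>The coefficient \<open>c 0\<close> has no sign, but for the constant basis
      polynomial the bound is an equality.\<close>
    case True
    then show ?thesis by (simp add: poly_node_poly node_gegen_def C(3) power2_eq_square)
  next
    case False
    have "(\<Sum>x\<in>C. \<Sum>y\<in>C. ?P j (x \<bullet> y)) \<ge> node_gegen j ! 0 * (real (card C))\<^sup>2"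
      by (rule gegen_expansion_bound[where m = j])
         (use C node_poly_gegen[OF j] node_gegen_nonneg[OF j] in auto)
    then show ?thesis using C(3) c(1)[of j] j False by (intro mult_left_mono) auto
  qed
  have node: "f (code_node i) = h (code_node i)" if "i < 6" for i
    using c(2)[OF that] by (simp add: f_def)
  have "design_energy h = design_energy f"
    using node[of 0] node[of 1] node[of 2] node[of 3] node[of 4] node[of 5]
    by (simp add: design_energy_def code_node_values)
  also have "\<dots> = (\<Sum>j\<le>6. c j * design_energy (?P j))"
    unfolding design_energy_def f_def sum_distrib_left sum.distrib[symmetric]
    by (intro sum.cong refl) (simp add: algebra_simps)
  finally have "93150 * design_energy h = 93150 * (\<Sum>j\<le>6. c j * design_energy (?P j))" by simp
  also have "\<dots> = (\<Sum>j\<le>6. c j * (node_gegen j ! 0 * 93150\<^sup>2)) - 93150 * f 1"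
    unfolding f_def sum_distrib_left sum_subtractf[symmetric]
    by (intro sum.cong refl) (simp add: design_energy_node_poly[symmetric] algebra_simps)
  also have "\<dots> \<le> (\<Sum>j\<le>6. c j * (\<Sum>x\<in>C. \<Sum>y\<in>C. ?P j (x \<bullet> y))) - 93150 * f 1"
    using bound by (intro diff_right_mono sum_mono) auto
  also have "(\<Sum>j\<le>6. c j * (\<Sum>x\<in>C. \<Sum>y\<in>C. ?P j (x \<bullet> y))) = (\<Sum>x\<in>C. \<Sum>y\<in>C. f (x \<bullet> y))"
    unfolding f_def sum_distrib_left by (subst sum.swap) (intro sum.cong refl sum.swap)
  \<comment> \<open>The comparison of \<open>f\<close> with \<open>h\<close> is available only below
    1, so the diagonal is removed while the sum is still written with \<open>f\<close>.\<close>
  also have "\<dots> - 93150 * f 1 = (\<Sum>x\<in>C. \<Sum>y\<in>C - {x}. f (x \<bullet> y))"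
  proof -
    have "(\<Sum>x\<in>C. \<Sum>y\<in>C. f (x \<bullet> y)) = (\<Sum>x\<in>C. f 1 + (\<Sum>y\<in>C - {x}. f (x \<bullet> y)))"
      by (intro sum.cong refl) (simp add: sum.remove[OF fin] self)
    then show ?thesis using C(3) by (simp add: sum.distrib)
  qed
  also have "\<dots> \<le> energy h C"
    unfolding energy_def f_def
    by (intro sum_mono c(3) k(2)) (use avoiding_inner_range[OF C(1,2)] in auto)
  finally show ?thesis .
qed

section \<open>Kissing configurations in dimension 24\<close>

lemma zonal_deriv_24:
  "zonal_deriv 24 1 = 1" "zonal_deriv 24 2 = 23/12" "zonal_deriv 24 3 = 36/13" "zonal_deriv 24 4 = 25/7"
  "zonal_deriv 24 5 = 13/3" "zonal_deriv 24 6 = 81/16" "zonal_deriv 24 7 = 98/17"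
proof -
  show 1: "zonal_deriv 24 1 = 1" by simp
  show 2: "zonal_deriv 24 2 = 23/12"
    using zonal_deriv_rec[of 2 1 24] by (simp add: 1 del: zonal_deriv.simps One_nat_def)
  show 3: "zonal_deriv 24 3 = 36/13"
    using zonal_deriv_rec[of 3 2 24] by (simp add: 2 del: zonal_deriv.simps One_nat_def)
  show 4: "zonal_deriv 24 4 = 25/7"
    using zonal_deriv_rec[of 4 3 24] by (simp add: 3 del: zonal_deriv.simps One_nat_def)
  show 5: "zonal_deriv 24 5 = 13/3"
    using zonal_deriv_rec[of 5 4 24] by (simp add: 4 del: zonal_deriv.simps One_nat_def)
  show 6: "zonal_deriv 24 6 = 81/16"
    using zonal_deriv_rec[of 6 5 24] by (simp add: 5 del: zonal_deriv.simps One_nat_def)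
  show "zonal_deriv 24 7 = 98/17"
    using zonal_deriv_rec[of 7 6 24] by (simp add: 6 del: zonal_deriv.simps One_nat_def)
qed

lemma gegen_24:
  "gegen 24 2 t = t^2 - 1/24"
  "gegen 24 3 t = t^3 - 3/26 * t"
  "gegen 24 4 t = t^4 - 3/14 * t^2 + 3/728"
  "gegen 24 5 t = t^5 - 1/3 * t^3 + 1/56 * t"
  "gegen 24 6 t = t^6 - 15/32 * t^4 + 3/64 * t^2 - 1/1792"
  "gegen 24 7 t = t^7 - 21/34 * t^5 + 105/1088 * t^3 - 7/2176 * t"
  "gegen 24 8 t = t^8 - 7/9 * t^6 + 35/204 * t^4 - 35/3264 * t^2 + 7/78336"
proof -
  have g: "gegen_coeff 24 1 = 1/24" "gegen_coeff 24 2 = 23/312" "gegen_coeff 24 3 = 9/91"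
    "gegen_coeff 24 4 = 5/42" "gegen_coeff 24 5 = 13/96" "gegen_coeff 24 6 = 81/544" "gegen_coeff 24 7 = 49/306"
    by (simp_all add: gegen_coeff_def zonal_deriv_24 del: One_nat_def zonal_deriv.simps(2))
  have r: "gegen 24 2 t = t * gegen 24 1 t - gegen_coeff 24 1 * gegen 24 0 t"
    "gegen 24 3 t = t * gegen 24 2 t - gegen_coeff 24 2 * gegen 24 1 t"
    "gegen 24 4 t = t * gegen 24 3 t - gegen_coeff 24 3 * gegen 24 2 t"
    "gegen 24 5 t = t * gegen 24 4 t - gegen_coeff 24 4 * gegen 24 3 t"
    "gegen 24 6 t = t * gegen 24 5 t - gegen_coeff 24 5 * gegen 24 4 t"
    "gegen 24 7 t = t * gegen 24 6 t - gegen_coeff 24 6 * gegen 24 5 t"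
    "gegen 24 8 t = t * gegen 24 7 t - gegen_coeff 24 7 * gegen 24 6 t"
    by (rule gegen_rec; simp)+
  show 2: "gegen 24 2 t = t^2 - 1/24"
    unfolding r(1) g gegen_01 by (simp add: power2_eq_square)
  show 3: "gegen 24 3 t = t^3 - 3/26 * t"
    unfolding r(2) g gegen_01 2 by (simp add: field_simps eval_nat_numeral)
  show 4: "gegen 24 4 t = t^4 - 3/14 * t^2 + 3/728"
    unfolding r(3) g 2 3 by (simp add: field_simps eval_nat_numeral)
  show 5: "gegen 24 5 t = t^5 - 1/3 * t^3 + 1/56 * t"
    unfolding r(4) g 3 4 by (simp add: field_simps eval_nat_numeral)
  show 6: "gegen 24 6 t = t^6 - 15/32 * t^4 + 3/64 * t^2 - 1/1792"
    unfolding r(5) g 4 5 by (simp add: field_simps eval_nat_numeral)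
  show 7: "gegen 24 7 t = t^7 - 21/34 * t^5 + 105/1088 * t^3 - 7/2176 * t"
    unfolding r(6) g 5 6 by (simp add: field_simps eval_nat_numeral)
  show "gegen 24 8 t = t^8 - 7/9 * t^6 + 35/204 * t^4 - 35/3264 * t^2 + 7/78336"
    unfolding r(7) g 6 7 by (simp add: field_simps eval_nat_numeral)
qed

text \<open>The expression vanishes at \<open>e = 0\<close>, so a nonzero slope there would make it
  negative on one side.\<close>

lemma linear_quadratic_nonneg:
  fixes l g :: real
  assumes "\<And>e. 2 * e * l + e\<^sup>2 * g \<ge> 0"
  shows "l = 0"
proof (rule ccontr)
  assume l: "l \<noteq> 0"
  \<comment> \<open>Since \<open>r\<close> exceeds \<open>g\<close>, the linear term outweighs the
    quadratic one at \<open>e = - l / r\<close>.\<close>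
  define r where "r = 1 + \<bar>g\<bar>"
  have r: "r > 0" "g < r" unfolding r_def by auto
  have "2 * (- l / r) * l + (- l / r)\<^sup>2 * g = l\<^sup>2 / r\<^sup>2 * (g - 2 * r)"
    using r by (simp add: field_simps power2_eq_square)
  also have "\<dots> < 0" using l r by (intro mult_pos_neg) auto
  finally show False using assms[of "- l / r"] by simp
qed

text \<open>Cauchy-Schwarz for the positive semidefinite Gegenbauer kernels.\<close>
lemma gegen_sum_zero:
  fixes L :: "(real^'n) set"
  assumes n: "CARD('n) > 2" and L: "finite L" "\<And>z. z \<in> L \<Longrightarrow> norm z = 1"
    and zero: "(\<Sum>y\<in>L. \<Sum>z\<in>L. gegen CARD('n) k (y \<bullet> z)) = 0" and u: "norm u = 1"
  shows "(\<Sum>z\<in>L. gegen CARD('n) k (u \<bullet> z)) = 0"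
proof (rule linear_quadratic_nonneg[where g = "gegen CARD('n) k 1"])
  fix e :: real
  let ?G = "gegen CARD('n) k"
  \<comment> \<open>Weight \<open>e\<close> is put on \<open>u\<close> and weight 1 on each point of
    \<open>L\<close>; the index type keeps \<open>u\<close> apart even if it lies in
    \<open>L\<close>. The assumption \<open>zero\<close> removes the part that does not depend on
    \<open>e\<close>.\<close>
  let ?f = "case_option u (\<lambda>z. z)" and ?c = "case_option e (\<lambda>_. 1)"
  let ?I = "insert None (Some ` L)"
  have uu: "u \<bullet> u = 1" using u by (simp add: dot_square_norm)
  have s: "(\<Sum>i\<in>?I. F i) = F None + (\<Sum>z\<in>L. F (Some z))" for F :: "(real^'n) option \<Rightarrow> real"
    using L(1) by (simp add: sum.reindex)
  have "0 \<le> (\<Sum>i\<in>?I. \<Sum>j\<in>?I. ?c i * ?c j * ?G (?f i \<bullet> ?f j))"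
    using n L u by (intro gegen_positive_definite) auto
  also have "\<dots> = (e * e * ?G (u \<bullet> u) + (\<Sum>z\<in>L. e * ?G (u \<bullet> z)))
      + (\<Sum>y\<in>L. e * ?G (y \<bullet> u) + (\<Sum>z\<in>L. ?G (y \<bullet> z)))"
    unfolding s by simp
  also have "\<dots> = 2 * e * (\<Sum>z\<in>L. ?G (u \<bullet> z)) + e\<^sup>2 * ?G 1"
  proof -
    have c: "(\<Sum>y\<in>L. ?G (y \<bullet> u)) = (\<Sum>z\<in>L. ?G (u \<bullet> z))"
      by (intro sum.cong refl arg_cong[where f = ?G] inner_commute)
    show ?thesis
      unfolding sum.distrib sum_distrib_left[symmetric] c zero uu by (simp add: power2_eq_square)
  qed
  finally show "2 * e * (\<Sum>z\<in>L. ?G (u \<bullet> z)) + e\<^sup>2 * ?G 1 \<ge> 0" .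
qed

lemma sum_by_values:
  fixes h :: "real \<Rightarrow> real"
  assumes "finite D" "finite T" "\<And>z. z \<in> D \<Longrightarrow> f z \<in> T"
  shows "(\<Sum>z\<in>D. h (f z)) = (\<Sum>t\<in>T. real (card {z\<in>D. f z = t}) * h t)"
proof -
  have "(\<Sum>z\<in>D. h (f z)) = (\<Sum>z\<in>D. \<Sum>t\<in>T. if f z = t then h t else 0)"
    using assms(2,3) by (intro sum.cong refl) simp
  also have "\<dots> = (\<Sum>t\<in>T. \<Sum>z\<in>D. if f z = t then h t else 0)" by (rule sum.swap)
  also have "\<dots> = (\<Sum>t\<in>T. real (card {z\<in>D. f z = t}) * h t)"
    using assms(1) by (intro sum.cong refl) (simp add: sum.If_cases Int_def conj_commute)
  finally show ?thesis .
qed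

lemma inner_values_zeros:
  fixes t :: real
  assumes "t \<in> {-1/2, -1/4, 0, 1/4, 1/2}"
  shows "t^4 * (t\<^sup>2 - 1/4) * (t\<^sup>2 - 1/16) = 0" "t \<noteq> 0 \<Longrightarrow> 64 * t^4 - 20 * t^2 + 1 = 0"
  using assms by (elim insertE emptyE; hypsubst; simp add: power2_eq_square power4_eq_xxxx)+

text \<open>The cardinality is bounded only from below, which is what exhibiting vectors yields;
  \<open>tight_bound\<close> adds the converse.\<close>

locale kissing_configuration =
  fixes L :: "(real^'n) set"
  assumes dim: "CARD('n) = 24" and finite_L: "finite L" and card_L_ge: "card L \<ge> 196560"
    and norm_L: "x \<in> L \<Longrightarrow> norm x = 1" and minus_L: "x \<in> L \<Longrightarrow> - x \<in> L"
    and inner_L: "x \<in> L \<Longrightarrow> y \<in> L \<Longrightarrow> y \<noteq> x \<Longrightarrow> y \<noteq> - x \<Longrightarrow> x \<bullet> y \<in> {-1/2, -1/4, 0, 1/4, 1/2}"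
begin

lemma self_L: "x \<in> L \<Longrightarrow> x \<bullet> x = 1"
  using norm_L by (simp add: dot_square_norm)

lemma minus_neq_L: "x \<in> L \<Longrightarrow> - x \<noteq> x"
  using self_L by (metis inner_minus_left one_neq_neg_one)

text \<open>The linear programming bound with the polynomial \<open>t\<^sup>4 (t\<^sup>2 - 1/4) (t\<^sup>2 - 1/16)\<close> is attained,
  so the configuration is a design.\<close>
lemma tight_bound:
  shows "card L = 196560" "k \<in> {2, 4, 6, 8} \<Longrightarrow> (\<Sum>x\<in>L. \<Sum>y\<in>L. gegen 24 k (x \<bullet> y)) = 0"
proof -
  define S where "S k = (\<Sum>x\<in>L. \<Sum>y\<in>L. gegen 24 k (x \<bullet> y))" for k
  define f :: "real \<Rightarrow> real" where "f t = t^4 * (t\<^sup>2 - 1/4) * (t\<^sup>2 - 1/16)" for t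
  have pos: "S k \<ge> 0" for k
    using gegen_positive_definite[of L "\<lambda>x. x" "\<lambda>_. 1" k] dim norm_L by (simp add: S_def)
  \<comment> \<open>The constant coefficient fixes the extremal cardinality:
    \<open>f 1 + f (-1) = 45/32\<close>, and \<open>45/32 * 139776 = 196560\<close>.\<close>
  have f: "f t = 1/139776 + 1/448 * gegen 24 2 t + 541/8704 * gegen 24 4 t + 67/144 * gegen 24 6 t + gegen 24 8 t" for t
    unfolding f_def gegen_24 by (simp add: field_simps eval_nat_numeral)
  have inner_sum: "(\<Sum>y\<in>L. f (x \<bullet> y)) = 45/32" if x: "x \<in> L" for x
  proof -
    have "f (x \<bullet> y) = 0" if "y \<in> L - {x, - x}" for y
      using inner_values_zeros(1)[OF inner_L[OF x, of y]] that unfolding f_def by blast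
    then have "(\<Sum>y\<in>L. f (x \<bullet> y)) = (\<Sum>y\<in>{x, - x}. f (x \<bullet> y))"
      using finite_L x minus_L by (intro sum.mono_neutral_right) auto
    also have "\<dots> = 45/32" using minus_neq_L[OF x] self_L[OF x] by (simp add: f_def)
    finally show ?thesis .
  qed
  have "(\<Sum>x\<in>L. \<Sum>y\<in>L. f (x \<bullet> y)) = (\<Sum>x\<in>L. 45/32)"
    by (rule sum.cong[OF refl inner_sum])
  then have "(\<Sum>x\<in>L. \<Sum>y\<in>L. f (x \<bullet> y)) = 45/32 * real (card L)" by simp
  moreover have "(\<Sum>x\<in>L. \<Sum>y\<in>L. f (x \<bullet> y)) = 1/139776 * (real (card L))\<^sup>2 + 1/448 * S 2 + 541/8704 * S 4
      + 67/144 * S 6 + S 8"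
    unfolding f S_def sum.distrib sum_distrib_left by (simp add: power2_eq_square)
  ultimately have eq: "1/139776 * (real (card L))\<^sup>2 + 1/448 * S 2 + 541/8704 * S 4 + 67/144 * S 6 + S 8
      = 45/32 * real (card L)" by simp
  have ge: "real (card L) \<ge> 196560" using card_L_ge by simp
  have ge2: "(real (card L))\<^sup>2 \<ge> 196560 * real (card L)"
    unfolding power2_eq_square using ge by (intro mult_right_mono) auto
  then have S0: "S 2 = 0 \<and> S 4 = 0 \<and> S 6 = 0 \<and> S 8 = 0 \<and> (real (card L))\<^sup>2 = 196560 * real (card L)"
    using eq pos[of 2] pos[of 4] pos[of 6] pos[of 8] by linarith
  then have "real (card L) = 196560" using ge by (simp add: power2_eq_square)
  then show "card L = 196560" by linarith
  show "(\<Sum>x\<in>L. \<Sum>y\<in>L. gegen 24 k (x \<bullet> y)) = 0" if "k \<in> {2, 4, 6, 8}"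
    using that S0 unfolding S_def by auto
qed

text \<open>The vanishing Gegenbauer sums determine the power sums degree by degree. Each is 196560
  times the spherical mean of the power, for example \<open>196560 / 24 = 8190\<close> and
  \<open>3 * 196560 / (24 * 26) = 945\<close>.\<close>

lemma unit_moments:
  assumes "norm u = 1"
  shows "(\<Sum>z\<in>L. (u \<bullet> z)^2) = 8190" "(\<Sum>z\<in>L. (u \<bullet> z)^4) = 945"
    "(\<Sum>z\<in>L. (u \<bullet> z)^6) = 675/4" "(\<Sum>z\<in>L. (u \<bullet> z)^8) = 315/8"
proof -
  have z: "(\<Sum>z\<in>L. gegen 24 k (u \<bullet> z)) = 0" if "k \<in> {2, 4, 6, 8}" for k
    using gegen_sum_zero[of L k u] dim finite_L norm_L tight_bound(2)[OF that] assms by simp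
  have N: "real (card L) = 196560" using tight_bound(1) by simp
  show 2: "(\<Sum>z\<in>L. (u \<bullet> z)^2) = 8190"
    using z[of 2] N by (simp add: gegen_24 sum_subtractf)
  show 4: "(\<Sum>z\<in>L. (u \<bullet> z)^4) = 945"
    using z[of 4] N 2 by (simp add: gegen_24 sum_subtractf sum.distrib sum_distrib_left[symmetric] sum_divide_distrib[symmetric])
  show 6: "(\<Sum>z\<in>L. (u \<bullet> z)^6) = 675/4"
    using z[of 6] N 2 4 by (simp add: gegen_24 sum_subtractf sum.distrib sum_distrib_left[symmetric] sum_divide_distrib[symmetric])
  show "(\<Sum>z\<in>L. (u \<bullet> z)^8) = 315/8"
    using z[of 8] N 2 4 6 by (simp add: gegen_24 sum_subtractf sum.distrib sum_distrib_left[symmetric] sum_divide_distrib[symmetric])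
qed

lemma moments:
  shows "(\<Sum>z\<in>L. (v \<bullet> z)^2) = 8190 * (v \<bullet> v)" "(\<Sum>z\<in>L. (v \<bullet> z)^4) = 945 * (v \<bullet> v)^2"
    "(\<Sum>z\<in>L. (v \<bullet> z)^6) = 675/4 * (v \<bullet> v)^3" "(\<Sum>z\<in>L. (v \<bullet> z)^8) = 315/8 * (v \<bullet> v)^4"
proof -
  \<comment> \<open>For \<open>v = 0\<close> any unit vector will do, since \<open>v\<close> is then
    0 times that vector.\<close>
  define u where "u = (if v = 0 then axis undefined 1 else v /\<^sub>R norm v)"
  have u: "norm u = 1" by (simp add: u_def norm_axis_1)
  have v: "v = norm v *\<^sub>R u" by (simp add: u_def)
  have vz: "v \<bullet> z = norm v * (u \<bullet> z)" for z
    using arg_cong[OF v, of "\<lambda>w. w \<bullet> z"] by simp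
  have vv: "v \<bullet> v = (norm v)^2" by (simp add: dot_square_norm)
  have "(\<Sum>z\<in>L. (v \<bullet> z)^2) = norm v ^ 2 * (8190)"
    unfolding vz power_mult_distrib sum_distrib_left[symmetric] unit_moments[OF u] ..
  then show "(\<Sum>z\<in>L. (v \<bullet> z)^2) = 8190 * (v \<bullet> v)" by (simp add: vv)
  have "(\<Sum>z\<in>L. (v \<bullet> z)^4) = norm v ^ 4 * (945)"
    unfolding vz power_mult_distrib sum_distrib_left[symmetric] unit_moments[OF u] ..
  then show "(\<Sum>z\<in>L. (v \<bullet> z)^4) = 945 * (v \<bullet> v)^2" by (simp add: vv)
  have "(\<Sum>z\<in>L. (v \<bullet> z)^6) = norm v ^ 6 * (675/4)"
    unfolding vz power_mult_distrib sum_distrib_left[symmetric] unit_moments[OF u] ..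
  then show "(\<Sum>z\<in>L. (v \<bullet> z)^6) = 675/4 * (v \<bullet> v)^3" by (simp add: vv)
  have "(\<Sum>z\<in>L. (v \<bullet> z)^8) = norm v ^ 8 * (315/8)"
    unfolding vz power_mult_distrib sum_distrib_left[symmetric] unit_moments[OF u] ..
  then show "(\<Sum>z\<in>L. (v \<bullet> z)^8) = 315/8 * (v \<bullet> v)^4" by (simp add: vv)
qed

text \<open>Polarization: adding the moments of \<open>x + r y\<close> and \<open>x - r y\<close>
  cancels the odd powers of \<open>r\<close>, and orthogonality makes the result a known function of
  \<open>r\<close>. Different values of \<open>r\<close> separate the mixed moments.\<close>

lemma mixed_moments:
  assumes x: "x \<bullet> x = 1" and y: "y \<bullet> y = 1" and xy: "x \<bullet> y = 0"
  shows "(\<Sum>z\<in>L. (x \<bullet> z)^2 * (y \<bullet> z)^2) = 315" "(\<Sum>z\<in>L. (x \<bullet> z)^4 * (y \<bullet> z)^2) = 135/4"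
    "(\<Sum>z\<in>L. (x \<bullet> z)^2 * (y \<bullet> z)^4) = 135/4" "(\<Sum>z\<in>L. (x \<bullet> z)^4 * (y \<bullet> z)^4) = 27/8"
proof -
  define M where "M a b = (\<Sum>z\<in>L. (x \<bullet> z)^a * (y \<bullet> z)^b)" for a b
  have pure: "M 4 0 = 945" "M 0 4 = 945" "M 6 0 = 675/4" "M 0 6 = 675/4" "M 8 0 = 315/8" "M 0 8 = 315/8"
    using moments[of x] moments[of y] x y by (simp_all add: M_def)
  have vv: "(x + r *\<^sub>R y) \<bullet> (x + r *\<^sub>R y) = 1 + r\<^sup>2" for r
    using x y xy by (simp add: inner_add_left inner_add_right inner_commute[of y x] power2_eq_square)
  have vz: "(x + r *\<^sub>R y) \<bullet> z = (x \<bullet> z) + r * (y \<bullet> z)" for r z by (simp add: inner_add_left)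
  have e4: "(s + r * t)^4 + (s + (- r) * t)^4 = 2 * (s^4 * t^0) + 12 * r^2 * (s^2 * t^2) + 2 * r^4 * (s^0 * t^4)" for s t r :: real
    by algebra
  have e6: "(s + r * t)^6 + (s + (- r) * t)^6 = 2 * (s^6 * t^0) + 30 * r^2 * (s^4 * t^2) + 30 * r^4 * (s^2 * t^4) + 2 * r^6 * (s^0 * t^6)" for s t r :: real
    by algebra
  have e8: "(s + r * t)^8 + (s + (- r) * t)^8 = 2 * (s^8 * t^0) + 56 * r^2 * (s^6 * t^2) + 140 * r^4 * (s^4 * t^4)
      + 56 * r^6 * (s^2 * t^6) + 2 * r^8 * (s^0 * t^8)" for s t r :: real
    by algebra
  have m4: "2 * M 4 0 + 12 * r^2 * M 2 2 + 2 * r^4 * M 0 4 = 1890 * (1 + r\<^sup>2)^2" for r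
  proof -
    have "2 * M 4 0 + 12 * r^2 * M 2 2 + 2 * r^4 * M 0 4
        = (\<Sum>z\<in>L. ((x + r *\<^sub>R y) \<bullet> z)^4) + (\<Sum>z\<in>L. ((x + (- r) *\<^sub>R y) \<bullet> z)^4)"
      unfolding M_def sum_distrib_left sum.distrib[symmetric] vz e4 ..
    then show ?thesis unfolding moments vv by simp
  qed
  have m6: "2 * M 6 0 + 30 * r^2 * M 4 2 + 30 * r^4 * M 2 4 + 2 * r^6 * M 0 6 = 675/2 * (1 + r\<^sup>2)^3" for r
  proof -
    have "2 * M 6 0 + 30 * r^2 * M 4 2 + 30 * r^4 * M 2 4 + 2 * r^6 * M 0 6
        = (\<Sum>z\<in>L. ((x + r *\<^sub>R y) \<bullet> z)^6) + (\<Sum>z\<in>L. ((x + (- r) *\<^sub>R y) \<bullet> z)^6)"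
      unfolding M_def sum_distrib_left sum.distrib[symmetric] vz e6 ..
    then show ?thesis unfolding moments vv by simp
  qed
  have m8: "2 * M 8 0 + 56 * r^2 * M 6 2 + 140 * r^4 * M 4 4 + 56 * r^6 * M 2 6 + 2 * r^8 * M 0 8 = 315/4 * (1 + r\<^sup>2)^4" for r
  proof -
    have "2 * M 8 0 + 56 * r^2 * M 6 2 + 140 * r^4 * M 4 4 + 56 * r^6 * M 2 6 + 2 * r^8 * M 0 8
        = (\<Sum>z\<in>L. ((x + r *\<^sub>R y) \<bullet> z)^8) + (\<Sum>z\<in>L. ((x + (- r) *\<^sub>R y) \<bullet> z)^8)"
      unfolding M_def sum_distrib_left sum.distrib[symmetric] vz e8 ..
    then show ?thesis unfolding moments vv by simp
  qed
  have "M 2 2 = 315" using m4[of 1] pure by simp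
  \<comment> \<open>Degree 6 leaves two unknowns and degree 8 three, hence two and three values of
    \<open>r\<close>.\<close>
  moreover have "M 4 2 = 135/4" "M 2 4 = 135/4" using m6[of 1] m6[of 2] pure by simp_all
  moreover have "M 4 4 = 27/8" using m8[of 1] m8[of 2] m8[of 3] pure by simp
  ultimately show "(\<Sum>z\<in>L. (x \<bullet> z)^2 * (y \<bullet> z)^2) = 315" "(\<Sum>z\<in>L. (x \<bullet> z)^4 * (y \<bullet> z)^2) = 135/4"
    "(\<Sum>z\<in>L. (x \<bullet> z)^2 * (y \<bullet> z)^4) = 135/4" "(\<Sum>z\<in>L. (x \<bullet> z)^4 * (y \<bullet> z)^4) = 27/8"
    by (simp_all add: M_def)
qed

text \<open>The polynomial \<open>64 (s\<^sup>2 - 1/4) (s\<^sup>2 - 1/16)\<close> picks out the vectors orthogonal to \<open>x\<close>, apart from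
  a contribution of \<open>x\<close> and \<open>- x\<close> themselves.\<close>
lemma section_sum:
  assumes x: "x \<in> L"
  shows "(\<Sum>z\<in>L. (64 * (x \<bullet> z)^4 - 20 * (x \<bullet> z)^2 + 1) * F z)
    = (\<Sum>z\<in>{z\<in>L. x \<bullet> z = 0}. F z) + 45 * (F x + F (- x))"
proof -
  let ?g = "\<lambda>s :: real. 64 * s^4 - 20 * s^2 + 1"
  let ?C = "{z\<in>L. x \<bullet> z = 0}"
  have g0: "?g (x \<bullet> z) = 0" if "z \<in> L" "x \<bullet> z \<noteq> 0" "z \<noteq> x" "z \<noteq> - x" for z
    using inner_values_zeros(2)[OF inner_L[OF x that(1,3,4)] that(2)] .
  have "(\<Sum>z\<in>L. ?g (x \<bullet> z) * F z) = (\<Sum>z\<in>?C \<union> {x, - x}. ?g (x \<bullet> z) * F z)"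
    using finite_L x minus_L g0 by (intro sum.mono_neutral_right) auto
  also have "\<dots> = (\<Sum>z\<in>?C. ?g (x \<bullet> z) * F z) + (\<Sum>z\<in>{x, - x}. ?g (x \<bullet> z) * F z)"
    using finite_L self_L[OF x] by (intro sum.union_disjoint) auto
  also have "(\<Sum>z\<in>?C. ?g (x \<bullet> z) * F z) = (\<Sum>z\<in>?C. F z)" by (intro sum.cong refl) simp
  also have "(\<Sum>z\<in>{x, - x}. ?g (x \<bullet> z) * F z) = 45 * (F x + F (- x))"
    using minus_neq_L[OF x] self_L[OF x] by simp
  finally show ?thesis .
qed

lemma card_section:
  assumes x: "x \<in> L"
  shows "card {z\<in>L. x \<bullet> z = 0} = 93150"
proof -
  \<comment> \<open>\<open>64 * 945 - 20 * 8190 + 196560 = 93240\<close>, of which \<open>x\<close>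
    and \<open>- x\<close> account for 90.\<close>
  have "(\<Sum>z\<in>L. 64 * (x \<bullet> z)^4 - 20 * (x \<bullet> z)^2 + 1) = 93240"
    using moments(1,2)[of x] self_L[OF x] tight_bound(1)
    by (simp add: sum.distrib sum_subtractf sum_distrib_left[symmetric])
  then have "real (card {z\<in>L. x \<bullet> z = 0}) = 93150"
    using section_sum[OF x, of "\<lambda>_. 1"] by simp
  then show ?thesis by linarith
qed

lemma section_moments:
  assumes x: "x \<in> L" and y: "y \<in> L" and xy: "x \<bullet> y = 0"
  shows "(\<Sum>z\<in>{z\<in>L. x \<bullet> z = 0}. (y \<bullet> z)^2) = 4050" "(\<Sum>z\<in>{z\<in>L. x \<bullet> z = 0}. (y \<bullet> z)^4) = 486"
proof -
  note m = mixed_moments[OF self_L[OF x] self_L[OF y] xy] moments(1,2)[of y]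
  have yx: "y \<bullet> x = 0" using xy by (simp add: inner_commute)
  have e: "(64 * s^4 - 20 * s^2 + 1) * r = 64 * (s^4 * r) - 20 * (s^2 * r) + r" for s r :: real
    by (simp add: algebra_simps)
  show "(\<Sum>z\<in>{z\<in>L. x \<bullet> z = 0}. (y \<bullet> z)^2) = 4050"
    using section_sum[OF x, of "\<lambda>z. (y \<bullet> z)^2"] yx self_L[OF y]
    unfolding e sum.distrib sum_subtractf sum_distrib_left[symmetric] m by simp
  show "(\<Sum>z\<in>{z\<in>L. x \<bullet> z = 0}. (y \<bullet> z)^4) = 486"
    using section_sum[OF x, of "\<lambda>z. (y \<bullet> z)^4"] yx self_L[OF y]
    unfolding e sum.distrib sum_subtractf sum_distrib_left[symmetric] m by simp
qed

text \<open>Antipodality and \<open>A 1 = 1\<close> leave the unknowns \<open>A 0\<close>,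
  \<open>A (1/4)\<close> and \<open>A (1/2)\<close>. The cardinality and the second and fourth
  moments of the section are three independent linear equations for them.\<close>

lemma section_distribution:
  fixes h :: "real \<Rightarrow> real"
  assumes x: "x \<in> L" and y: "y \<in> L" and xy: "x \<bullet> y = 0"
  defines "C \<equiv> {z\<in>L. x \<bullet> z = 0}"
  shows "(\<Sum>z\<in>C - {y}. h (y \<bullet> z)) =
    2464 * (h (-1/2) + h (1/2)) + 22528 * (h (-1/4) + h (1/4)) + 43164 * h 0 + h (-1)"
proof -
  define A where "A t = real (card {z\<in>C. y \<bullet> z = t})" for t
  let ?T = "{-1, -1/2, -1/4, 0, 1/4, 1/2, 1 :: real}"
  have fin: "finite C" using finite_L by (simp add: C_def)
  have yC: "y \<in> C" "- y \<in> C" using y xy minus_L by (auto simp: C_def)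
  have yy: "y \<bullet> y = 1" by (rule self_L[OF y])
  have mem: "y \<bullet> z \<in> ?T" if "z \<in> C" for z
    using inner_L[OF y, of z] that yy by (cases "z = y"; cases "z = - y") (auto simp: C_def)
  have vals: "(\<Sum>z\<in>C. F (y \<bullet> z)) = A (-1) * F (-1) + A (-1/2) * F (-1/2) + A (-1/4) * F (-1/4) + A 0 * F 0
      + A (1/4) * F (1/4) + A (1/2) * F (1/2) + A 1 * F 1" for F :: "real \<Rightarrow> real"
    using sum_by_values[OF fin, of ?T "\<lambda>z. y \<bullet> z" F] mem by (simp add: A_def)
  have sym: "A (- t) = A t" for t
  proof -
    have "bij_betw uminus {z\<in>C. y \<bullet> z = - t} {z\<in>C. y \<bullet> z = t}"
      by (rule bij_betw_byWitness[where f' = uminus]) (auto simp: C_def minus_L)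
    then show ?thesis by (simp add: A_def bij_betw_same_card)
  qed
  have "{z\<in>C. y \<bullet> z = 1} = {y}"
    using inner_L[OF y] yC yy by (fastforce simp: C_def)
  then have A1: "A 1 = 1" by (simp add: A_def)
  have s: "A (-1) = 1" "A (-1/2) = A (1/2)" "A (-1/4) = A (1/4)"
    using sym[of 1] sym[of "1/2"] sym[of "1/4"] A1 by simp_all
  have "A 0 + 2 * A (1/4) + 2 * A (1/2) + 2 = 93150"
    using vals[of "\<lambda>_. 1"] card_section[OF x] A1 s by (simp add: C_def)
  moreover have "A (1/4) / 8 + A (1/2) / 2 + 2 = 4050"
    using vals[of "\<lambda>t. t^2"] section_moments(1)[OF x y xy] A1 s by (simp add: C_def power2_eq_square)
  moreover have "A (1/4) / 128 + A (1/2) / 8 + 2 = 486"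
    using vals[of "\<lambda>t. t^4"] section_moments(2)[OF x y xy] A1 s by (simp add: C_def power4_eq_xxxx)
  ultimately have A: "A (1/2) = 2464" "A (1/4) = 22528" "A 0 = 43164" by linarith+
  have "(\<Sum>z\<in>C. h (y \<bullet> z)) = h 1 + (\<Sum>z\<in>C - {y}. h (y \<bullet> z))"
    using sum.remove[OF fin yC(1), of "\<lambda>z. h (y \<bullet> z)"] yy by simp
  then show ?thesis using vals[of h] A A1 s by (simp add: algebra_simps)
qed

end

section \<open>The Golay code\<close>

lemma UNIV_23: "(UNIV :: 23 set) = {0,1,2,3,4,5,6,7,8,9,10,11,12,13,14,15,16,17,18,19,20,21,22}" (is "_ = ?S")
proof -
  have "card ?S = CARD(23)" by simp
  then show ?thesis using card_subset_eq[of "UNIV :: 23 set" ?S] by simp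
qed

lemma mem_23: "(x :: 23) \<in> {0,1,2,3,4,5,6,7,8,9,10,11,12,13,14,15,16,17,18,19,20,21,22}"
  using UNIV_I[of x] unfolding UNIV_23 .

definition nonsquares_23 :: "23 set" where
  "nonsquares_23 = {5,7,10,11,14,15,17,19,20,21,22}"

lemma nonsquares_23: "n \<notin> range (\<lambda>k. k * k) \<longleftrightarrow> n \<in> nonsquares_23"
proof -
  have r: "range (\<lambda>k :: 23. k * k) = {0,1,2,3,4,6,8,9,12,13,16,18}"
    unfolding UNIV_23 by auto
  show ?thesis using mem_23[of n] unfolding r nonsquares_23_def
    by (elim insertE emptyE) simp_all
qed

lemma golay_generator_eq: "golay_generator i = insert None {Some x |x. x - i \<in> nonsquares_23}"
proof -
  have "{n + i |n. n \<in> nonsquares_23} = {x. x - i \<in> nonsquares_23}"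
    by (auto intro: exI[of _ "_ - i"])
  then show ?thesis unfolding golay_generator_def nonsquares_23 by auto
qed

lemma golay_generator_iff:
  "None \<in> golay_generator i" "Some x \<in> golay_generator i \<longleftrightarrow> x - i \<in> nonsquares_23"
  by (auto simp: golay_generator_eq)

section \<open>Closure, self-orthogonality and weights modulo 4\<close>

lemma card_sym_diff:
  fixes A B :: "'a::finite set"
  shows "card (sym_diff A B) + 2 * card (A \<inter> B) = card A + card B"
proof -
  have "card A = card (A - B) + card (A \<inter> B)"
    by (metis card_Diff_subset_Int card_mono Int_lower1 finite le_add_diff_inverse2)
  moreover have "card B = card (B - A) + card (A \<inter> B)"
    by (metis card_Diff_subset_Int card_mono Int_lower2 Int_commute finite le_add_diff_inverse2)
  moreover have "card (sym_diff A B) = card (A - B) + card (B - A)"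
    by (intro card_Un_disjoint) auto
  ultimately show ?thesis by simp
qed

lemma even_card_Int_sym_diff:
  fixes A B C :: "'a::finite set"
  assumes "even (card (A \<inter> B))" "even (card (A \<inter> C))"
  shows "even (card (A \<inter> sym_diff B C))"
proof -
  have "A \<inter> sym_diff B C = sym_diff (A \<inter> B) (A \<inter> C)" by auto
  then show ?thesis using card_sym_diff[of "A \<inter> B" "A \<inter> C"] assms
    by (metis even_add even_mult_iff even_numeral)
qed

definition golay_word :: "23 set \<Rightarrow> 23 option set" where
  "golay_word J = {a. odd (card {i\<in>J. a \<in> golay_generator i})}"

lemma golay_code_words: "golay_code = range golay_word"
  by (auto simp: golay_code_def golay_word_def)

lemma golay_word_insert:
  assumes "i \<notin> J"
  shows "golay_word (insert i J) = sym_diff (golay_word J) (golay_generator i)"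
proof -
  have "{j \<in> insert i J. a \<in> golay_generator j} =
    (if a \<in> golay_generator i then insert i {j\<in>J. a \<in> golay_generator j} else {j\<in>J. a \<in> golay_generator j})" for a
    by auto
  then show ?thesis using assms by (auto simp: golay_word_def)
qed

lemma golay_word_empty: "golay_word {} = {}"
  by (simp add: golay_word_def)

lemma golay_code_induct [consumes 1, case_names empty step]:
  assumes "B \<in> golay_code" "P {}"
    "\<And>B i. B \<in> golay_code \<Longrightarrow> P B \<Longrightarrow> P (sym_diff B (golay_generator i))"
  shows "P B"
proof -
  obtain J where J: "B = golay_word J" using assms(1) golay_code_words by auto
  have "finite J" by simp
  then have "P (golay_word J)"
  proof induction
    case empty
    then show ?case using assms(2) by (simp add: golay_word_empty)
  next
    case (insert i J)
    then show ?case using assms(3)[of "golay_word J" i] by (simp add: golay_word_insert golay_code_words)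
  qed
  then show ?thesis using J by simp
qed

lemma golay_code_empty: "{} \<in> golay_code"
  using golay_word_empty golay_code_words by (metis rangeI)

lemma golay_code_sym_diff_generator:
  assumes "B \<in> golay_code"
  shows "sym_diff B (golay_generator i) \<in> golay_code"
proof -
  obtain J where J: "B = golay_word J" using assms golay_code_words by auto
  show ?thesis
  proof (cases "i \<in> J")
    case True
    then have "B = sym_diff (golay_word (J - {i})) (golay_generator i)"
      using golay_word_insert[of i "J - {i}"] J by (simp add: insert_absorb)
    then have "sym_diff B (golay_generator i) = golay_word (J - {i})" by auto
    then show ?thesis by (simp add: golay_code_words)
  next
    case False
    then show ?thesis using golay_word_insert[OF False] J golay_code_words by (metis rangeI)
  qed
qed

lemma golay_code_sym_diff:
  assumes "A \<in> golay_code" "B \<in> golay_code"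
  shows "sym_diff A B \<in> golay_code"
  using assms(2)
proof (induction rule: golay_code_induct)
  case empty
  then show ?case using assms(1) by simp
next
  case (step B i)
  have "sym_diff A (sym_diff B (golay_generator i)) = sym_diff (sym_diff A B) (golay_generator i)" by auto
  then show ?case using golay_code_sym_diff_generator[OF step.IH] by simp
qed

lemma card_golay_generator: "card (golay_generator i) = 12"
proof -
  have "golay_generator i = insert None ((\<lambda>n. Some (n + i)) ` nonsquares_23)"
    unfolding golay_generator_def nonsquares_23 by auto
  moreover have "card ((\<lambda>n. Some (n + i)) ` nonsquares_23) = card nonsquares_23"
    by (intro card_image) (auto simp: inj_on_def)
  moreover have "card nonsquares_23 = 11" by (simp add: nonsquares_23_def)
  ultimately show ?thesis by (auto simp: card_insert_if)
qed

text \<open>The quadratic nonresidues modulo 23 form a difference set with parameters (23, 11, 5),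
  checked here shift by shift.\<close>

lemma card_nonsquares_shift:
  assumes "d \<noteq> 0"
  shows "card (nonsquares_23 \<inter> {x. x - d \<in> nonsquares_23}) = 5"
  using assms mem_23[of d]
  by (elim insertE emptyE) (simp_all add: nonsquares_23_def Int_insert_left)

text \<open>Two different generators share the point at infinity and 5 points from the difference
  set, 6 in all.\<close>

lemma card_golay_generator_Int: "even (card (golay_generator i \<inter> golay_generator j))"
proof (cases "i = j")
  case True
  then show ?thesis by (simp add: card_golay_generator)
next
  case False
  let ?N = "nonsquares_23 \<inter> {x. x - (j - i) \<in> nonsquares_23}"
  have "golay_generator i \<inter> golay_generator j = insert None ((\<lambda>n. Some (n + i)) ` ?N)"
  proof -
    have "\<exists>n. x = n + i \<and> n \<in> nonsquares_23 \<and> n - (j - i) \<in> nonsquares_23"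
      if "x - i \<in> nonsquares_23" "x - j \<in> nonsquares_23" for x
      using that by (intro exI[of _ "x - i"]) simp
    then show ?thesis unfolding golay_generator_eq by (auto simp: algebra_simps)
  qed
  moreover have "card ((\<lambda>n. Some (n + i)) ` ?N) = card ?N"
    by (intro card_image) (auto simp: inj_on_def)
  moreover have "card ?N = 5" using False by (intro card_nonsquares_shift) simp
  ultimately show ?thesis by (auto simp: card_insert_if)
qed

lemma golay_code_orthogonal_generator:
  assumes "B \<in> golay_code"
  shows "even (card (B \<inter> golay_generator i))"
  using assms
proof (induction rule: golay_code_induct)
  case (step B j)
  then show ?case
    using even_card_Int_sym_diff[of "golay_generator i" B "golay_generator j"] card_golay_generator_Int[of i j]
    by (simp add: Int_commute)
qed simp

lemma golay_code_orthogonal: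
  assumes "A \<in> golay_code" "B \<in> golay_code"
  shows "even (card (A \<inter> B))"
  using assms(2)
proof (induction rule: golay_code_induct)
  case (step B i)
  then show ?case
    using even_card_Int_sym_diff[of A B "golay_generator i"] golay_code_orthogonal_generator[OF assms(1)] by blast
qed simp

text \<open>Adding a generator changes the weight by 12 minus twice the size of an intersection,
  which is even.\<close>

lemma golay_code_doubly_even:
  assumes "B \<in> golay_code"
  shows "4 dvd card B"
  using assms
proof (induction rule: golay_code_induct)
  case (step B i)
  obtain k where "card (B \<inter> golay_generator i) = 2 * k"
    using golay_code_orthogonal_generator[OF step(1), of i] by (elim evenE)
  then have "card (sym_diff B (golay_generator i)) + 4 * k = card B + 12"
    using card_sym_diff[of B "golay_generator i"] by (simp add: card_golay_generator)
  then have "4 dvd card (sym_diff B (golay_generator i)) + 4 * k" using step(2) by simp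
  then show ?case by (simp add: dvd_add_left_iff)
qed simp

text \<open>This is the sum of all 23 generators: infinity lies in every one of them and each other
  point in 11.\<close>

lemma golay_code_UNIV: "UNIV \<in> golay_code"
proof -
  have "golay_word UNIV = UNIV"
  proof -
    have "odd (card {i. a \<in> golay_generator i})" for a
    proof (cases a)
      case None
      then show ?thesis by (simp add: golay_generator_iff)
    next
      case (Some x)
      have "{i. Some x \<in> golay_generator i} = (\<lambda>n. x - n) ` nonsquares_23"
        by (auto simp: golay_generator_iff image_iff) (metis diff_diff_eq2 add_diff_cancel_left')
      moreover have "card ((\<lambda>n. x - n) ` nonsquares_23) = card nonsquares_23"
        by (intro card_image) (auto simp: inj_on_def)
      moreover have "card nonsquares_23 = 11" by (simp add: nonsquares_23_def)
      ultimately show ?thesis using Some by simp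
    qed
    then show ?thesis by (auto simp: golay_word_def)
  qed
  then show ?thesis using golay_code_words by (metis rangeI)
qed

lemma golay_code_Compl: "B \<in> golay_code \<Longrightarrow> - B \<in> golay_code"
  using golay_code_sym_diff[OF golay_code_UNIV, of B] by (simp add: Compl_eq_Diff_UNIV)

section \<open>Independence of any four coordinates\<close>

fun pair_sums :: "bool list list \<Rightarrow> bool list list" where
  "pair_sums [] = []"
| "pair_sums (x # xs) = map (map2 (\<noteq>) x) xs @ pair_sums xs"

text \<open>Membership in twelve of the generators already distinguishes all sums of two
  points.\<close>

definition golay_column :: "23 option \<Rightarrow> bool list" where
  "golay_column a = map (\<lambda>i. a \<in> golay_generator i) [0,1,2,3,4,5,6,7,8,9,10,11]"

definition golay_points :: "23 option list" where
  "golay_points = None # map Some [0,1,2,3,4,5,6,7,8,9,10,11,12,13,14,15,16,17,18,19,20,21,22]"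

lemma set_golay_points: "set golay_points = UNIV"
proof -
  have "a \<in> set golay_points" for a
  proof (cases a)
    case (Some x)
    then show ?thesis using mem_23[of x] by (simp add: golay_points_def)
  qed (simp add: golay_points_def)
  then show ?thesis by auto
qed

\<comment> \<open>The schematic side is instantiated with the explicit 24 by 12 matrix, so that
  distinctness of the 276 pair sums is decided on literals.\<close>
schematic_goal golay_columns: "map golay_column golay_points = ?X"
  unfolding golay_column_def golay_points_def
  by (simp add: golay_generator_iff nonsquares_23_def)

lemma distinct_golay_pair_sums: "distinct (pair_sums (map golay_column golay_points))"
  unfolding golay_columns by simp

lemma map2_neq_commute: "map2 (\<noteq>) xs ys = map2 (\<noteq>) ys (xs :: bool list)"
  by (induction xs ys rule: list_induct2') auto

lemma pair_sums_mem:
  assumes "a \<in> set xs" "b \<in> set xs" "a \<noteq> b"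
  shows "map2 (\<noteq>) (f a) (f b) \<in> set (pair_sums (map f xs))"
  using assms
proof (induction xs)
  case (Cons x xs)
  consider "a = x" | "b = x" | "a \<noteq> x" "b \<noteq> x" by blast
  then show ?case
  proof cases
    case 2
    then have "map2 (\<noteq>) (f x) (f a) \<in> set (pair_sums (map f (x # xs)))" using Cons.prems by auto
    then show ?thesis using 2 map2_neq_commute[of "f a" "f b"] by simp
  qed (use Cons in auto)
qed simp

lemma pair_sums_inj:
  assumes "distinct (pair_sums (map f xs))" "{a, b, c, d} \<subseteq> set xs" "a \<noteq> b" "c \<noteq> d"
    "map2 (\<noteq>) (f a) (f b) = map2 (\<noteq>) (f c) (f d)"
  shows "{a, b} = {c, d}"
  using assms
proof (induction xs arbitrary: a b c d)
  case (Cons x xs)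
  let ?s = "\<lambda>a b. map2 (\<noteq>) (f a) (f b)"
  have dist: "distinct (map (?s x) xs)" "distinct (pair_sums (map f xs))"
    "set (map (?s x) xs) \<inter> set (pair_sums (map f xs)) = {}"
    using Cons.prems(1) by (simp_all add: comp_def)
  have sep: "?s x b \<noteq> ?s c d" if "b \<in> set xs" "c \<in> set xs" "d \<in> set xs" "c \<noteq> d" for b c d
    using dist(3) that pair_sums_mem[of c xs d f] by auto
  have inj: "b = d" if "b \<in> set xs" "d \<in> set xs" "?s x b = ?s x d" for b d
    using dist(1) that by (simp add: distinct_map inj_on_def)
  have com: "?s a b = ?s b a" for a b by (rule map2_neq_commute)
  consider "a = x" "c = x" | "a = x" "d = x" | "b = x" "c = x" | "b = x" "d = x"
    | "a = x" "c \<noteq> x" "d \<noteq> x" | "b = x" "c \<noteq> x" "d \<noteq> x"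
    | "c = x" "a \<noteq> x" "b \<noteq> x" | "d = x" "a \<noteq> x" "b \<noteq> x"
    | "a \<noteq> x" "b \<noteq> x" "c \<noteq> x" "d \<noteq> x" by blast
  then show ?case
  proof cases
    case 1
    then show ?thesis using inj[of b d] Cons.prems by auto
  next
    case 2
    then show ?thesis using inj[of b c] com[of c d] Cons.prems by auto
  next
    case 3
    then show ?thesis using inj[of a d] com[of a b] Cons.prems by auto
  next
    case 4
    then show ?thesis using inj[of a c] com[of a b] com[of c d] Cons.prems by auto
  next
    case 5
    then show ?thesis using sep[of b c d] Cons.prems by auto
  next
    case 6
    then show ?thesis using sep[of a c d] com[of a b] Cons.prems by auto
  next
    case 7
    then show ?thesis using sep[of d a b] Cons.prems by auto
  next
    case 8
    then show ?thesis using sep[of c a b] com[of c d] Cons.prems by auto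
  next
    case 9
    then show ?thesis using Cons.IH[OF dist(2), of a b c d] Cons.prems by auto
  qed
qed simp

text \<open>Any four points are independent: the dual code has minimum distance at least 5.\<close>
lemma golay_generator_pair_separation:
  assumes "\<And>i. (a \<in> golay_generator i) \<noteq> (b \<in> golay_generator i) \<longleftrightarrow>
      (c \<in> golay_generator i) \<noteq> (d \<in> golay_generator i)"
  shows "a = b \<and> c = d \<or> a = c \<and> b = d \<or> a = d \<and> b = c"
proof -
  let ?s = "\<lambda>a b. map2 (\<noteq>) (golay_column a) (golay_column b)"
  have inj: "{a, b} = {c, d}" if "a \<noteq> b" "c \<noteq> d" "?s a b = ?s c d" for a b c d
    using pair_sums_inj[OF distinct_golay_pair_sums _ that] by (simp add: set_golay_points)
  \<comment> \<open>If two columns were equal, a third point \<open>e\<close> would give different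
    pairs with the same sum.\<close>
  have inj1: "a = b" if "golay_column a = golay_column b" for a b
  proof (rule ccontr)
    assume ne: "a \<noteq> b"
    have "card {a, b} < CARD(23 option)" using card_insert_le_m1[of 2 "{b}" a] by simp
    then obtain e where "e \<notin> {a, b}" by (metis UNIV_eq_I less_irrefl)
    then show False using inj[of a e b e] that ne by (auto simp: doubleton_eq_iff)
  qed
  show ?thesis
  proof (cases "a = b \<or> c = d")
    case True
    then show ?thesis using assms inj1[of a b] inj1[of c d] by (auto simp: golay_column_def)
  next
    case False
    moreover have "?s a b = ?s c d" using assms by (simp add: golay_column_def)
    ultimately show ?thesis using inj[of a b c d] by (auto simp: doubleton_eq_iff)
  qed
qed

text \<open>By self-orthogonality every generator meets the word evenly, so the columns of its four
  points would sum to zero.\<close>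

lemma golay_code_card_ne_4:
  assumes "B \<in> golay_code"
  shows "card B \<noteq> 4"
proof
  assume "card B = 4"
  then obtain a b c d where B: "B = {a, b, c, d}" "distinct [a, b, c, d]"
    by (auto simp: card_Suc_eq numeral_eq_Suc)
  have "(a \<in> golay_generator i) \<noteq> (b \<in> golay_generator i) \<longleftrightarrow>
      (c \<in> golay_generator i) \<noteq> (d \<in> golay_generator i)" for i
  proof -
    have "card (B \<inter> golay_generator i) = (\<Sum>x\<in>B. if x \<in> golay_generator i then 1 else 0)"
      by (simp add: sum.If_cases)
    also have "\<dots> = of_bool (a \<in> golay_generator i) + of_bool (b \<in> golay_generator i)
        + of_bool (c \<in> golay_generator i) + of_bool (d \<in> golay_generator i)"
      using B by simp
    finally show ?thesis using golay_code_orthogonal_generator[OF assms, of i] by (auto split: if_splits)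
  qed
  then show False using golay_generator_pair_separation[of a b c d] B(2) by auto
qed

lemma card_Compl_24: "card (- B) = 24 - card (B :: 23 option set)"
  by (simp add: Compl_eq_Diff_UNIV card_Diff_subset)

text \<open>Among the multiples of 4, weight 4 is excluded directly and weight 20 by passing to the
  complement.\<close>

lemma golay_code_weights:
  assumes "B \<in> golay_code"
  shows "B = {} \<or> B = UNIV \<or> card B = 8 \<or> card B = 12 \<or> card B = 16"
proof -
  have c24: "card B \<le> 24" using card_mono[of UNIV B] by simp
  obtain k where k: "card B = 4 * k" using golay_code_doubly_even[OF assms] by blast
  have ne: "card B \<noteq> 4" using golay_code_card_ne_4[OF assms] .
  have comp: "card (- B) = 24 - card B" by (simp add: card_Compl_24)
  have ne': "card B \<noteq> 20" using golay_code_card_ne_4[OF golay_code_Compl[OF assms]] comp by auto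
  have "k = 0 \<or> k = 1 \<or> k = 2 \<or> k = 3 \<or> k = 4 \<or> k = 5 \<or> k = 6" using c24 k by auto
  moreover have "B = UNIV" if "card B = 24" using that card_subset_eq[of UNIV B] by simp
  ultimately show ?thesis using k ne ne' by auto
qed

text \<open>The coordinate characters of the group of sets under symmetric difference.\<close>

definition sign_char :: "'a \<Rightarrow> 'a set \<Rightarrow> int" where
  "sign_char a B = (if a \<in> B then -1 else 1)"

lemma sum_sign_char:
  fixes B :: "23 option set"
  shows "(\<Sum>a\<in>UNIV. sign_char a B) = 24 - 2 * int (card B)"
proof -
  have "(\<Sum>a\<in>UNIV. sign_char a B) = - int (card B) + int (card (- B))"
    unfolding sign_char_def by (simp add: sum.If_cases)
  then show ?thesis using card_mono[of UNIV B] by (simp add: card_Compl_24)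
qed

lemma sign_char_sym_diff: "sign_char a (sym_diff A B) = sign_char a A * sign_char a B"
  by (auto simp: sign_char_def)

text \<open>Orthogonality of characters: unless the four points cancel in pairs, some generator
  takes the value -1 on their product, and translating the code by it negates the sum.\<close>

lemma golay_char_sum:
  "(\<Sum>B\<in>golay_code. sign_char a B * sign_char b B * sign_char c B * sign_char d B) =
    (if a = b \<and> c = d \<or> a = c \<and> b = d \<or> a = d \<and> b = c then int (card golay_code) else 0)"
proof (cases "a = b \<and> c = d \<or> a = c \<and> b = d \<or> a = d \<and> b = c")
  case True
  have "sign_char x B * sign_char x B = 1" for x B by (simp add: sign_char_def)
  then have "sign_char a B * sign_char b B * sign_char c B * sign_char d B = 1" for B
    using True by (auto simp: sign_char_def)
  then show ?thesis using True by simp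
next
  case False
  let ?p = "\<lambda>B. sign_char a B * sign_char b B * sign_char c B * sign_char d B"
  obtain i where "\<not> ((a \<in> golay_generator i) \<noteq> (b \<in> golay_generator i) \<longleftrightarrow>
      (c \<in> golay_generator i) \<noteq> (d \<in> golay_generator i))"
    using golay_generator_pair_separation[of a b c d] False by blast
  then have G: "?p (golay_generator i) = - 1" by (auto simp: sign_char_def)
  let ?f = "\<lambda>B. sym_diff B (golay_generator i)"
  have "sum ?p golay_code = (\<Sum>B\<in>golay_code. ?p (?f B))"
    by (rule sum.reindex_bij_witness[of _ ?f ?f])
       (simp_all add: golay_code_sym_diff_generator, auto intro!: arg_cong[where f = ?p])
  also have "\<dots> = (\<Sum>B\<in>golay_code. ?p B * ?p (golay_generator i))"
    by (simp only: sign_char_sym_diff mult_ac)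
  also have "\<dots> = - sum ?p golay_code" unfolding G by (simp add: sum_negf)
  finally show ?thesis using False by auto
qed

text \<open>\<open>24 - 2 * card B\<close> is the sum of all coordinate characters at
  \<open>B\<close>. Two factors at \<open>None\<close>, whose product is 1, pad the double sum to
  fit the four-point relation.\<close>

lemma golay_moment_2:
  "(\<Sum>B\<in>golay_code. (24 - 2 * int (card B))\<^sup>2) = 24 * int (card golay_code)"
proof -
  have n: "sign_char None B * sign_char None B = 1" for B by (simp add: sign_char_def)
  have "(\<Sum>B\<in>golay_code. (24 - 2 * int (card B))\<^sup>2)
      = (\<Sum>B\<in>golay_code. \<Sum>a\<in>UNIV. \<Sum>b\<in>UNIV. sign_char a B * sign_char b B * sign_char None B * sign_char None B)"
    by (simp add: sum_sign_char[symmetric] power2_eq_square sum_product mult.assoc n)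
  also have "\<dots> = (\<Sum>a\<in>UNIV. \<Sum>b\<in>UNIV. \<Sum>B\<in>golay_code. sign_char a B * sign_char b B * sign_char None B * sign_char None B)"
    by (subst sum.swap, rule sum.cong[OF refl], rule sum.swap)
  also have "\<dots> = (\<Sum>a\<in>(UNIV :: 23 option set). \<Sum>b\<in>UNIV. if a = b then int (card golay_code) else 0)"
    unfolding golay_char_sum by (intro sum.cong refl) auto
  finally show ?thesis by simp
qed

text \<open>1680 is the number of quadruples of points that cancel in pairs:
  \<open>24 * (24 + 23 * 2)\<close>.\<close>

lemma golay_moment_4:
  "(\<Sum>B\<in>golay_code. (24 - 2 * int (card B)) ^ 4) = 1680 * int (card golay_code)"
proof -
  let ?K = "int (card golay_code)"
  have sq: "(24 - 2 * int (card B))\<^sup>2 = (\<Sum>a\<in>UNIV. \<Sum>b\<in>UNIV. sign_char a B * sign_char b B)" for B :: "23 option set"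
    by (simp add: sum_sign_char[symmetric] power2_eq_square sum_product)
  have "(24 - 2 * int (card B)) ^ 4 = (\<Sum>a\<in>UNIV. \<Sum>b\<in>UNIV. \<Sum>c\<in>UNIV. \<Sum>d\<in>UNIV.
      sign_char a B * sign_char b B * sign_char c B * sign_char d B)" for B :: "23 option set"
  proof -
    have "(24 - 2 * int (card B)) ^ 4 = ((24 - 2 * int (card B))\<^sup>2) * ((24 - 2 * int (card B))\<^sup>2)"
      by (simp add: power2_eq_square power4_eq_xxxx)
    also have "\<dots> = (\<Sum>a\<in>UNIV. \<Sum>b\<in>UNIV. \<Sum>c\<in>UNIV. \<Sum>d\<in>UNIV.
        sign_char a B * sign_char b B * sign_char c B * sign_char d B)"
      unfolding sq sum_distrib_right unfolding sum_distrib_left by (simp only: mult.assoc)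
    finally show ?thesis .
  qed
  then have "(\<Sum>B\<in>golay_code. (24 - 2 * int (card B)) ^ 4) = (\<Sum>B\<in>golay_code.
      \<Sum>a\<in>UNIV. \<Sum>b\<in>UNIV. \<Sum>c\<in>UNIV. \<Sum>d\<in>UNIV. sign_char a B * sign_char b B * sign_char c B * sign_char d B)"
    by simp
  also have "\<dots> = (\<Sum>a\<in>UNIV. \<Sum>b\<in>UNIV. \<Sum>c\<in>UNIV. \<Sum>d\<in>UNIV. \<Sum>B\<in>golay_code.
      sign_char a B * sign_char b B * sign_char c B * sign_char d B)"
    by (subst sum.swap, rule sum.cong[OF refl], subst sum.swap, rule sum.cong[OF refl], subst sum.swap,
        rule sum.cong[OF refl], rule sum.swap)
  also have "\<dots> = (\<Sum>a\<in>(UNIV :: 23 option set). \<Sum>b\<in>UNIV. if a = b then 24 * ?K else 2 * ?K)"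
    unfolding golay_char_sum
  proof (intro sum.cong refl)
    fix a b :: "23 option"
    show "(\<Sum>c\<in>UNIV. \<Sum>d\<in>UNIV. if a = b \<and> c = d \<or> a = c \<and> b = d \<or> a = d \<and> b = c then ?K else 0)
        = (if a = b then 24 * ?K else 2 * ?K)"
    proof (cases "a = b")
      case True
      then have "(\<Sum>c\<in>UNIV. \<Sum>d\<in>UNIV. if a = b \<and> c = d \<or> a = c \<and> b = d \<or> a = d \<and> b = c then ?K else 0)
        = (\<Sum>c\<in>(UNIV :: 23 option set). \<Sum>d\<in>UNIV. if c = d then ?K else 0)"
        by (intro sum.cong refl) auto
      then show ?thesis using True by simp
    next
      case False
      then have "(\<Sum>c\<in>UNIV. \<Sum>d\<in>UNIV. if a = b \<and> c = d \<or> a = c \<and> b = d \<or> a = d \<and> b = c then ?K else 0)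
        = (\<Sum>c\<in>UNIV. \<Sum>d\<in>UNIV. (if c = a then if d = b then ?K else 0 else 0) + (if c = b then if d = a then ?K else 0 else 0))"
        by (intro sum.cong refl) auto
      also have "\<dots> = (\<Sum>c\<in>UNIV. (if c = a then ?K else 0) + (if c = b then ?K else 0))"
        by (intro sum.cong refl) (auto simp: sum.distrib)
      finally show ?thesis using False by (simp add: sum.distrib)
    qed
  qed
  also have "\<dots> = (\<Sum>a\<in>(UNIV :: 23 option set). 70 * ?K)"
  proof (intro sum.cong refl)
    fix a :: "23 option"
    have "(\<Sum>b\<in>UNIV. if a = b then 24 * ?K else 2 * ?K) = (\<Sum>b\<in>UNIV. 2 * ?K + (if a = b then 22 * ?K else 0))"
      by (intro sum.cong refl) auto
    then show "(\<Sum>b\<in>UNIV. if a = b then 24 * ?K else 2 * ?K) = 70 * ?K" by (simp add: sum.distrib)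
  qed
  finally show ?thesis by simp
qed

text \<open>Weight 12 contributes 0 to both moments, and complementation equates the numbers of
  words of weight 8 and 16, which leaves two linear equations in two unknowns.\<close>

theorem golay_card: "card golay_code = 4096" "card {B \<in> golay_code. card B = 8} = 759"
proof -
  let ?n = "\<lambda>k. int (card {B \<in> golay_code. card B = k})"
  let ?x = "\<lambda>B :: 23 option set. 24 - 2 * int (card B)"
  have fin: "finite golay_code" by simp
  have UNIV: "card (UNIV :: 23 option set) = 24" by simp
  have eq: "?x B ^ j = 24 ^ j * of_bool (B = {}) + (- 24) ^ j * of_bool (B = UNIV)
      + 8 ^ j * of_bool (card B = 8) + (- 8) ^ j * of_bool (card B = 16)" if "B \<in> golay_code" "j > 0" for B j
    using golay_code_weights[OF that(1)] that(2) by (auto simp: UNIV)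
  have ind: "(\<Sum>B\<in>golay_code. r * of_bool (P B)) = r * int (card {B\<in>golay_code. P B})" for r P
    by (simp add: sum_distrib_left[symmetric] of_bool_def sum.If_cases Int_def conj_commute)
  have c1: "{B\<in>golay_code. B = {}} = {{}}" "{B\<in>golay_code. B = UNIV} = {UNIV}"
    using golay_code_empty golay_code_UNIV by auto
  have m: "(\<Sum>B\<in>golay_code. ?x B ^ j) = 24 ^ j + (- 24) ^ j + 8 ^ j * ?n 8 + (- 8) ^ j * ?n 16" if "j > 0" for j
    using that by (simp add: eq sum.distrib ind c1)
  have comp: "?n 16 = ?n 8"
  proof -
    have "bij_betw uminus {B \<in> golay_code. card B = 8} {B \<in> golay_code. card B = 16}"
      by (rule bij_betw_byWitness[where f' = uminus]) (auto simp: golay_code_Compl card_Compl_24)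
    then show ?thesis by (simp add: bij_betw_same_card)
  qed
  have "1152 + 128 * ?n 8 = 24 * int (card golay_code)"
    using m[of 2] golay_moment_2 comp by simp
  moreover have "663552 + 8192 * ?n 8 = 1680 * int (card golay_code)"
    using m[of 4] golay_moment_4 comp by simp
  ultimately show "card golay_code = 4096" "card {B \<in> golay_code. card B = 8} = 759" by linarith+
qed

section \<open>Minimal vectors of the Leech lattice\<close>

abbreviation ind :: "'a set \<Rightarrow> 'a \<Rightarrow> int" where
  "ind B a \<equiv> of_bool (a \<in> B)"

definition leech_int :: "(23 option \<Rightarrow> int) set" where
  "leech_int = {z. \<exists>m. (\<forall>a. z a mod 2 = m mod 2) \<and> (\<Sum>a\<in>UNIV. z a) mod 8 = 4 * m mod 8 \<and>
     (\<forall>k\<in>{0..<4}. {a. z a mod 4 = k} \<in> golay_code)}"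

lemma sum_bit: "(\<Sum>a\<in>UNIV. ind B a) = int (card (B :: 'a::finite set))"
  by (simp add: of_bool_def sum.If_cases)

lemma sum_leech_rep:
  fixes w :: "23 option \<Rightarrow> int"
  shows "(\<Sum>a\<in>UNIV. m + 2 * ind B a + 4 * w a) = 24 * m + 2 * int (card B) + 4 * (\<Sum>a\<in>UNIV. w a)"
  by (simp add: sum.distrib sum_distrib_left[symmetric] sum_bit)

lemma golay_code_card_4: "B \<in> golay_code \<Longrightarrow> \<exists>b. int (card B) = 4 * b"
  using golay_code_doubly_even by (metis dvdE of_nat_dvd_iff of_nat_numeral)

lemma leech_int_iff:
  "z \<in> leech_int \<longleftrightarrow> (\<exists>m B w. B \<in> golay_code \<and> z = (\<lambda>a. m + 2 * ind B a + 4 * w a)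
      \<and> even ((\<Sum>a\<in>UNIV. w a) - m))"
proof
  assume "z \<in> leech_int"
  then obtain n where n: "\<And>a. z a mod 2 = n mod 2" "(\<Sum>a\<in>UNIV. z a) mod 8 = 4 * n mod 8"
    "\<And>k. k \<in> {0..<4} \<Longrightarrow> {a. z a mod 4 = k} \<in> golay_code" unfolding leech_int_def by blast
  define m where "m = n mod 2"
  define B where "B = {a. z a mod 4 = m + 2}"
  define w where "w a = (z a - m - 2 * ind B a) div 4" for a
  have m: "m = 0 \<or> m = 1" unfolding m_def by auto
  have B: "B \<in> golay_code" unfolding B_def using m by (intro n(3)) auto
  have z: "z a = m + 2 * ind B a + 4 * w a" for a
  proof -
    have "z a mod 2 = m" using n(1) m_def by simp
    then have "z a mod 4 = m \<or> z a mod 4 = m + 2" using m by presburger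
    then have "4 dvd z a - m - 2 * ind B a" using m unfolding B_def by auto presburger+
    then show ?thesis by (simp add: w_def)
  qed
  obtain b where b: "int (card B) = 4 * b" using golay_code_card_4[OF B] by blast
  have "(24 * m + 8 * b + 4 * (\<Sum>a\<in>UNIV. w a)) mod 8 = 4 * n mod 8"
    using n(2) sum_leech_rep[of m B w] z b by simp
  then have "8 dvd 24 * m + 8 * b + 4 * (\<Sum>a\<in>UNIV. w a) - 4 * n" by (simp add: mod_eq_dvd_iff)
  then obtain k where k: "24 * m + 8 * b + 4 * (\<Sum>a\<in>UNIV. w a) - 4 * n = 8 * k" by (elim dvdE)
  have "n = m + 2 * (n div 2)" unfolding m_def by simp
  then obtain q where "n = m + 2 * q" by blast
  then have "(\<Sum>a\<in>UNIV. w a) - m = 2 * (k - 3 * m - b + q)" using k by simp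
  then have "even ((\<Sum>a\<in>UNIV. w a) - m)" by (rule dvdI)
  then show "\<exists>m B w. B \<in> golay_code \<and> z = (\<lambda>a. m + 2 * ind B a + 4 * w a) \<and> even ((\<Sum>a\<in>UNIV. w a) - m)"
    using B z by blast
next
  assume "\<exists>m B w. B \<in> golay_code \<and> z = (\<lambda>a. m + 2 * ind B a + 4 * w a) \<and> even ((\<Sum>a\<in>UNIV. w a) - m)"
  then obtain m B w where B: "B \<in> golay_code" and z: "z = (\<lambda>a. m + 2 * ind B a + 4 * w a)"
    and w: "even ((\<Sum>a\<in>UNIV. w a) - m)" by blast
  have "z a mod 2 = m mod 2" for a unfolding z by presburger
  moreover have "(\<Sum>a\<in>UNIV. z a) mod 8 = 4 * m mod 8"
  proof -
    obtain b where b: "int (card B) = 4 * b" using golay_code_card_4[OF B] by blast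
    show ?thesis unfolding z sum_leech_rep b using w by presburger
  qed
  moreover have "{a. z a mod 4 = k} \<in> golay_code" if "k \<in> {0..<4}" for k
  proof -
    have in_B: "z a mod 4 = (m + 2) mod 4" if "a \<in> B" for a using that by (simp add: z; presburger)
    have nin_B: "z a mod 4 = m mod 4" if "a \<notin> B" for a using that by (simp add: z; presburger)
    have ne: "(m + 2) mod 4 \<noteq> m mod 4" by presburger
    \<comment> \<open>Modulo 4 a coordinate is \<open>m + 2\<close> on \<open>B\<close> and
      \<open>m\<close> off \<open>B\<close>, so the set in question is \<open>B\<close>, its
      complement, or empty.\<close>
    consider "k = m mod 4" | "k = (m + 2) mod 4" | "k \<noteq> m mod 4" "k \<noteq> (m + 2) mod 4" by blast
    then show ?thesis
    proof cases
      case 1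
      then have "{a. z a mod 4 = k} = - B" using in_B nin_B ne by auto
      then show ?thesis using golay_code_Compl[OF B] by simp
    next
      case 2
      have "z a mod 4 = k \<longleftrightarrow> a \<in> B" for a using in_B[of a] nin_B[of a] ne 2 by (cases "a \<in> B") auto
      then have "{a. z a mod 4 = k} = B" by simp
      then show ?thesis using B by simp
    next
      case 3
      have "z a mod 4 \<noteq> k" for a using in_B[of a] nin_B[of a] 3 by (cases "a \<in> B") auto
      then have "{a. z a mod 4 = k} = {}" by simp
      then show ?thesis using golay_code_empty by simp
    qed
  qed
  ultimately show "z \<in> leech_int" unfolding leech_int_def by blast
qed

lemma leech_intI:
  assumes "B \<in> golay_code" "z = (\<lambda>a. m + 2 * ind B a + 4 * w a)" "even ((\<Sum>a\<in>UNIV. w a) - m)"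
  shows "z \<in> leech_int"
  unfolding leech_int_iff using assms by blast

lemma leech_int_diff:
  assumes "z \<in> leech_int" "z' \<in> leech_int"
  shows "(\<lambda>a. z a - z' a) \<in> leech_int"
proof -
  obtain m B w where z: "B \<in> golay_code" "z = (\<lambda>a. m + 2 * ind B a + 4 * w a)" "even ((\<Sum>a\<in>UNIV. w a) - m)"
    using assms(1) leech_int_iff by blast
  obtain m' B' w' where z': "B' \<in> golay_code" "z' = (\<lambda>a. m' + 2 * ind B' a + 4 * w' a)" "even ((\<Sum>a\<in>UNIV. w' a) - m')"
    using assms(2) leech_int_iff by blast
  \<comment> \<open>\<open>ind B - ind B'\<close> is the indicator of the symmetric difference minus
    twice that of \<open>B' - B\<close>. The correction keeps the parity because
    \<open>card B'\<close> and \<open>card (B \<inter> B')\<close> are even.\<close>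
  let ?w = "\<lambda>a. w a - w' a - ind (B' - B) a"
  have "(\<lambda>a. z a - z' a) = (\<lambda>a. (m - m') + 2 * ind (sym_diff B B') a + 4 * ?w a)"
    unfolding z z' by (auto simp: fun_eq_iff)
  moreover have "even ((\<Sum>a\<in>UNIV. ?w a) - (m - m'))"
  proof -
    have "card (B' - B) + card (B \<inter> B') = card B'"
      by (metis Int_commute card_Diff_subset_Int card_mono Int_lower1 finite le_add_diff_inverse2)
    moreover have "even (card B')" using golay_code_doubly_even[OF z'(1)] by (meson dvd_trans even_numeral)
    ultimately have "even (card (B' - B))" using golay_code_orthogonal[OF z(1) z'(1)] by (metis even_add)
    then have "even (int (card (B' - B)))" by simp
    moreover have "(\<Sum>a\<in>UNIV. ?w a) = (\<Sum>a\<in>UNIV. w a) - (\<Sum>a\<in>UNIV. w' a) - int (card (B' - B))"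
      by (simp only: sum_subtractf sum_bit)
    ultimately show ?thesis using z(3) z'(3) by presburger
  qed
  ultimately show ?thesis
    by (rule leech_intI[OF golay_code_sym_diff[OF z(1) z'(1)]])
qed

lemma leech_int_zero: "(\<lambda>a. 0) \<in> leech_int"
  unfolding leech_int_iff
  by (intro exI[of _ 0] exI[of _ "{}"] exI[of _ "\<lambda>a. 0"]) (simp add: golay_code_empty)

lemma leech_int_minus: "z \<in> leech_int \<Longrightarrow> (\<lambda>a. - z a) \<in> leech_int"
  using leech_int_diff[OF leech_int_zero] by simp

text \<open>Integrality of the rescaled lattice. The missing factors of 2 come from weights
  divisible by 4, even intersections, and the parity condition on the sum of
  \<open>w\<close>.\<close>

lemma leech_int_inner:
  assumes "z \<in> leech_int" "z' \<in> leech_int"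
  shows "8 dvd (\<Sum>a\<in>UNIV. z a * z' a)"
proof -
  obtain m B w where z: "B \<in> golay_code" "z = (\<lambda>a. m + 2 * ind B a + 4 * w a)" "even ((\<Sum>a\<in>UNIV. w a) - m)"
    using assms(1) leech_int_iff by blast
  obtain m' B' w' where z': "B' \<in> golay_code" "z' = (\<lambda>a. m' + 2 * ind B' a + 4 * w' a)" "even ((\<Sum>a\<in>UNIV. w' a) - m')"
    using assms(2) leech_int_iff by blast
  let ?X = "\<Sum>a\<in>UNIV. ind B a * w' a + ind B' a * w a + 2 * w a * w' a"
  have "z a * z' a = m * m' + 2 * m * ind B' a + 2 * m' * ind B a + 4 * ind (B \<inter> B') a
      + 4 * m * w' a + 4 * m' * w a + 8 * (ind B a * w' a + ind B' a * w a + 2 * w a * w' a)" for a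
    unfolding z z' by (cases "a \<in> B"; cases "a \<in> B'"; simp add: algebra_simps)
  then have "(\<Sum>a\<in>UNIV. z a * z' a) = 24 * (m * m') + 2 * m * int (card B') + 2 * m' * int (card B)
      + 4 * int (card (B \<inter> B')) + 4 * m * (\<Sum>a\<in>UNIV. w' a) + 4 * m' * (\<Sum>a\<in>UNIV. w a) + 8 * ?X"
    by (simp only: sum.distrib sum_distrib_left[symmetric] sum_bit) simp
  moreover obtain b where "int (card B) = 4 * b" using golay_code_card_4[OF z(1)] by blast
  moreover obtain b' where "int (card B') = 4 * b'" using golay_code_card_4[OF z'(1)] by blast
  moreover obtain c where "int (card (B \<inter> B')) = 2 * c"
    using golay_code_orthogonal[OF z(1) z'(1)] by (metis dvdE of_nat_dvd_iff of_nat_numeral)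
  moreover obtain s where "(\<Sum>a\<in>UNIV. w a) = m + 2 * s"
    using z(3) by (metis dvdE diff_eq_eq add.commute)
  moreover obtain s' where "(\<Sum>a\<in>UNIV. w' a) = m' + 2 * s'"
    using z'(3) by (metis dvdE diff_eq_eq add.commute)
  ultimately have "(\<Sum>a\<in>UNIV. z a * z' a) = 8 * (4 * (m * m') + m * b' + m' * b + c + m * s' + m' * s + ?X)"
    by (simp add: algebra_simps)
  then show ?thesis by (rule dvdI)
qed

text \<open>Evenness of the rescaled lattice: divided by 8, the squared norms are even
  integers.\<close>

lemma leech_int_norm:
  assumes "z \<in> leech_int"
  shows "16 dvd (\<Sum>a\<in>UNIV. (z a)\<^sup>2)"
proof -
  obtain m B w where z: "B \<in> golay_code" "z = (\<lambda>a. m + 2 * ind B a + 4 * w a)" "even ((\<Sum>a\<in>UNIV. w a) - m)"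
    using assms(1) leech_int_iff by blast
  let ?X = "\<Sum>a\<in>UNIV. ind B a * w a + w a * w a"
  have "(z a)\<^sup>2 = m * m + 4 * m * ind B a + 4 * ind B a + 8 * m * w a + 16 * (ind B a * w a + w a * w a)" for a
    unfolding z by (simp add: algebra_simps power2_eq_square)
  then have "(\<Sum>a\<in>UNIV. (z a)\<^sup>2) = 24 * (m * m) + 4 * m * int (card B) + 4 * int (card B)
      + 8 * m * (\<Sum>a\<in>UNIV. w a) + 16 * ?X"
    by (simp only: sum.distrib sum_distrib_left[symmetric] sum_bit) simp
  moreover obtain b where "int (card B) = 4 * b" using golay_code_card_4[OF z(1)] by blast
  moreover obtain s where "(\<Sum>a\<in>UNIV. w a) = m + 2 * s"
    using z(3) by (metis dvdE diff_eq_eq add.commute)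
  ultimately have "(\<Sum>a\<in>UNIV. (z a)\<^sup>2) = 16 * (2 * (m * m) + m * b + b + m * s + ?X)"
    by (simp add: algebra_simps)
  then show ?thesis by (rule dvdI)
qed

text \<open>Only the value 16 has to be excluded. Odd coordinates give at least 24. Otherwise half
  the vector has squared norm 4, so its odd entries form a codeword of weight at most 4, which is
  empty. What remains is one entry 4 or -4, against the sum condition modulo 8.\<close>

lemma leech_int_min_norm:
  assumes z: "z \<in> leech_int" and nz: "z a0 \<noteq> 0"
  shows "(\<Sum>a\<in>UNIV. (z a)\<^sup>2) \<ge> 32"
proof (rule ccontr)
  assume small: "\<not> ?thesis"
  have "(\<Sum>a\<in>UNIV. (z a)\<^sup>2) > 0" using nz by (intro sum_pos2[of _ a0]) auto
  then have n16: "(\<Sum>a\<in>UNIV. (z a)\<^sup>2) = 16" using leech_int_norm[OF z] small by presburger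
  obtain n where n: "\<And>a. z a mod 2 = n mod 2" "(\<Sum>a\<in>UNIV. z a) mod 8 = 4 * n mod 8"
    "\<And>k. k \<in> {0..<4} \<Longrightarrow> {a. z a mod 4 = k} \<in> golay_code" using z unfolding leech_int_def by blast
  have "even n"
  proof (rule ccontr)
    assume "odd n"
    then have "z a \<noteq> 0" for a using n(1)[of a] by (metis mod_0 parity_cases zero_neq_one odd_iff_mod_2_eq_one)
    then have "(z a)\<^sup>2 \<ge> 1" for a by (metis int_one_le_iff_zero_less zero_less_power2)
    then have "(\<Sum>a\<in>(UNIV :: 23 option set). 1) \<le> (\<Sum>a\<in>UNIV. (z a)\<^sup>2)" by (intro sum_mono)
    then show False using n16 by simp
  qed
  define y where "y a = z a div 2" for a
  have zy: "z a = 2 * y a" for a using n(1)[of a] \<open>even n\<close> unfolding y_def by presburger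
  have y4: "(\<Sum>a\<in>UNIV. (y a)\<^sup>2) = 4"
    using n16 by (simp add: zy power_mult_distrib sum_distrib_left[symmetric])
  define Q where "Q = {a. z a mod 4 = 2}"
  have Q: "Q \<in> golay_code" unfolding Q_def by (intro n(3)) simp
  have Qy: "odd (y a) \<longleftrightarrow> a \<in> Q" for a unfolding Q_def mem_Collect_eq zy by presburger
  have "ind Q a \<le> (y a)\<^sup>2" for a
  proof (cases "a \<in> Q")
    case True
    then have "y a \<noteq> 0" using Qy[of a] by auto
    then show ?thesis using True by (simp add: int_one_le_iff_zero_less)
  qed simp
  then have "int (card Q) \<le> 4" unfolding y4[symmetric] sum_bit[symmetric] by (intro sum_mono)
  then have "Q = {}" using golay_code_weights[OF Q] by auto
  then have even_y: "even (y a)" for a using Qy by auto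
  define u where "u a = y a div 2" for a
  have yu: "y a = 2 * u a" for a using even_y[of a] unfolding u_def by simp
  have u1: "(\<Sum>a\<in>UNIV. (u a)\<^sup>2) = 1"
    using y4 by (simp add: yu power_mult_distrib sum_distrib_left[symmetric])
  have "even ((\<Sum>a\<in>UNIV. (u a)\<^sup>2) - (\<Sum>a\<in>UNIV. u a))"
    unfolding sum_subtractf[symmetric] by (intro dvd_sum) (simp add: power2_eq_square)
  then have "odd (\<Sum>a\<in>UNIV. u a)" using u1 by presburger
  moreover have "(\<Sum>a\<in>UNIV. z a) = 4 * (\<Sum>a\<in>UNIV. u a)" by (simp add: zy yu sum_distrib_left)
  ultimately show False using n(2) \<open>even n\<close> by presburger
qed

definition leech_min :: "(23 option \<Rightarrow> int) set" where
  "leech_min = {z\<in>leech_int. (\<Sum>a\<in>UNIV. (z a)\<^sup>2) = 32}"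

lemma finite_leech_min: "finite leech_min"
proof (rule finite_subset)
  show "leech_min \<subseteq> PiE UNIV (\<lambda>_. {-32..32})"
  proof
    fix z assume "z \<in> leech_min"
    then have n: "(\<Sum>a\<in>UNIV. (z a)\<^sup>2) = 32" by (simp add: leech_min_def)
    have "\<bar>z a\<bar> \<le> 32" for a
    proof -
      have "(z a)\<^sup>2 \<le> 32" using member_le_sum[of a UNIV "\<lambda>a. (z a)\<^sup>2"] n by simp
      then have "\<bar>z a\<bar>\<^sup>2 \<le> 32\<^sup>2" by simp
      then show ?thesis by (rule power2_le_imp_le) simp
    qed
    then show "z \<in> PiE UNIV (\<lambda>_. {-32..32})" by (auto simp: abs_le_iff minus_le_iff)
  qed
qed (intro finite_PiE; simp)

text \<open>The sum and the difference of the two vectors are nonzero elements of the lattice, so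
  \<open>64 + 2 * s\<close> and \<open>64 - 2 * s\<close> are at least 32 for their inner product
  \<open>s\<close>, which is a multiple of 8.\<close>

lemma leech_min_inner:
  assumes "z \<in> leech_min" "z' \<in> leech_min" "z \<noteq> z'" "z \<noteq> (\<lambda>a. - z' a)"
  shows "(\<Sum>a\<in>UNIV. z a * z' a) \<in> {-16, -8, 0, 8, 16}"
proof -
  let ?s = "\<Sum>a\<in>UNIV. z a * z' a"
  have z: "z \<in> leech_int" "z' \<in> leech_int" "(\<Sum>a\<in>UNIV. (z a)\<^sup>2) = 32" "(\<Sum>a\<in>UNIV. (z' a)\<^sup>2) = 32"
    using assms by (auto simp: leech_min_def)
  have "(\<Sum>a\<in>UNIV. (z a - z' a)\<^sup>2) = 64 - 2 * ?s"
    using z by (simp add: power2_diff sum.distrib sum_subtractf sum_distrib_left mult.assoc)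
  moreover obtain a where "z a - z' a \<noteq> 0" using assms(3) by (auto simp: fun_eq_iff)
  ultimately have 1: "?s \<le> 16"
    using leech_int_min_norm[OF leech_int_diff[OF z(1,2)]] by fastforce
  have "(\<Sum>a\<in>UNIV. (z a - - z' a)\<^sup>2) = 64 + 2 * ?s"
    using z by (simp add: power2_sum sum.distrib sum_distrib_left mult.assoc)
  moreover obtain a where "z a - - z' a \<noteq> 0" using assms(4) by (auto simp: fun_eq_iff eq_neg_iff_add_eq_0)
  ultimately have 2: "?s \<ge> -16"
    using leech_int_min_norm[OF leech_int_diff[OF z(1) leech_int_minus[OF z(2)]]] by fastforce
  obtain k where "?s = 8 * k" using leech_int_inner[OF z(1,2)] by (elim dvdE)
  then show ?thesis using 1 2 by (simp; presburger)
qed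

section \<open>Three families of explicit minimal vectors\<close>

definition signed_support :: "int \<Rightarrow> 'a set \<times> 'a set \<Rightarrow> 'a \<Rightarrow> int" where
  "signed_support c PS a = (if a \<in> fst PS then if a \<in> snd PS then - c else c else 0)"

lemma inj_on_signed_support:
  assumes "c > 0"
  shows "inj_on (signed_support c) {(P, S). S \<subseteq> P}"
proof (rule inj_on_inverseI[where g = "\<lambda>z. ({a. z a \<noteq> 0}, {a. z a < 0})"])
  fix PS assume "PS \<in> {(P, S). S \<subseteq> (P :: 'a set)}"
  then show "({a. signed_support c PS a \<noteq> 0}, {a. signed_support c PS a < 0}) = PS"
    using assms by (auto simp: signed_support_def)
qed

lemma sum_square_signed_support:
  fixes PS :: "'a::finite set \<times> 'a set"
  shows "(\<Sum>a\<in>UNIV. (signed_support c PS a)\<^sup>2) = c\<^sup>2 * int (card (fst PS))"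
proof -
  have "(signed_support c PS a)\<^sup>2 = c\<^sup>2 * ind (fst PS) a" for a by (simp add: signed_support_def)
  then show ?thesis by (simp add: sum_distrib_left[symmetric] sum_bit)
qed

definition shape_2 :: "(23 option set \<times> 23 option set) set" where
  "shape_2 = Sigma {B\<in>golay_code. card B = 8} (\<lambda>B. {S. S \<subseteq> B \<and> even (card S)})"

definition shape_4 :: "(23 option set \<times> 23 option set) set" where
  "shape_4 = Sigma {P. card P = 2} Pow"

definition vector_3 :: "23 option \<times> 23 option set \<Rightarrow> 23 option \<Rightarrow> int" where
  "vector_3 pB a = (1 - 2 * ind (snd pB) a) * (if a = fst pB then -3 else 1)"

lemma shape_2_min: "PS \<in> shape_2 \<Longrightarrow> signed_support 2 PS \<in> leech_min"
proof -
  assume "PS \<in> shape_2"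
  then obtain B S where BS: "PS = (B, S)" "B \<in> golay_code" "card B = 8" "S \<subseteq> B" "even (card S)"
    by (auto simp: shape_2_def)
  have "signed_support 2 PS = (\<lambda>a. 0 + 2 * ind B a + 4 * (- ind S a))"
    using BS by (auto simp: signed_support_def fun_eq_iff)
  moreover have "even ((\<Sum>a\<in>UNIV. - ind S a) - 0)"
    using BS(5) by (simp add: sum_negf sum_bit)
  ultimately have "signed_support 2 PS \<in> leech_int" by (rule leech_intI[OF BS(2)])
  then show ?thesis using BS by (simp add: leech_min_def sum_square_signed_support)
qed

lemma shape_4_min: "PS \<in> shape_4 \<Longrightarrow> signed_support 4 PS \<in> leech_min"
proof -
  assume "PS \<in> shape_4"
  then obtain P S where PS: "PS = (P, S)" "card P = 2" "S \<subseteq> P" by (auto simp: shape_4_def)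
  have "signed_support 4 PS = (\<lambda>a. 0 + 2 * ind {} a + 4 * (ind P a - 2 * ind S a))"
    using PS by (auto simp: signed_support_def fun_eq_iff)
  moreover have "even ((\<Sum>a\<in>UNIV. ind P a - 2 * ind S a) - 0)"
    using PS(2) by (simp add: sum_subtractf sum_distrib_left[symmetric] sum_bit)
  ultimately have "signed_support 4 PS \<in> leech_int" by (rule leech_intI[OF golay_code_empty])
  then show ?thesis using PS by (simp add: leech_min_def sum_square_signed_support)
qed

lemma vector_3_min: "pB \<in> UNIV \<times> golay_code \<Longrightarrow> vector_3 pB \<in> leech_min"
proof -
  assume "pB \<in> UNIV \<times> golay_code"
  then obtain p B where pB: "pB = (p, B)" "B \<in> golay_code" by auto
  \<comment> \<open>The second term acts only at \<open>p\<close>, where it turns 1 into -3 off the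
    codeword and -1 into 3 on it.\<close>
  let ?w = "\<lambda>a. - ind B a - (if a = p then 1 - 2 * ind B p else 0)"
  have "vector_3 pB = (\<lambda>a. 1 + 2 * ind B a + 4 * ?w a)"
    using pB by (auto simp: vector_3_def fun_eq_iff)
  moreover have "even ((\<Sum>a\<in>UNIV. ?w a) - 1)"
  proof -
    have "(\<Sum>a\<in>UNIV. ?w a) = - int (card B) - (1 - 2 * ind B p)"
      by (simp add: sum_subtractf sum_negf sum_bit)
    moreover have "even (int (card B))"
      using golay_code_doubly_even[OF pB(2)] by (meson dvd_trans even_numeral even_of_nat_iff)
    ultimately show ?thesis by simp
  qed
  ultimately have "vector_3 pB \<in> leech_int" by (rule leech_intI[OF pB(2)])
  moreover have "(\<Sum>a\<in>UNIV. (vector_3 pB a)\<^sup>2) = 32"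
  proof -
    have "(vector_3 pB a)\<^sup>2 = 1 + (if a = p then 8 else 0)" for a
      using pB by (simp add: vector_3_def)
    then show ?thesis by (simp add: sum.distrib)
  qed
  ultimately show ?thesis by (simp add: leech_min_def)
qed

text \<open>The entry of absolute value 3 recovers the point, after which the signs recover the
  codeword.\<close>

lemma inj_vector_3: "inj vector_3"
proof (rule injI)
  fix x y assume eq: "vector_3 x = vector_3 y"
  have "\<bar>vector_3 x a\<bar> = 3 \<longleftrightarrow> a = fst x" for x a by (simp add: vector_3_def)
  then have p: "fst x = fst y" using eq by metis
  have "(vector_3 x a < 0) = ((a \<in> snd x) \<noteq> (a = fst x))" for x a by (auto simp: vector_3_def)
  then have "snd x = snd y" using eq p by (metis set_eqI)
  then show "x = y" using p by (simp add: prod_eq_iff)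
qed

lemma card_even_subsets_8:
  assumes "card (B :: 'a::finite set) = 8"
  shows "card {S. S \<subseteq> B \<and> even (card S)} = 128"
proof -
  have "card {S. S \<subseteq> B \<and> even (card S)} = card {S. S \<subseteq> B \<and> odd (card S)}"
    using card_subsupersets_even_odd[of B "{}"] assms by fastforce
  moreover have "card (Pow B) = card {S. S \<subseteq> B \<and> even (card S)} + card {S. S \<subseteq> B \<and> odd (card S)}"
    by (subst card_Un_disjoint[symmetric]) (auto intro: arg_cong[where f = card])
  moreover have "card (Pow B) = 256" using assms by (simp add: card_Pow)
  ultimately show ?thesis by simp
qed

text \<open>\<open>759 * 128 + 1104 + 24 * 4096 = 196560\<close>. Parity separates the third family
  from the others, and the size of the nonzero entries separates the first two.\<close>

theorem card_leech_min: "card leech_min \<ge> 196560"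
proof -
  have 1: "card (signed_support 2 ` shape_2) = 759 * 128"
  proof -
    have "inj_on (signed_support 2) shape_2"
      using inj_on_signed_support[of 2] by (rule inj_on_subset) (auto simp: shape_2_def)
    moreover have "card shape_2 = (\<Sum>B\<in>{B\<in>golay_code. card B = 8}. 128)"
      unfolding shape_2_def by (subst card_SigmaI) (auto simp: card_even_subsets_8)
    ultimately show ?thesis using golay_card(2) by (simp add: card_image)
  qed
  have 2: "card (signed_support 4 ` shape_4) = 1104"
  proof -
    have "inj_on (signed_support 4) shape_4"
      using inj_on_signed_support[of 4] by (rule inj_on_subset) (auto simp: shape_4_def)
    moreover have "card shape_4 = (\<Sum>P\<in>{P :: 23 option set. card P = 2}. 4)"
      unfolding shape_4_def by (subst card_SigmaI) (auto simp: card_Pow)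
    moreover have "card {P :: 23 option set. card P = 2} = 276"
      using n_subsets[of "UNIV :: 23 option set" 2] by (simp add: choose_two)
    ultimately show ?thesis by (simp add: card_image)
  qed
  have 3: "card (vector_3 ` (UNIV \<times> golay_code)) = 24 * 4096"
  proof -
    have "card (vector_3 ` (UNIV \<times> golay_code)) = card ((UNIV :: 23 option set) \<times> golay_code)"
      by (intro card_image inj_on_subset[OF inj_vector_3]) simp
    then show ?thesis using golay_card(1) by (simp add: card_cartesian_product)
  qed
  have sep24: "signed_support 2 ` shape_2 \<inter> signed_support 4 ` shape_4 = {}"
  proof -
    have "signed_support 2 PS \<noteq> signed_support 4 QS" if "QS \<in> shape_4" for PS QS :: "23 option set \<times> 23 option set"
    proof
      assume eq: "signed_support 2 PS = signed_support 4 QS"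
      have "fst QS \<noteq> {}" using that by (auto simp: shape_4_def)
      then obtain a where "a \<in> fst QS" by blast
      then show False using fun_cong[OF eq, of a] by (auto simp: signed_support_def split: if_splits)
    qed
    then show ?thesis by blast
  qed
  have odd: "odd (vector_3 pB a)" for pB a by (simp add: vector_3_def)
  have ev: "even (signed_support 2 PS a)" "even (signed_support 4 PS a)" for PS and a :: "23 option"
    by (simp_all add: signed_support_def)
  have sep3: "(signed_support 2 ` shape_2 \<union> signed_support 4 ` shape_4) \<inter> vector_3 ` (UNIV \<times> golay_code) = {}"
  proof -
    have "signed_support 2 PS \<noteq> vector_3 pB" "signed_support 4 PS \<noteq> vector_3 pB" for PS pB
      using odd ev by metis+
    then show ?thesis by blast
  qed
  have "196560 = card (signed_support 2 ` shape_2 \<union> signed_support 4 ` shape_4 \<union> vector_3 ` (UNIV \<times> golay_code))"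
    using sep24 sep3 1 2 3 by (simp add: card_Un_disjoint)
  also have "\<dots> \<le> card leech_min"
    using shape_2_min shape_4_min vector_3_min by (intro card_mono finite_leech_min) blast
  finally show ?thesis .
qed

section \<open>Rescaling to the unit sphere\<close>

definition leech_vector :: "(23 option \<Rightarrow> int) \<Rightarrow> real^(23 option)" where
  "leech_vector z = (1 / sqrt 8) *\<^sub>R (\<chi> a. of_int (z a))"

lemma leech_lattice_eq: "leech_lattice = leech_vector ` leech_int"
  by (auto simp: leech_lattice_def leech_vector_def leech_int_def)

lemma inner_leech_vector: "leech_vector z \<bullet> leech_vector z' = of_int (\<Sum>a\<in>UNIV. z a * z' a) / 8"
proof -
  have "leech_vector z \<bullet> leech_vector z' = (\<Sum>a\<in>UNIV. of_int (z a * z' a) / 8)"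
    unfolding leech_vector_def inner_vec_def by (intro sum.cong refl) (simp add: field_simps)
  then show ?thesis by (simp add: sum_divide_distrib)
qed

lemma norm_leech_vector: "(norm (leech_vector z))\<^sup>2 = of_int (\<Sum>a\<in>UNIV. (z a)\<^sup>2) / 8"
  unfolding power2_norm_eq_inner inner_leech_vector by (simp add: power2_eq_square)

lemma inj_leech_vector: "inj leech_vector"
  by (rule injI) (auto simp: leech_vector_def vec_eq_iff fun_eq_iff)

lemma leech_vector_eq_0: "leech_vector z = 0 \<longleftrightarrow> z = (\<lambda>a. 0)"
  by (auto simp: leech_vector_def vec_eq_iff fun_eq_iff)

lemma minimal_vectors_leech: "minimal_vectors leech_lattice = leech_vector ` leech_min"
proof -
  have ge: "norm (leech_vector z) \<ge> 2" if z: "z \<in> leech_int" "leech_vector z \<noteq> 0" for z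
  proof -
    obtain a where "z a \<noteq> 0" using z(2) by (auto simp: leech_vector_eq_0)
    then have "(\<Sum>a\<in>UNIV. (z a)\<^sup>2) \<ge> 32" using leech_int_min_norm z(1) by blast
    then have "(of_int 32 :: real) \<le> of_int (\<Sum>a\<in>UNIV. (z a)\<^sup>2)" by (simp only: of_int_le_iff)
    then have "(norm (leech_vector z))\<^sup>2 \<ge> 2\<^sup>2" unfolding norm_leech_vector by simp
    then show ?thesis by (rule power2_le_imp_le) simp
  qed
  have eq: "norm (leech_vector z) = 2 \<longleftrightarrow> (\<Sum>a\<in>UNIV. (z a)\<^sup>2) = 32" for z
  proof -
    have "norm (leech_vector z) = 2 \<longleftrightarrow> (norm (leech_vector z))\<^sup>2 = 2\<^sup>2"
      by (rule power2_eq_iff_nonneg[symmetric]) simp_all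
    also have "\<dots> \<longleftrightarrow> (of_int (\<Sum>a\<in>UNIV. (z a)\<^sup>2) :: real) = of_int 32" unfolding norm_leech_vector by simp
    finally show ?thesis unfolding of_int_eq_iff .
  qed
  have "leech_min \<noteq> {}" using card_leech_min by auto
  then obtain z0 where z0: "z0 \<in> leech_min" by blast
  then have z0': "leech_vector z0 \<in> leech_lattice - {0}" "norm (leech_vector z0) = 2"
    using eq[of z0] by (auto simp: leech_min_def leech_lattice_eq)
  show ?thesis
  proof (intro equalityI subsetI)
    fix v assume v: "v \<in> minimal_vectors leech_lattice"
    then obtain z where z: "v = leech_vector z" "z \<in> leech_int" "v \<noteq> 0"
      by (auto simp: minimal_vectors_def leech_lattice_eq)
    have "norm v \<le> norm (leech_vector z0)" using v z0'(1) unfolding minimal_vectors_def by blast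
    then have "norm v \<le> 2" using z0'(2) by simp
    then have "norm v = 2" using ge[of z] z by simp
    then show "v \<in> leech_vector ` leech_min" using z eq[of z] by (auto simp: leech_min_def)
  next
    fix v assume "v \<in> leech_vector ` leech_min"
    then obtain z where z: "v = leech_vector z" "z \<in> leech_int" "norm v = 2"
      using eq by (auto simp: leech_min_def)
    then have "v \<in> leech_lattice - {0}" by (auto simp: leech_lattice_eq)
    moreover have "norm v \<le> norm w" if "w \<in> leech_lattice - {0}" for w
      using that ge z(3) by (auto simp: leech_lattice_eq)
    ultimately show "v \<in> minimal_vectors leech_lattice" by (simp add: minimal_vectors_def)
  qed
qed

lemma leech_kissing_eq: "leech_kissing = (\<lambda>z. leech_vector z /\<^sub>R 2) ` leech_min"
proof -
  have "norm (leech_vector z) = 2" if "z \<in> leech_min" for z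
  proof -
    have "(norm (leech_vector z))\<^sup>2 = 2\<^sup>2" unfolding norm_leech_vector using that by (simp add: leech_min_def)
    then show ?thesis by (simp only: power2_eq_iff_nonneg norm_ge_zero zero_le_numeral)
  qed
  then show ?thesis unfolding leech_kissing_def minimal_vectors_leech image_image by (intro image_cong) auto
qed

theorem leech_kissing_configuration:
  shows "finite leech_kissing" "card leech_kissing \<ge> 196560"
    "\<And>x. x \<in> leech_kissing \<Longrightarrow> norm x = 1"
    "\<And>x. x \<in> leech_kissing \<Longrightarrow> - x \<in> leech_kissing"
    "\<And>x y. x \<in> leech_kissing \<Longrightarrow> y \<in> leech_kissing \<Longrightarrow> y \<noteq> x \<Longrightarrow> y \<noteq> - x \<Longrightarrow>
      x \<bullet> y \<in> {-1/2, -1/4, 0, 1/4, 1/2}"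
proof -
  let ?k = "\<lambda>z. leech_vector z /\<^sub>R 2"
  have inner: "?k z \<bullet> ?k z' = of_int (\<Sum>a\<in>UNIV. z a * z' a) / 32" for z z'
    by (simp add: inner_leech_vector)
  have minus: "?k (\<lambda>a. - z a) = - ?k z" for z by (simp add: leech_vector_def vec_eq_iff)
  show "finite leech_kissing" unfolding leech_kissing_eq using finite_leech_min by simp
  have inj: "inj ?k" using inj_leech_vector by (auto simp: inj_on_def)
  have "card leech_kissing = card leech_min"
    unfolding leech_kissing_eq by (rule card_image[OF inj_on_subset[OF inj subset_UNIV]])
  then show "card leech_kissing \<ge> 196560" using card_leech_min by simp
  show "norm x = 1" if x: "x \<in> leech_kissing" for x
  proof -
    obtain z where z: "x = ?k z" "z \<in> leech_min" using x unfolding leech_kissing_eq by blast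
    have "(\<Sum>a\<in>UNIV. z a * z a) = 32" using z(2) by (simp add: leech_min_def power2_eq_square)
    then have "x \<bullet> x = 1" unfolding z(1) inner by simp
    then show ?thesis by (simp add: norm_eq_sqrt_inner)
  qed
  show "- x \<in> leech_kissing" if x: "x \<in> leech_kissing" for x
  proof -
    obtain z where z: "x = ?k z" "z \<in> leech_min" using x unfolding leech_kissing_eq by blast
    have "(\<lambda>a. - z a) \<in> leech_min" using z(2) leech_int_minus by (simp add: leech_min_def)
    then show ?thesis unfolding z(1) minus[symmetric] leech_kissing_eq by blast
  qed
  show "x \<bullet> y \<in> {-1/2, -1/4, 0, 1/4, 1/2}"
    if xy: "x \<in> leech_kissing" "y \<in> leech_kissing" "y \<noteq> x" "y \<noteq> - x" for x y
  proof -
    obtain z where z: "x = ?k z" "z \<in> leech_min" using xy(1) unfolding leech_kissing_eq by blast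
    obtain z' where z': "y = ?k z'" "z' \<in> leech_min" using xy(2) unfolding leech_kissing_eq by blast
    have "z \<noteq> z'" using xy(3) z z' by auto
    moreover have "z \<noteq> (\<lambda>a. - z' a)" using xy(4) z z' minus[of z'] by auto
    ultimately have "(\<Sum>a\<in>UNIV. z a * z' a) \<in> {-16, -8, 0, 8, 16}" using leech_min_inner z(2) z'(2) by blast
    then show ?thesis unfolding z(1) z'(1) inner by (auto simp del: of_int_sum of_int_mult)
  qed
qed

section \<open>Designs and distance invariance\<close>

text \<open>It suffices to compare volumes of boxes. Their preimages are orthogonal images, whose
  Lebesgue measure is known, and Lebesgue and Borel measure agree on Borel sets.\<close>

lemma distr_lborel_orthogonal:
  fixes f :: "real^'n::{finite,wellorder} \<Rightarrow> real^'n::_"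
  assumes f: "orthogonal_transformation f"
  shows "distr lborel borel f = lborel"
proof (rule lborel_eqI[symmetric])
  fix l u :: "real^'n::_" assume le: "\<And>b. b \<in> Basis \<Longrightarrow> l \<bullet> b \<le> u \<bullet> b"
  have lin: "linear f" using f by (simp add: orthogonal_transformation_def)
  have [measurable]: "f \<in> borel_measurable borel"
    using lin by (intro borel_measurable_continuous_onI linear_continuous_on linear_conv_bounded_linear[THEN iffD1])
  have inv: "orthogonal_transformation (inv f)" using f by (rule orthogonal_transformation_inv)
  have vim: "f -` box l u = inv f ` box l u"
    using f by (intro bij_vimage_eq_inv_image orthogonal_transformation_bij)
  have lm: "box l u \<in> lmeasurable" by simp
  have m: "f -` box l u \<in> lmeasurable" "measure lebesgue (f -` box l u) = measure lebesgue (box l u)"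
    unfolding vim by (rule measurable_orthogonal_image[OF inv lm], rule measure_orthogonal_image[OF inv lm])
  have b: "f -` box l u \<in> sets borel"
    using measurable_sets_borel[of f borel "box l u"] by simp
  have "emeasure (distr lborel borel f) (box l u) = emeasure lborel (f -` box l u)"
    by (simp add: emeasure_distr)
  also have "\<dots> = emeasure lebesgue (f -` box l u)" using b by simp
  also have "\<dots> = ennreal (measure lebesgue (box l u))"
    using emeasure_eq_measure2[OF m(1)] m(2) by simp
  also have "\<dots> = emeasure lborel (box l u)" using emeasure_eq_measure2[OF lm] by simp
  also have "\<dots> = (\<Prod>b\<in>Basis. (u - l) \<bullet> b)" using le by (rule emeasure_lborel_box)
  finally show "emeasure (distr lborel borel f) (box l u) = (\<Prod>b\<in>Basis. (u - l) \<bullet> b)" .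
qed simp

text \<open>An orthogonal map preserves the unit ball and commutes with \<open>sgn\<close>, so the
  invariance of volume passes to the sphere.\<close>

lemma distr_sphere_measure_orthogonal:
  fixes f :: "real^'n::{finite,wellorder} \<Rightarrow> real^'n::_"
  assumes f: "orthogonal_transformation f"
  shows "distr sphere_measure borel f = sphere_measure"
proof -
  let ?B = "ball 0 1 :: (real^'n::_) set"
  let ?U = "uniform_measure lborel ?B"
  have lin: "linear f" using f by (simp add: orthogonal_transformation_def)
  have meas [measurable]: "f \<in> borel_measurable borel"
    using lin by (intro borel_measurable_continuous_onI linear_continuous_on linear_conv_bounded_linear[THEN iffD1])
  have nf: "norm (f x) = norm x" for x using f by (rule orthogonal_transformation_norm)
  have U: "distr ?U borel f = ?U"
  proof (rule measure_eqI)
    fix A assume "A \<in> sets (distr ?U borel f)"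
    then have A [measurable]: "A \<in> sets borel" by simp
    have fA [measurable]: "f -` A \<in> sets borel" using measurable_sets_borel[OF meas A] .
    have eq: "?B \<inter> f -` A = f -` (?B \<inter> A)" using nf by auto
    have "emeasure (distr ?U borel f) A = emeasure ?U (f -` A)" by (simp add: emeasure_distr)
    also have "\<dots> = emeasure lborel (f -` (?B \<inter> A)) / emeasure lborel ?B"
      by (simp add: eq)
    also have "emeasure lborel (f -` (?B \<inter> A)) = emeasure (distr lborel borel f) (?B \<inter> A)"
      by (subst emeasure_distr) auto
    also have "\<dots> = emeasure lborel (?B \<inter> A)" by (simp only: distr_lborel_orthogonal[OF f])
    finally show "emeasure (distr ?U borel f) A = emeasure ?U A" by simp
  qed simp
  have sgn [measurable]: "(sgn :: real^'n::_ \<Rightarrow> real^'n::_) \<in> borel_measurable borel" by (rule borel_measurable_sgn)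
  have comm: "f \<circ> sgn = sgn \<circ> f"
    by (rule ext) (simp add: sgn_div_norm nf linear_scale[OF lin])
  have "distr sphere_measure borel f = distr ?U borel (f \<circ> sgn)"
    unfolding sphere_measure_def by (subst distr_distr) simp_all
  also have "\<dots> = distr (distr ?U borel f) borel sgn"
    unfolding comm by (subst distr_distr) simp_all
  finally show ?thesis unfolding U sphere_measure_def .
qed

text \<open>Some orthogonal map takes \<open>x\<close> to \<open>y\<close>, and the measure is
  invariant under it.\<close>

lemma sphere_measure_zonal:
  fixes x y :: "real^'n::{finite,wellorder}"
  assumes "norm x = 1" "norm y = 1" and P: "P \<in> borel_measurable borel"
  shows "(\<integral>z. P (x \<bullet> z) \<partial>sphere_measure) = (\<integral>z. P (y \<bullet> z) \<partial>sphere_measure :: real)"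
proof -
  note [measurable] = P
  obtain f where f: "orthogonal_transformation f" "f x = y"
    using orthogonal_transformation_exists_1[OF assms(1,2)] by blast
  have lin: "linear f" using f by (simp add: orthogonal_transformation_def)
  have meas [measurable]: "f \<in> borel_measurable borel"
    using lin by (intro borel_measurable_continuous_onI linear_continuous_on linear_conv_bounded_linear[THEN iffD1])
  have sets: "sets sphere_measure = sets (borel :: (real^'n::_) measure)" by (simp add: sphere_measure_def)
  have "(\<integral>z. P (y \<bullet> z) \<partial>sphere_measure) = (\<integral>z. P (y \<bullet> z) \<partial>(distr sphere_measure borel f))"
    by (simp only: distr_sphere_measure_orthogonal[OF f(1)])
  also have "\<dots> = (\<integral>z. P (y \<bullet> f z) \<partial>sphere_measure)"
    by (intro integral_distr) (simp_all add: measurable_cong_sets[OF sets refl])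
  also have "\<dots> = (\<integral>z. P (x \<bullet> z) \<partial>sphere_measure)"
    using f by (simp add: orthogonal_transformation_def flip: f(2))
  finally show ?thesis ..
qed

section \<open>Polynomial functions of bounded degree\<close>

lemma polynomials_upto_const: "(\<lambda>_. c) \<in> polynomials_upto d"
  unfolding polynomials_upto_def
  by (rule CollectI, rule exI[of _ "{\<lambda>_. 0}"], rule exI[of _ "\<lambda>_. c"]) simp

lemma polynomials_upto_add:
  assumes "p \<in> polynomials_upto d" "q \<in> polynomials_upto d"
  shows "(\<lambda>x. p x + q x) \<in> polynomials_upto d"
proof -
  obtain A a where A: "finite A" "\<forall>\<alpha>\<in>A. (\<Sum>i\<in>UNIV. \<alpha> i) \<le> d"
    "p = (\<lambda>x. \<Sum>\<alpha>\<in>A. a \<alpha> * (\<Prod>i\<in>UNIV. (x $ i) ^ \<alpha> i))"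
    using assms(1) unfolding polynomials_upto_def by blast
  obtain B b where B: "finite B" "\<forall>\<alpha>\<in>B. (\<Sum>i\<in>UNIV. \<alpha> i) \<le> d"
    "q = (\<lambda>x. \<Sum>\<alpha>\<in>B. b \<alpha> * (\<Prod>i\<in>UNIV. (x $ i) ^ \<alpha> i))"
    using assms(2) unfolding polynomials_upto_def by blast
  let ?c = "\<lambda>\<alpha>. (if \<alpha> \<in> A then a \<alpha> else 0) + (if \<alpha> \<in> B then b \<alpha> else 0)"
  let ?m = "\<lambda>x \<alpha>. \<Prod>i\<in>UNIV. (x $ i) ^ \<alpha> i"
  have "(\<Sum>\<alpha>\<in>A \<union> B. ?c \<alpha> * ?m x \<alpha>) = p x + q x" for x
  proof -
    have "(\<Sum>\<alpha>\<in>A \<union> B. ?c \<alpha> * ?m x \<alpha>) = (\<Sum>\<alpha>\<in>A \<union> B. (if \<alpha> \<in> A then a \<alpha> * ?m x \<alpha> else 0))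
        + (\<Sum>\<alpha>\<in>A \<union> B. (if \<alpha> \<in> B then b \<alpha> * ?m x \<alpha> else 0))"
      unfolding sum.distrib[symmetric] by (intro sum.cong refl) (simp add: distrib_right)
    also have "\<dots> = p x + q x"
      using A(1) B(1) by (simp add: sum.If_cases A(3) B(3) Int_absorb1 Int_absorb2)
    finally show ?thesis .
  qed
  then show ?thesis unfolding polynomials_upto_def using A B
    by (intro CollectI exI[of _ "A \<union> B"] exI[of _ ?c]) auto
qed

lemma polynomials_upto_scale:
  assumes "p \<in> polynomials_upto d"
  shows "(\<lambda>x. r * p x) \<in> polynomials_upto d"
proof -
  obtain A a where A: "finite A" "\<forall>\<alpha>\<in>A. (\<Sum>i\<in>UNIV. \<alpha> i) \<le> d"
    "p = (\<lambda>x. \<Sum>\<alpha>\<in>A. a \<alpha> * (\<Prod>i\<in>UNIV. (x $ i) ^ \<alpha> i))"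
    using assms(1) unfolding polynomials_upto_def by blast
  then show ?thesis unfolding polynomials_upto_def
    by (intro CollectI exI[of _ A] exI[of _ "\<lambda>\<alpha>. r * a \<alpha>"]) (simp add: sum_distrib_left mult.assoc)
qed

lemma polynomials_upto_mono: "d \<le> e \<Longrightarrow> p \<in> polynomials_upto d \<Longrightarrow> p \<in> polynomials_upto e"
  unfolding polynomials_upto_def by fastforce

lemma polynomials_upto_coordinate:
  fixes p :: "real^'n \<Rightarrow> real"
  assumes "p \<in> polynomials_upto d"
  shows "(\<lambda>x. x $ i * p x) \<in> polynomials_upto (Suc d)"
proof -
  obtain A a where A: "finite A" "\<forall>\<alpha>\<in>A. (\<Sum>i\<in>UNIV. \<alpha> i) \<le> d"
    "p = (\<lambda>x. \<Sum>\<alpha>\<in>A. a \<alpha> * (\<Prod>i\<in>UNIV. (x $ i) ^ \<alpha> i))"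
    using assms(1) unfolding polynomials_upto_def by blast
  let ?up = "\<lambda>\<alpha> :: 'n \<Rightarrow> nat. \<alpha>(i := Suc (\<alpha> i))" and ?down = "\<lambda>\<alpha> :: 'n \<Rightarrow> nat. \<alpha>(i := \<alpha> i - 1)"
  have du: "?down (?up \<alpha>) = \<alpha>" for \<alpha> by auto
  have inj: "inj_on ?up A" by (rule inj_on_inverseI[where g = ?down]) (rule du)
  have mon: "(\<Prod>j\<in>UNIV. (x $ j) ^ (?up \<alpha>) j) = x $ i * (\<Prod>j\<in>UNIV. (x $ j) ^ \<alpha> j)" for x :: "real^'n" and \<alpha>
  proof -
    have "(\<Prod>j\<in>UNIV - {i}. (x $ j) ^ (?up \<alpha>) j) = (\<Prod>j\<in>UNIV - {i}. (x $ j) ^ \<alpha> j)"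
      by (rule prod.cong) auto
    then show ?thesis by (simp add: prod.remove[of UNIV i])
  qed
  have "(\<Sum>\<alpha>\<in>?up ` A. a (?down \<alpha>) * (\<Prod>j\<in>UNIV. (x $ j) ^ \<alpha> j)) = x $ i * p x" for x
    unfolding sum.reindex[OF inj] comp_def mon du A(3) sum_distrib_left
    by (intro sum.cong refl) simp
  then have "(\<lambda>x. x $ i * p x) = (\<lambda>x. \<Sum>\<alpha>\<in>?up ` A. a (?down \<alpha>) * (\<Prod>j\<in>UNIV. (x $ j) ^ \<alpha> j))"
    by (simp only: fun_eq_iff) simp
  moreover have "\<forall>\<alpha>\<in>?up ` A. (\<Sum>j\<in>UNIV. \<alpha> j) \<le> Suc d"
    using A(2) by (simp add: sum_upd_Suc del: fun_upd_apply)
  moreover have "finite (?up ` A)" using A(1) by simp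
  ultimately show ?thesis unfolding polynomials_upto_def
    by (intro CollectI exI[of _ "?up ` A"] exI[of _ "\<lambda>\<alpha>. a (?down \<alpha>)"] conjI)
qed

lemma polynomials_upto_times_affine:
  fixes p :: "real^'n \<Rightarrow> real"
  assumes "p \<in> polynomials_upto d"
  shows "(\<lambda>z. (x \<bullet> z - r) * p z) \<in> polynomials_upto (Suc d)"
proof -
  have "(\<lambda>z. \<Sum>i\<in>I. x $ i * (z $ i * p z)) \<in> polynomials_upto (Suc d)" for I
  proof (induction I rule: infinite_finite_induct)
    case (insert i I)
    then show ?case
      using polynomials_upto_add[OF polynomials_upto_scale[OF polynomials_upto_coordinate[OF assms]]] by simp
  qed (simp_all add: polynomials_upto_const)
  moreover have "(\<lambda>z. (- r) * p z) \<in> polynomials_upto (Suc d)"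
    using assms by (intro polynomials_upto_scale polynomials_upto_mono[of d "Suc d"]) simp_all
  ultimately have "(\<lambda>z. (\<Sum>i\<in>UNIV. x $ i * (z $ i * p z)) + (- r) * p z) \<in> polynomials_upto (Suc d)"
    by (rule polynomials_upto_add)
  moreover have "(\<Sum>i\<in>UNIV. x $ i * (z $ i * p z)) + (- r) * p z = (x \<bullet> z - r) * p z" for z
    by (simp add: inner_vec_def left_diff_distrib sum_distrib_right mult.assoc)
  ultimately show ?thesis by (simp only:)
qed

lemma polynomials_upto_zonal:
  assumes "finite R"
  shows "(\<lambda>z. \<Prod>r\<in>R. x \<bullet> z - r) \<in> polynomials_upto (card R)"
  using assms
proof (induction R rule: finite_induct)
  case (insert r R)
  then show ?case using polynomials_upto_times_affine[OF insert.IH] by simp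
qed (simp add: polynomials_upto_const)

text \<open>Apply the design property to the Lagrange basis polynomials of the set of distances.\<close>
theorem design_distance_invariant:
  fixes C :: "(real^'n::{finite,wellorder}) set"
  assumes des: "spherical_design d C" and fin: "finite (inner_products C)"
    and card: "card (inner_products C) \<le> d"
  shows "distance_invariant C"
  unfolding distance_invariant_def
proof (intro ballI)
  fix t x x' assume t: "t \<in> inner_products C" and x: "x \<in> C" "x' \<in> C"
  have C: "finite C" "\<And>y. y \<in> C \<Longrightarrow> norm y = 1"
    using des by (auto simp: spherical_design_def spherical_code_def)
  have "card C \<noteq> 0" using x C(1) by auto
  \<comment> \<open>Including 1 makes \<open>q\<close> vanish at the base point itself, and leaving
    out \<open>t\<close> compensates, so the degree of \<open>q\<close> stays within the strength of
    the design.\<close>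
  define R where "R = insert 1 (inner_products C) - {t}"
  have R: "finite R" "t \<notin> R" using fin by (auto simp: R_def)
  have "t \<noteq> 1" using t C(2) unit_inner_ne_1 by (fastforce simp: inner_products_def)
  then have "R = insert 1 (inner_products C - {t})" by (auto simp: R_def)
  then have "card R \<le> Suc (card (inner_products C - {t}))" using fin by (simp add: card_insert_if)
  then have cR: "card R \<le> d" using card_Suc_Diff1[OF fin t] card by simp
  define q where "q s = (\<Prod>r\<in>R. s - r)" for s :: real
  have q0: "q t \<noteq> 0" using R by (auto simp: q_def)
  have key: "real (card {y\<in>C. w \<bullet> y = t}) * q t = real (card C) * (\<integral>z. q (w \<bullet> z) \<partial>sphere_measure)"
    if w: "w \<in> C" for w
  proof -
    have "(\<lambda>z. q (w \<bullet> z)) \<in> polynomials_upto d"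
      unfolding q_def using polynomials_upto_mono[OF cR polynomials_upto_zonal[OF R(1)]] .
    then have "(\<Sum>y\<in>C. q (w \<bullet> y)) / real (card C) = (\<integral>z. q (w \<bullet> z) \<partial>sphere_measure)"
      using des unfolding spherical_design_def by blast
    moreover have "(\<Sum>y\<in>C. q (w \<bullet> y)) = (\<Sum>y\<in>C. if w \<bullet> y = t then q t else 0)"
    proof (intro sum.cong refl)
      fix y assume y: "y \<in> C"
      have "w \<bullet> y \<in> insert 1 (inner_products C)"
        using w y C(2)[OF y] by (cases "w = y") (auto simp: inner_products_def dot_square_norm)
      then show "q (w \<bullet> y) = (if w \<bullet> y = t then q t else 0)"
        using R(1) by (auto simp: q_def R_def)
    qed
    moreover have "\<dots> = real (card {y\<in>C. w \<bullet> y = t}) * q t"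
      using C(1) by (simp add: sum.If_cases Int_def conj_commute)
    ultimately show ?thesis using \<open>card C \<noteq> 0\<close> by (simp add: field_simps)
  qed
  have "q \<in> borel_measurable borel" unfolding q_def by measurable
  then have "(\<integral>z. q (x \<bullet> z) \<partial>sphere_measure) = (\<integral>z. q (x' \<bullet> z) \<partial>sphere_measure)"
    using x C(2) by (intro sphere_measure_zonal) auto
  then have "real (card {y\<in>C. x \<bullet> y = t}) * q t = real (card {y\<in>C. x' \<bullet> y = t}) * q t"
    using key x by simp
  then show "card {y\<in>C. x \<bullet> y = t} = card {y\<in>C. x' \<bullet> y = t}" using q0 by simp
qed

lemma energy_of_distribution:
  fixes C :: "(real^23) set"
  assumes C: "spherical_code C" "card C = 93150"
    and ip: "inner_products C = {-1, -1/2, -1/4, 0, 1/4, 1/2}"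
    and dist: "has_distance_distribution C [1, 2464, 22528, 43164, 22528, 2464]"
  shows "energy h C = 93150 * design_energy h"
proof -
  let ?T = "{-1, -1/2, -1/4, 0, 1/4, 1/2 :: real}"
  have fin: "finite C" using C by (simp add: spherical_code_def)
  have "sorted_list_of_set ?T = [-1, -1/2, -1/4, 0, 1/4, 1/2]"
    using sorted_list_of_set.idem_if_sorted_distinct[of "[-1, -1/2, -1/4, 0, 1/4, 1/2 :: real]"] by simp
  then have A: "card {y\<in>C. x \<bullet> y = -1} = 1" "card {y\<in>C. x \<bullet> y = -1/2} = 2464" "card {y\<in>C. x \<bullet> y = -1/4} = 22528"
    "card {y\<in>C. x \<bullet> y = 0} = 43164" "card {y\<in>C. x \<bullet> y = 1/4} = 22528" "card {y\<in>C. x \<bullet> y = 1/2} = 2464"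
    if "x \<in> C" for x
    using dist that unfolding has_distance_distribution_def ip by auto
  have "(\<Sum>y\<in>C - {x}. h (x \<bullet> y)) = design_energy h" if x: "x \<in> C" for x
  proof -
    have "x \<bullet> x = 1" using x C by (auto simp: spherical_code_def dot_square_norm)
    then have eq: "{y\<in>C - {x}. x \<bullet> y = t} = {y\<in>C. x \<bullet> y = t}" if "t \<noteq> 1" for t using that by auto
    have "x \<bullet> y \<in> ?T" if "y \<in> C - {x}" for y
      using that x unfolding ip[symmetric] inner_products_def by blast
    then have "(\<Sum>y\<in>C - {x}. h (x \<bullet> y)) = (\<Sum>t\<in>?T. real (card {y\<in>C - {x}. x \<bullet> y = t}) * h t)"
      using fin by (intro sum_by_values) auto
    also have "\<dots> = (\<Sum>t\<in>?T. real (card {y\<in>C. x \<bullet> y = t}) * h t)"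
      by (intro sum.cong refl) (subst eq, auto)
    also have "\<dots> = design_energy h"
      using A[OF x] by (simp add: design_energy_def algebra_simps)
    finally show ?thesis .
  qed
  then show ?thesis using C(2) by (simp add: energy_def)
qed

section \<open>The code orthogonal to a minimal vector of the Leech lattice\<close>

interpretation leech: kissing_configuration leech_kissing
  by unfold_locales (use leech_kissing_configuration in auto)

lemma inner_linear_isometry:
  fixes \<phi> :: "'a::real_inner \<Rightarrow> 'b::real_inner"
  assumes "linear \<phi>" "\<And>u. norm (\<phi> u) = norm u"
  shows "\<phi> u \<bullet> \<phi> v = u \<bullet> v"
  unfolding dot_norm linear_add[OF assms(1), symmetric] assms(2) ..

text \<open>\<open>\<phi>\<close> maps the code bijectively onto the section and preserves inner
  products, so the counts made in dimension 24 carry over.\<close>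

lemma leech_section_code:
  fixes x :: "real^(23 option)" and \<phi> :: "real^23 \<Rightarrow> real^(23 option)"
  assumes x: "x \<in> leech_kissing" and \<phi>: "hyperplane_coordinates x \<phi>"
  defines "C \<equiv> \<phi> -` leech_section x"
  shows "spherical_code C" "card C = 93150"
    "inner_products C \<subseteq> {-1, -1/2, -1/4, 0, 1/4, 1/2}" "energy h C = 93150 * design_energy h"
proof -
  let ?S = "leech_section x"
  have S: "?S = {y\<in>leech_kissing. x \<bullet> y = 0}" by (simp add: leech_section_def)
  have lin: "linear \<phi>" and norm: "\<And>u. norm (\<phi> u) = norm u" and range: "range \<phi> = {y. x \<bullet> y = 0}"
    using \<phi> by (auto simp: hyperplane_coordinates_def)
  note inner = inner_linear_isometry[OF lin norm]
  have inj: "inj \<phi>"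
    unfolding linear_injective_0[OF lin] using norm by (metis norm_eq_zero)
  have "?S \<subseteq> range \<phi>" unfolding range S by auto
  then have bij: "bij_betw \<phi> C ?S"
    unfolding C_def by (auto simp: bij_betw_def inj_on_subset[OF inj])
  have fin: "finite ?S" using leech.finite_L by (simp add: S)
  have finC: "finite C" using bij fin bij_betw_finite by blast
  show "spherical_code C"
  proof -
    have "norm u = 1" if "u \<in> C" for u
      using leech.norm_L[of "\<phi> u"] norm[of u] that by (simp add: C_def S)
    then show ?thesis using finC by (auto simp: spherical_code_def)
  qed
  show card: "card C = 93150"
    using bij_betw_same_card[OF bij] leech.card_section[OF x] by (simp add: S)
  show "inner_products C \<subseteq> {-1, -1/2, -1/4, 0, 1/4, 1/2}"
  proof
    fix t assume "t \<in> inner_products C"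
    then obtain u v where uv: "u \<in> C" "v \<in> C" "u \<noteq> v" "t = \<phi> u \<bullet> \<phi> v"
      by (auto simp: inner_products_def inner)
    have L: "\<phi> u \<in> leech_kissing" "\<phi> v \<in> leech_kissing" using uv by (auto simp: C_def S)
    have ne: "\<phi> v \<noteq> \<phi> u" using uv(3) inj by (auto dest: injD)
    show "t \<in> {-1, -1/2, -1/4, 0, 1/4, 1/2}"
    proof (cases "\<phi> v = - \<phi> u")
      case True
      then show ?thesis using uv(4) leech.self_L[OF L(1)] by simp
    next
      case False
      then show ?thesis using leech.inner_L[OF L ne] uv(4) by blast
    qed
  qed
  have "(\<Sum>v\<in>C - {u}. h (u \<bullet> v)) = design_energy h" if u: "u \<in> C" for u
  proof -
    have "bij_betw \<phi> (C - {u}) (?S - {\<phi> u})"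
      using bij image_set_diff[OF inj, of C "{u}"] by (simp add: bij_betw_def inj_on_subset[OF inj])
    then have "(\<Sum>v\<in>C - {u}. h (\<phi> u \<bullet> \<phi> v)) = (\<Sum>z\<in>?S - {\<phi> u}. h (\<phi> u \<bullet> z))"
      by (rule sum.reindex_bij_betw)
    also have "\<dots> = design_energy h"
      unfolding S design_energy_def using u by (intro leech.section_distribution[OF x]) (auto simp: C_def S)
    finally show ?thesis by (simp add: inner)
  qed
  then show "energy h C = 93150 * design_energy h"
    using card by (simp add: energy_def)
qed

theorem theorem7p3:
  fixes T :: "real set"
  assumes "T \<in> {{-1/2<..<-1/4} \<union> {1/4<..<1/2},
                {-1/4<..<0} \<union> {1/4<..<1/2},
                {-1/2<..<-1/4} \<union> {0<..<1/4}}"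
  shows
    "(\<forall>h. absolutely_monotone h \<and> (\<forall>t\<in>{-1<..<1}. (deriv ^^ 8) h t > 0) \<longrightarrow>
        min_energy TYPE(23) h 93150 T =
          93150 * (2464 * (h (-1/2) + h (1/2)) + 22528 * (h (-1/4) + h (1/4))
                   + 43164 * h 0 + h (-1)) \<and>
        (\<forall>C :: (real^23) set. spherical_code C \<and> avoiding T C \<and> card C = 93150 \<longrightarrow>
          energy h C \<ge> min_energy TYPE(23) h 93150 T \<and>
          (spherical_design 7 C \<and> inner_products C = {-1, -1/2, -1/4, 0, 1/4, 1/2} \<longrightarrow>
            distance_invariant C \<and>
            (has_distance_distribution C [1, 2464, 22528, 43164, 22528, 2464] \<longrightarrow>
              energy h C = min_energy TYPE(23) h 93150 T)))) \<and>
     (\<forall>x\<in>leech_kissing. \<forall>\<phi> :: real^23 \<Rightarrow> real^(23 option).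
        hyperplane_coordinates x \<phi> \<longrightarrow> universally_optimal T (\<phi> -` leech_section x))"
proof (intro conjI allI impI ballI)
  let ?V = "\<lambda>h :: real \<Rightarrow> real. 93150 * (2464 * (h (-1/2) + h (1/2)) + 22528 * (h (-1/4) + h (1/4)) + 43164 * h 0 + h (-1))"
  have V: "?V h = 93150 * design_energy h" for h by (simp add: design_energy_def)
  have bound: "energy h C \<ge> 93150 * design_energy h"
    if "absolutely_monotone h" "spherical_code C" "avoiding T C" "card C = 93150" for h and C :: "(real^23) set"
    using energy_lower_bound[OF assms that] .
  have section_avoiding: "avoiding T (\<phi> -` leech_section x)"
    if "x \<in> leech_kissing" "hyperplane_coordinates x \<phi>" for x and \<phi> :: "real^23 \<Rightarrow> real^(23 option)"
  proof -
    have "{-1, -1/2, -1/4, 0, 1/4, 1/2} \<inter> T = {}" using assms by auto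
    then show ?thesis using leech_section_code(3)[OF that] unfolding avoiding_def by blast
  qed
  \<comment> \<open>The section of any one minimal vector attains the lower bound, so the bound is a
    genuine least element.\<close>
  have min: "min_energy TYPE(23) h 93150 T = ?V h" if h: "absolutely_monotone h" for h
  proof -
    have "leech_kissing \<noteq> {}" using leech.card_L_ge by auto
    then obtain x where x: "x \<in> leech_kissing" by blast
    then have "x \<noteq> 0" using leech.norm_L[OF x] by auto
    then obtain \<phi> :: "real^23 \<Rightarrow> real^(23 option)" where \<phi>: "hyperplane_coordinates x \<phi>"
      using hyperplane_coordinates_exist by blast
    note C = leech_section_code[OF x \<phi>]
    show ?thesis
      unfolding min_energy_def V
    proof (rule Least_equality)
      show "\<exists>C :: (real^23) set. spherical_code C \<and> avoiding T C \<and> card C = 93150 \<and>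
          93150 * design_energy h = energy h C"
        using C(1,2) C(4)[of h] section_avoiding[OF x \<phi>] by metis
    qed (use bound[OF h] in auto)
  qed
  {
    fix h assume h: "absolutely_monotone h \<and> (\<forall>t\<in>{-1<..<1}. (deriv ^^ 8) h t > 0)"
    then show "min_energy TYPE(23) h 93150 T = ?V h" using min by blast
    fix C :: "(real^23) set" assume C: "spherical_code C \<and> avoiding T C \<and> card C = 93150"
    then show "min_energy TYPE(23) h 93150 T \<le> energy h C"
      using min[of h] bound[of h C] h unfolding V by simp
    assume des: "spherical_design 7 C \<and> inner_products C = {-1, -1/2, -1/4, 0, 1/4, 1/2}"
    have "card {-1, -1/2, -1/4, 0, 1/4, 1/2 :: real} \<le> 7" by (simp add: card_insert_if)
    then show "distance_invariant C"
      using des by (intro design_distance_invariant[of 7]) auto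
    assume "has_distance_distribution C [1, 2464, 22528, 43164, 22528, 2464]"
    then have "energy h C = 93150 * design_energy h"
      using C des by (intro energy_of_distribution) auto
    then show "energy h C = min_energy TYPE(23) h 93150 T"
      using min[of h] h unfolding V by simp
  }
  fix x and \<phi> :: "real^23 \<Rightarrow> real^(23 option)"
  assume x: "x \<in> leech_kissing" "hyperplane_coordinates x \<phi>"
  note C = leech_section_code[OF x]
  show "universally_optimal T (\<phi> -` leech_section x)"
    unfolding universally_optimal_def
    using C(1,2,4) section_avoiding[OF x] bound by simp
qed

end
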